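(* Let $d\geq 1$ be an integer, let $s>\frac32$ and let $v_0\in H^s(\mathbb{R})$. Assume that for some point $x_0\in\mathbb{R}$ $$v_0'(x_0)<-\frac{1}{\sqrt d}\,|v_0(x_0)|.$$ Let $u_0(x)=v_0(x_1+x_2+\cdots+x_d)\,\vec e$ for $x=(x_1,\dots,x_d)\in\mathbb{R}^d$, where $\vec e=(1,\dots,1)\in\mathbb{R}^d$. Then the corresponding solution $u$ of the Euler--Poincaré equations $$\partial_tm+u\cdot\nabla m+(\nabla u)^{\top}\cdot m+(\mathrm{div}\,u)\,m=0,\quad m=(1-\Delta)u,\quad (t,x)\in\mathbb{R}^+\times\mathbb{R}^d,\qquad u(0,x)=u_0(x),$$ blows up in finite time.
   Context: Component-wise, the Euler--Poincaré equations read $\partial_tm_i+\sum_{j=1}^du_j\partial_{x_j}m_i+\sum_{j=1}^d(\partial_{x_i}u_j)m_j+m_i\sum_{j=1}^d\partial_{x_j}u_j=0$ for $i=1,\dots,d$. For $v_0\in H^s(\mathbb{R})$, $s>\frac32$, the Cauchy problem $$\partial_tv+d\,v\,\partial_xv=-\partial_x(1-d\,\partial_x^2)^{-1}\Big(d\,v^2+\frac{d^2}{2}(\partial_xv)^2\Big),\qquad v(0,x)=v_0(x),\quad x\in\mathbb{R},$$ where $(1-d\,\partial_x^2)^{-1}f=p_d*f$ with $p_d(x)=\frac{1}{2\sqrt d}\,e^{-|x|/\sqrt d}$, has a unique strong solution $v\in C([0,T);H^s(\mathbb{R}))\cap C^1([0,T);H^{s-1}(\mathbb{R}))$ on a maximal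 time interval $[0,T)$, $0<T\le\infty$. This equation is equivalent to $\partial_tn+d\,v\,\partial_xn+2d\,(\partial_xv)\,n=0$ with $n=(1-d\,\partial_x^2)v$. The solution of the Euler--Poincaré equations corresponding to $u_0(x)=v_0(x_1+\cdots+x_d)\vec e$ is $u(t,x)=v(t,x_1+\cdots+x_d)\,\vec e$, with $m(t,x)=n(t,x_1+\cdots+x_d)\,\vec e$, for $t\in[0,T)$; it blows up in finite time if the maximal existence time $T$ of $v$ is finite. Since $s>\frac32$, $v_0$ is (identified with) a $C^1$ function, so $v_0(x_0)$ and $v_0'(x_0)$ make sense pointwise. *)

theory Defs
  imports "HOL-Analysis.Analysis"
begin

section \<open>Sobolev spaces on the line\<close>

definition square_integrable :: "(real \<Rightarrow> 'b::euclidean_space) \<Rightarrow> bool" where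
  "square_integrable f \<longleftrightarrow>
     f \<in> borel_measurable borel \<and> integrable lborel (\<lambda>x. (norm (f x))\<^sup>2)"

text \<open>The Plancherel transform of a square integrable function: \<^term>\<open>F\<close> is the limit in the mean,
  as the cut-off \<^term>\<open>R\<close> tends to infinity, of the integrals of \<open>f(x) exp(-i x \<xi>)\<close> over \<open>[-R, R]\<close>.
  It is determined by \<^term>\<open>f\<close> up to a null set.\<close>

definition is_fourier_transform :: "(real \<Rightarrow> real) \<Rightarrow> (real \<Rightarrow> complex) \<Rightarrow> bool" where
  "is_fourier_transform f F \<longleftrightarrow>
     square_integrable f \<and> square_integrable F \<and>
     ((\<lambda>R::real. \<integral>\<^sup>+\<xi>. ennreal ((norm (F \<xi> -
          (LBINT x:{-R..R}. complex_of_real (f x) * cis (- (x * \<xi>)))))\<^sup>2) \<partial>lborel)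
        \<longlongrightarrow> 0) at_top"

text \<open>The square of the \<open>H\<^sup>s\<close> norm. As the transform is unique up to null sets, the infimum
  ranges over at most one value; it is \<open>\<infinity>\<close> if there is no transform.\<close>

definition sobolev_norm_sq :: "real \<Rightarrow> (real \<Rightarrow> real) \<Rightarrow> ennreal" where
  "sobolev_norm_sq s f =
     (INF F \<in> {F. is_fourier_transform f F}.
        \<integral>\<^sup>+\<xi>. ennreal ((1 + \<xi>\<^sup>2) powr s * (norm (F \<xi>))\<^sup>2) \<partial>lborel)"

text \<open>\<open>H\<^sup>s(\<real>)\<close> for \<open>s \<ge> 0\<close>, as a set of functions rather than of classes modulo null sets.\<close>

definition sobolev :: "real \<Rightarrow> (real \<Rightarrow> real) set" where
  "sobolev s = {f. square_integrable f \<and> sobolev_norm_sq s f < \<infinity>}"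

text \<open>\<open>C([0,T); H\<^sup>s(\<real>))\<close>. All uses have \<open>s > 1/2\<close>, so that every class in \<open>H\<^sup>s\<close> has exactly one
  continuous representative; \<^term>\<open>v t\<close> is required to be that representative.\<close>

definition continuous_into_sobolev ::
    "real \<Rightarrow> ereal \<Rightarrow> (real \<Rightarrow> real \<Rightarrow> real) \<Rightarrow> bool" where
  "continuous_into_sobolev s T v \<longleftrightarrow>
     (\<forall>t. 0 \<le> t \<and> ereal t < T \<longrightarrow>
        v t \<in> sobolev s \<and> continuous_on UNIV (v t) \<and>
        ((\<lambda>\<tau>. sobolev_norm_sq s (\<lambda>x. v \<tau> x - v t x)) \<longlongrightarrow> 0)
          (at t within {\<tau>. 0 \<le> \<tau> \<and> ereal \<tau> < T}))"

text \<open>\<^term>\<open>w\<close> is the time derivative of \<^term>\<open>v\<close> with respect to the \<open>H\<^sup>s\<close> norm on \<open>[0,T)\<close>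
  (one-sided at \<open>0\<close>).\<close>

definition has_sobolev_time_derivative ::
    "real \<Rightarrow> ereal \<Rightarrow> (real \<Rightarrow> real \<Rightarrow> real) \<Rightarrow> (real \<Rightarrow> real \<Rightarrow> real) \<Rightarrow> bool" where
  "has_sobolev_time_derivative s T v w \<longleftrightarrow>
     (\<forall>t. 0 \<le> t \<and> ereal t < T \<longrightarrow>
        ((\<lambda>\<tau>. sobolev_norm_sq s (\<lambda>x. (v \<tau> x - v t x) / (\<tau> - t) - w t x)) \<longlongrightarrow> 0)
          (at t within {\<tau>. 0 \<le> \<tau> \<and> ereal \<tau> < T}))"


section \<open>The scalar Cauchy problem\<close>

definition green_kernel :: "real \<Rightarrow> real \<Rightarrow> real" where
  "green_kernel d x = exp (- \<bar>x\<bar> / sqrt d) / (2 * sqrt d)"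

text \<open>The operator \<open>(1 - d \<partial>\<^sub>x\<^sup>2)\<^sup>-\<^sup>1\<close>.\<close>

definition inverse_helmholtz :: "real \<Rightarrow> (real \<Rightarrow> real) \<Rightarrow> real \<Rightarrow> real" where
  "inverse_helmholtz d f x = (\<integral>y. green_kernel d (x - y) * f y \<partial>lborel)"

text \<open>Strong solutions in \<open>C([0,T); H\<^sup>s) \<inter> C\<^sup>1([0,T); H\<^sup>s\<^sup>-\<^sup>1)\<close>. Both sides of the equation are continuous
  in \<^term>\<open>x\<close>, so equality in \<open>H\<^sup>s\<^sup>-\<^sup>1\<close> is equality at every point.\<close>

definition strong_solution ::
    "real \<Rightarrow> real \<Rightarrow> (real \<Rightarrow> real) \<Rightarrow> ereal \<Rightarrow> (real \<Rightarrow> real \<Rightarrow> real) \<Rightarrow> bool" where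
  "strong_solution d s v0 T v \<longleftrightarrow>
     0 < T \<and> v 0 = v0 \<and> continuous_into_sobolev s T v \<and>
     (\<exists>w. continuous_into_sobolev (s - 1) T w \<and> has_sobolev_time_derivative (s - 1) T v w \<and>
        (\<forall>t x. 0 \<le> t \<and> ereal t < T \<longrightarrow>
           w t x + d * v t x * deriv (v t) x =
           - deriv (inverse_helmholtz d
               (\<lambda>y. d * (v t y)\<^sup>2 + d\<^sup>2 / 2 * (deriv (v t) y)\<^sup>2)) x))"

text \<open>\<open>T\<close> is the maximal existence time: no strong solution on a longer interval continues
  \<^term>\<open>v\<close>. Blow-up in finite time, of \<^term>\<open>v\<close> and of the field \<open>v(t, x\<^sub>1 + \<dots> + x\<^sub>d) e\<close>, means
  \<open>T < \<infinity>\<close>.\<close>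

definition maximal_strong_solution ::
    "real \<Rightarrow> real \<Rightarrow> (real \<Rightarrow> real) \<Rightarrow> ereal \<Rightarrow> (real \<Rightarrow> real \<Rightarrow> real) \<Rightarrow> bool" where
  "maximal_strong_solution d s v0 T v \<longleftrightarrow>
     strong_solution d s v0 T v \<and>
     (\<forall>T' v'. strong_solution d s v0 T' v' \<and>
        (\<forall>t. 0 \<le> t \<and> ereal t < T \<and> ereal t < T' \<longrightarrow> v' t = v t) \<longrightarrow> T' \<le> T)"


section \<open>The Euler--Poincare equations\<close>

definition partial_deriv :: "'n \<Rightarrow> (real^'n \<Rightarrow> real) \<Rightarrow> real^'n::finite \<Rightarrow> real" where
  "partial_deriv k f x = deriv (\<lambda>h. f (x + h *\<^sub>R axis k 1)) 0"

primrec times_cont_diff :: "nat \<Rightarrow> (real^'n::finite \<Rightarrow> real) \<Rightarrow> bool" where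
  "times_cont_diff 0 f \<longleftrightarrow> continuous_on UNIV f"
| "times_cont_diff (Suc r) f \<longleftrightarrow>
     (\<forall>x. f differentiable (at x)) \<and> (\<forall>k. times_cont_diff r (partial_deriv k f))"

definition test_function :: "(real^'n::finite \<Rightarrow> real) \<Rightarrow> bool" where
  "test_function \<phi> \<longleftrightarrow> (\<forall>r. times_cont_diff r \<phi>) \<and> compact (closure {x. \<phi> x \<noteq> 0})"

text \<open>For \<open>u\<close> merely \<open>C\<^sup>1\<close> in space, \<open>m = (1 - \<Delta>)u\<close> is a distribution of order at most one. Its component
  \<open>m\<^sub>i\<close> acts on compactly supported \<open>C\<^sup>1\<close> functions \<open>\<psi>\<close> by \<open>\<integral> u\<^sub>i \<psi> + \<nabla>u\<^sub>i \<cdot> \<nabla>\<psi>\<close>.\<close>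

definition momentum :: "(real^'n \<Rightarrow> real^'n) \<Rightarrow> 'n \<Rightarrow> (real^'n::finite \<Rightarrow> real) \<Rightarrow> real" where
  "momentum u i \<psi> =
     (\<integral>x. u x $ i * \<psi> x +
        (\<Sum>k\<in>UNIV. partial_deriv k (\<lambda>y. u y $ i) x * partial_deriv k \<psi> x) \<partial>lborel)"

text \<open>\<open>u \<cdot> \<nabla>m\<^sub>i + (div u) m\<^sub>i = \<Sum>\<^sub>j \<partial>\<^sub>j(u\<^sub>j m\<^sub>i)\<close>, acting on a test function by
  \<open>- \<Sum>\<^sub>j \<langle>m\<^sub>i, u\<^sub>j \<partial>\<^sub>j\<phi>\<rangle>\<close>.\<close>

definition transport_term :: "(real^'n \<Rightarrow> real^'n) \<Rightarrow> 'n \<Rightarrow> (real^'n::finite \<Rightarrow> real) \<Rightarrow> real" where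
  "transport_term u i \<phi> =
     - (\<Sum>j\<in>UNIV. momentum u i (\<lambda>x. u x $ j * partial_deriv j \<phi> x))"

text \<open>\<open>((\<nabla>u)\<^sup>T m)\<^sub>i = \<Sum>\<^sub>j (\<partial>\<^sub>iu\<^sub>j) m\<^sub>j\<close>. Here \<open>\<partial>\<^sub>iu\<^sub>j\<close> is only continuous, and the
  product is given a meaning through
  \<open>(\<partial>\<^sub>iu\<^sub>j) \<Delta>u\<^sub>j = \<Sum>\<^sub>k \<partial>\<^sub>k(\<partial>\<^sub>iu\<^sub>j \<partial>\<^sub>ku\<^sub>j) - \<partial>\<^sub>i(\<Sum>\<^sub>k (\<partial>\<^sub>ku\<^sub>j)\<^sup>2) / 2\<close>.\<close>

definition stretching_term :: "(real^'n \<Rightarrow> real^'n) \<Rightarrow> 'n \<Rightarrow> (real^'n::finite \<Rightarrow> real) \<Rightarrow> real" where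
  "stretching_term u i \<phi> =
     (\<integral>x. (\<Sum>j\<in>UNIV.
        let D = (\<lambda>k. partial_deriv k (\<lambda>y. u y $ j) x) in
          D i * u x $ j * \<phi> x
          + (\<Sum>k\<in>UNIV. D i * D k * partial_deriv k \<phi> x)
          - (\<Sum>k\<in>UNIV. (D k)\<^sup>2) / 2 * partial_deriv i \<phi> x) \<partial>lborel)"

text \<open>Solutions of
  \<open>\<partial>\<^sub>tm + u \<cdot> \<nabla>m + (\<nabla>u)\<^sup>T m + (div u) m = 0\<close>, \<open>m = (1 - \<Delta>)u\<close>, \<open>u(0) = u\<^sub>0\<close> on
  \<open>[0,T)\<close>: the equation holds in the sense of distributions in space at every time.\<close>

definition euler_poincare_solution ::
    "ereal \<Rightarrow> (real^'n \<Rightarrow> real^'n) \<Rightarrow> (real \<Rightarrow> real^'n \<Rightarrow> real^'n::finite) \<Rightarrow> bool" where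
  "euler_poincare_solution T u0 u \<longleftrightarrow>
     u 0 = u0 \<and>
     (\<forall>t. 0 \<le> t \<and> ereal t < T \<longrightarrow>
        (\<forall>i. times_cont_diff 1 (\<lambda>x. u t x $ i)) \<and>
        (\<forall>i \<phi>. test_function \<phi> \<longrightarrow>
           ((\<lambda>\<tau>. momentum (u \<tau>) i \<phi>) has_real_derivative
              - (transport_term (u t) i \<phi> + stretching_term (u t) i \<phi>))
             (at t within {\<tau>. 0 \<le> \<tau> \<and> ereal \<tau> < T})))"

text \<open>The field \<open>x \<mapsto> f(x\<^sub>1 + \<dots> + x\<^sub>d) e\<close> with \<open>e = (1, \<dots>, 1)\<close>.\<close>

definition diagonal_field :: "(real \<Rightarrow> real) \<Rightarrow> real^'n::finite \<Rightarrow> real^'n" where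
  "diagonal_field f x = f (\<Sum>i\<in>UNIV. x $ i) *\<^sub>R (\<chi> i. 1)"

end

theory Submission
  imports Defs "HOL-Probability.Characteristic_Functions" "HOL-Probability.Sinc_Integral"
begin

text \<open>Write \<open>c = \<surd>d\<close>, let \<open>F = d v\<^sup>2 + (d\<^sup>2/2) v\<^sub>x\<^sup>2\<close> be the source and \<open>H = (1 - d \<partial>\<^sub>x\<^sup>2)\<^sup>-\<^sup>1 F\<close> the pressure, so that
  the scalar equation reads \<open>v\<^sub>t + d v v\<^sub>x = - H\<^sub>x\<close>. Follow a characteristic \<open>q' = d v(t, q)\<close> that starts at \<open>x0\<close>.
  Along it \<open>v\<close> changes at the rate \<open>- H\<^sub>x\<close> and, since \<open>H\<^sub>x\<^sub>x = (H - F)/d\<close>, the slope \<open>v\<^sub>x\<close> changes at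
  the rate \<open>(F - H)/d - d v\<^sub>x\<^sup>2\<close>. Splitting the kernel \<open>exp(- |x|/c) / (2c)\<close> at the origin gives
  \<open>H = L + R\<close> and \<open>H\<^sub>x = (R - L)/c\<close>, and both halves satisfy \<open>L, R \<ge> d v\<^sup>2/4\<close>
  (\<open>half_resolvent_lower_bound\<close>): \<open>exp(x/c) (L - d v\<^sup>2/4)\<close> tends to \<open>0\<close> at \<open>-\<infinity>\<close>, and its derivative is a
  nonnegative multiple of the square of \<open>v - c v\<^sub>x\<close>; the other half is its mirror image. Hence \<open>a = v - c v\<^sub>x\<close> and \<open>b = v + c v\<^sub>x\<close> obey
  \<open>a' \<ge> - (c/2) a b\<close> and \<open>b' \<le> (c/2) a b\<close>. The assumption on \<open>x0\<close> says \<open>a > 0 > b\<close> at time \<open>0\<close>; this persists, and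
  \<open>(1/a - 1/b)' \<le> - c\<close>, so the positive quantity \<open>1/a - 1/b\<close> is exhausted in finite time
  (\<open>riccati_pair_lifespan\<close>, \<open>lifespan_bound\<close>).

  At the regularity \<open>s > 3/2\<close> the second derivative \<open>v\<^sub>x\<^sub>x\<close> need not exist as a function, so the equation for
  \<open>v\<^sub>x\<close> cannot be obtained by differentiating the equation in \<open>x\<close>. Instead \<open>v\<^sub>x\<close> on the characteristic is the limit of the
  difference quotients of \<open>v\<close> between it and neighbouring characteristics. These quotients satisfy an
  equation that involves only \<open>v\<close> and the \<open>C\<^sup>1\<close> function \<open>H\<^sub>x\<close>, and the limit can be taken in its
  integrated form (\<open>slope_along_characteristic\<close>).

  What the argument uses of the Sobolev spaces is the embedding of \<open>H\<^sup>s\<close> into bounded \<open>C\<^sup>1\<close> functions, and of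
  \<open>H\<^sup>s\<^sup>-\<^sup>1\<close> into bounded continuous ones, with bounds of the sup norms by the Sobolev norm
  (\<open>sobolev_imp_bounded\<close>, \<open>sobolev_imp_C1\<close>). They follow from the Fourier inversion formula, proved by Gaussian
  summation. Thereby a strong solution is a classical one whose time regularity is uniform in space; the locale
  \<open>rod_solution\<close> collects these properties.

  That the diagonal field solves the Euler--Poincare equations weakly is a computation with plane waves
  \<open>g(x\<^sub>1 + \<dots> + x\<^sub>d)\<close>. Under the integral such a function moves derivatives off the test function
  (\<open>plane_wave_integral_by_parts\<close>), and it does not see in which coordinate direction the test function is
  differentiated (\<open>integral_plane_wave_partial_deriv_cong\<close>). With these two rules the weak form reduces to
  the scalar equation, the nonlocal term being removed by \<open>H - d H\<^sub>x\<^sub>x = F\<close>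
  (\<open>pressure_slope_helmholtz\<close>, \<open>momentum_equation\<close>).\<close>

section \<open>Fourier inversion\<close>

lemma integrable_inverse_1_plus_square_lborel:
  "integrable lborel (\<lambda>x::real. inverse (1 + x\<^sup>2))"
  using integrable_inverse_1_plus_square by (simp add: set_integrable_def)

lemma continuous_imp_set_integrable_Icc:
  fixes f :: "real \<Rightarrow> 'b::euclidean_space"
  shows "continuous_on UNIV f \<Longrightarrow> set_integrable lborel {a..b} f"
  by (rule borel_integrable_atLeastAtMost') (auto intro: continuous_on_subset)

text \<open>The characteristic function of the standard normal distribution, rescaled. The transform of the summation
  factor is \<open>2\<pi>\<close> times a probability density of width \<open>\<sigma>\<close>, which is the approximate identity used below.\<close>

lemma gaussian_fourier_transform:
  assumes "\<sigma> > 0"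
  shows "(\<integral>\<xi>. cis ((a - x) * \<xi>) * complex_of_real (exp (- (\<sigma> * \<xi>)\<^sup>2 / 2)) \<partial>lborel)
         = complex_of_real (2 * pi * normal_density a \<sigma> x)"
    and gaussian_integrable: "integrable lborel (\<lambda>\<xi>. exp (- (\<sigma> * \<xi>)\<^sup>2 / 2))"
proof -
  have std: "(\<integral>\<xi>. complex_of_real (std_normal_density \<xi>) * cis (z * \<xi>) \<partial>lborel)
      = complex_of_real (exp (- z\<^sup>2 / 2))" for z
  proof -
    have "char std_normal_distribution z
        = (\<integral>\<xi>. std_normal_density \<xi> *\<^sub>R iexp (z * \<xi>) \<partial>lborel)"
      unfolding char_def by (subst integral_density) (auto simp: normal_density_nonneg)
    thus ?thesis
      by (simp add: char_std_normal_distribution cis_conv_exp scaleR_conv_of_real)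
  qed
  have "(\<integral>\<xi>. complex_of_real (std_normal_density \<xi>) * cis ((a-x)/\<sigma> * \<xi>) \<partial>lborel)
      = \<bar>\<sigma>\<bar> *\<^sub>R (\<integral>\<xi>. complex_of_real (std_normal_density (0 + \<sigma>*\<xi>)) * cis ((a-x)/\<sigma> * (0+\<sigma>*\<xi>)) \<partial>lborel)"
    using assms by (intro lborel_integral_real_affine) auto
  also have "\<dots> = \<sigma> *\<^sub>R (\<integral>\<xi>. complex_of_real (1/sqrt(2*pi)) * (cis ((a - x) * \<xi>) * complex_of_real (exp (- (\<sigma> * \<xi>)\<^sup>2 / 2))) \<partial>lborel)"
  proof -
    have "(a - x) / \<sigma> * (0 + \<sigma> * \<xi>) = (a - x) * \<xi>" for \<xi> using assms by simp
    thus ?thesis using assms by (simp only: std_normal_density_def) (simp add: ac_simps)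
  qed
  also have "\<dots> = complex_of_real (\<sigma> / sqrt (2*pi)) * (\<integral>\<xi>. cis ((a - x) * \<xi>) * complex_of_real (exp (- (\<sigma> * \<xi>)\<^sup>2 / 2)) \<partial>lborel)"
    by (simp only: integral_mult_right_zero scaleR_conv_of_real) simp
  finally have "complex_of_real (\<sigma> / sqrt (2*pi)) * (\<integral>\<xi>. cis ((a - x) * \<xi>) * complex_of_real (exp (- (\<sigma> * \<xi>)\<^sup>2 / 2)) \<partial>lborel)
      = complex_of_real (exp (- ((a-x)/\<sigma>)\<^sup>2 / 2))" (is "?c * ?I = _")
    unfolding std by (rule sym)
  moreover have "?c \<noteq> 0" using assms by simp
  ultimately have "?I = complex_of_real (exp (- ((a-x)/\<sigma>)\<^sup>2 / 2)) / ?c"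
    by (simp add: field_simps)
  also have "\<dots> = complex_of_real (exp (- ((a-x)/\<sigma>)\<^sup>2 / 2) / (\<sigma> / sqrt (2*pi)))" by simp
  also have "exp (- ((a-x)/\<sigma>)\<^sup>2 / 2) / (\<sigma> / sqrt (2*pi)) = 2 * pi * normal_density a \<sigma> x"
  proof -
    have "sqrt (2 * pi * \<sigma>\<^sup>2) = sqrt (2*pi) * \<sigma>" using assms by (simp add: real_sqrt_mult)
    moreover have "2 * pi = sqrt (2*pi) * sqrt (2*pi)" by simp
    ultimately have "2 * pi / sqrt (2 * pi * \<sigma>\<^sup>2) = sqrt (2*pi) / \<sigma>"
      using assms by (smt (verit) mult_divide_mult_cancel_left pi_gt_zero real_sqrt_gt_zero)
    hence "2 * pi * (1 / sqrt (2 * pi * \<sigma>\<^sup>2)) = 1 / (\<sigma> / sqrt (2*pi))" by simp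
    hence "2 * pi * (1 / sqrt (2 * pi * \<sigma>\<^sup>2)) * exp (- ((a-x)/\<sigma>)\<^sup>2 / 2)
        = exp (- ((a-x)/\<sigma>)\<^sup>2 / 2) / (\<sigma> / sqrt (2*pi))" by simp
    moreover have "((a-x)/\<sigma>)\<^sup>2 / 2 = (x - a)\<^sup>2 / (2 * \<sigma>\<^sup>2)"
      by (simp add: power_divide power2_commute[of a x])
    ultimately show ?thesis by (simp add: normal_density_def mult.assoc)
  qed
  finally show "?I = complex_of_real (2 * pi * normal_density a \<sigma> x)" .
  have "integrable lborel (\<lambda>\<xi>. std_normal_density (0 + \<sigma> * \<xi>))"
    using assms by (intro lborel_integrable_real_affine) auto
  hence "integrable lborel (\<lambda>\<xi>. sqrt (2*pi) * std_normal_density (0 + \<sigma> * \<xi>))"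
    by (rule integrable_mult_right)
  thus "integrable lborel (\<lambda>\<xi>. exp (- (\<sigma> * \<xi>)\<^sup>2 / 2))"
    by (simp add: std_normal_density_def)
qed

text \<open>Since \<open>exp(- u) \<le> 1 / u\<close>. Off a neighbourhood of \<open>a\<close> the bound is square integrable and proportional to \<open>\<sigma>\<close>, which controls the tails of a function that is only square integrable.\<close>

lemma normal_density_le:
  assumes "\<sigma> > 0" "x \<noteq> a"
  shows "normal_density a \<sigma> x \<le> 2 * \<sigma> / (x - a)\<^sup>2"
proof -
  define u where "u = (x - a)\<^sup>2 / (2 * \<sigma>\<^sup>2)"
  have u: "u > 0" using assms by (simp add: u_def)
  have "exp (- u) \<le> 1 / u"
    using order_trans[OF _ exp_ge_add_one_self[of u], of u] u by (simp add: exp_minus field_simps)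
  have "1 \<le> sqrt (2 * pi)" using pi_gt3 by simp
  hence "\<sigma> \<le> sqrt (2 * pi * \<sigma>\<^sup>2)" using assms by (simp add: real_sqrt_mult)
  hence "1 / sqrt (2 * pi * \<sigma>\<^sup>2) \<le> 1 / \<sigma>" using assms by (intro divide_left_mono) auto
  hence "normal_density a \<sigma> x \<le> (1 / \<sigma>) * (1 / u)"
    unfolding normal_density_def using \<open>exp (- u) \<le> 1 / u\<close> assms u
    by (intro mult_mono) (auto simp: u_def)
  also have "\<dots> = 2 * \<sigma> / (x - a)\<^sup>2" using assms by (simp add: u_def field_simps power2_eq_square)
  finally show ?thesis .
qed

text \<open>A continuous square integrable function may be unbounded, so the mass near \<open>a\<close> and far from
  \<open>a\<close> are treated separately: near \<open>a\<close> the function is bounded and dominated convergence applies after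
  rescaling; far away \<open>normal_density_le\<close> and the inequality of the means give a bound proportional to \<open>\<sigma>\<close>.\<close>

lemma gaussian_approximate_identity:
  fixes f :: "real \<Rightarrow> real"
  assumes cont: "continuous_on UNIV f" and L2: "integrable lborel (\<lambda>x. (f x)\<^sup>2)"
  shows "integrable lborel (\<lambda>x. f x * normal_density a (inverse (real (Suc n))) x)"
    and "(\<lambda>n. \<integral>x. f x * normal_density a (inverse (real (Suc n))) x \<partial>lborel) \<longlonglongrightarrow> f a"
proof -
  define \<sigma> where "\<sigma> n = inverse (real (Suc n))" for n
  have s0: "\<sigma> n > 0" and s1: "\<sigma> n \<le> 1" for n by (auto simp: \<sigma>_def field_simps)
  have slim: "\<sigma> \<longlonglongrightarrow> 0" unfolding \<sigma>_def by (rule LIMSEQ_inverse_real_of_nat)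
  have meas[measurable]: "f \<in> borel_measurable borel"
    using cont by (rule borel_measurable_continuous_onI)
  define I where "I = {a-1..a+1}"
  have [measurable]: "I \<in> sets borel" by (simp add: I_def)
  have "compact (f ` I)" unfolding I_def
    by (intro compact_continuous_image continuous_on_subset[OF cont]) auto
  then obtain B where "\<forall>y \<in> f ` I. norm y \<le> B" using compact_imp_bounded bounded_iff by metis
  hence B: "\<And>x. x \<in> I \<Longrightarrow> \<bar>f x\<bar> \<le> B" by auto
  have B0: "B \<ge> 0" using B[of a] by (simp add: I_def)
  \<comment> \<open>The part on \<open>I\<close>; rescaling by \<open>\<sigma> n\<close> turns the shrinking densities into a fixed one.\<close>
  define A where "A n x = indicator I x * f x * normal_density a (\<sigma> n) x" for n x
  have Aint: "integrable lborel (A n)" for n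
  proof (rule Bochner_Integration.integrable_bound)
    show "integrable lborel (\<lambda>x. B * normal_density a (\<sigma> n) x)" using s0 by simp
    show "AE x in lborel. norm (A n x) \<le> norm (B * normal_density a (\<sigma> n) x)"
      using B B0 by (intro AE_I2) (auto simp: A_def abs_mult indicator_def intro!: mult_right_mono)
  qed (simp add: A_def[abs_def])
  have Alim: "(\<lambda>n. integral\<^sup>L lborel (A n)) \<longlonglongrightarrow> f a"
  proof -
    have eq: "integral\<^sup>L lborel (A n) = (\<integral>y. indicator I (a + \<sigma> n * y) * f (a + \<sigma> n * y) * std_normal_density y \<partial>lborel)" for n
    proof -
      have "integral\<^sup>L lborel (A n) = \<bar>\<sigma> n\<bar> *\<^sub>R (\<integral>y. A n (a + \<sigma> n * y) \<partial>lborel)"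
        using s0[of n] by (intro lborel_integral_real_affine) auto
      also have "\<dots> = (\<integral>y. \<sigma> n * A n (a + \<sigma> n * y) \<partial>lborel)" using s0[of n] by simp
      also have "(\<lambda>y. \<sigma> n * A n (a + \<sigma> n * y)) = (\<lambda>y. indicator I (a + \<sigma> n * y) * f (a + \<sigma> n * y) * std_normal_density y)"
        using s0[of n] by (auto simp: fun_eq_iff A_def normal_density_def real_sqrt_mult field_simps power_mult_distrib)
      finally show ?thesis .
    qed
    have "(\<lambda>n. \<integral>y. indicator I (a + \<sigma> n * y) * f (a + \<sigma> n * y) * std_normal_density y \<partial>lborel)
        \<longlonglongrightarrow> (\<integral>y. f a * std_normal_density y \<partial>lborel)"
    proof (rule integral_dominated_convergence[where w="\<lambda>y. B * std_normal_density y"])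
      show "AE y in lborel. norm (indicator I (a + \<sigma> n * y) * f (a + \<sigma> n * y) * std_normal_density y)
             \<le> B * std_normal_density y" for n
        using B B0 by (intro AE_I2) (auto simp: abs_mult indicator_def intro!: mult_right_mono)
      show "AE y in lborel. (\<lambda>n. indicator I (a + \<sigma> n * y) * f (a + \<sigma> n * y) * std_normal_density y)
               \<longlonglongrightarrow> f a * std_normal_density y"
      proof (intro AE_I2 tendsto_mult_right)
        fix y
        have l: "(\<lambda>n. a + \<sigma> n * y) \<longlonglongrightarrow> a + 0 * y" by (intro tendsto_intros slim)
        have "eventually (\<lambda>n. a + \<sigma> n * y \<in> {a-1<..<a+1}) sequentially"
          by (rule topological_tendstoD[OF l]) auto
        hence ev: "eventually (\<lambda>n. f (a + \<sigma> n * y) = indicator I (a + \<sigma> n * y) * f (a + \<sigma> n * y)) sequentially"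
          by eventually_elim (auto simp: I_def)
        have "(\<lambda>n. f (a + \<sigma> n * y)) \<longlonglongrightarrow> f a"
          using l cont by (intro isCont_tendsto_compose[of a f]) (auto simp: continuous_on_eq_continuous_at)
        thus "(\<lambda>n. indicator I (a + \<sigma> n * y) * f (a + \<sigma> n * y)) \<longlonglongrightarrow> f a"
          using ev by (rule Lim_transform_eventually)
      qed
    qed auto
    thus ?thesis by (simp add: eq)
  qed
  \<comment> \<open>The part off \<open>I\<close>; \<open>2 |f| / z\<^sup>2 \<le> f\<^sup>2 + 1 / z\<^sup>4\<close> yields an integrable majorant independent of \<open>n\<close>.\<close>
  define C where "C n x = indicator (- I) x * f x * normal_density a (\<sigma> n) x" for n x
  define W where "W x = (f x)\<^sup>2 + 2 * inverse (1 + (-a + 1 * x)\<^sup>2)" for x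
  have Wint: "integrable lborel W" unfolding W_def[abs_def]
    by (intro Bochner_Integration.integrable_add L2 integrable_mult_right
         lborel_integrable_real_affine[OF integrable_inverse_1_plus_square_lborel]) simp
  have Cb: "\<bar>C n x\<bar> \<le> \<sigma> n * W x" for n x
  proof (cases "x \<in> I")
    case True thus ?thesis using s0[of n] by (auto simp: C_def W_def intro!: mult_nonneg_nonneg)
  next
    case False
    define z where "z = x - a"
    have "1 \<le> \<bar>z\<bar>" using False by (auto simp: I_def z_def)
    hence z: "z\<^sup>2 \<ge> 1" using power_mono[of 1 "\<bar>z\<bar>" 2] by simp
    have "x \<noteq> a" using False by (auto simp: I_def)
    have "\<bar>C n x\<bar> = \<bar>f x\<bar> * normal_density a (\<sigma> n) x"
      using False by (simp add: C_def abs_mult)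
    also have "\<dots> \<le> \<bar>f x\<bar> * (2 * \<sigma> n / z\<^sup>2)"
      unfolding z_def by (intro mult_left_mono normal_density_le[OF s0 \<open>x \<noteq> a\<close>]) simp
    also have "\<dots> = \<sigma> n * (2 * \<bar>f x\<bar> * (1 / z\<^sup>2))" by simp
    also have "2 * \<bar>f x\<bar> * (1 / z\<^sup>2) \<le> \<bar>f x\<bar>\<^sup>2 + (1/z\<^sup>2)\<^sup>2" by (rule sum_squares_bound)
    also have "(1/z\<^sup>2)\<^sup>2 \<le> 1/z\<^sup>2"
    proof -
      have "0 < z\<^sup>2" using z by linarith
      hence "1/z\<^sup>2 \<le> 1" using z by (subst divide_le_eq_1_pos)
      thus ?thesis using power_decreasing[of 1 2 "1/z\<^sup>2"] by simp
    qed
    also have "1/z\<^sup>2 \<le> 2 / (1 + z\<^sup>2)"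
    proof -
      have "0 < z\<^sup>2" using z by linarith
      thus ?thesis using z by (intro frac_le_eq[THEN iffD2] divide_nonpos_pos mult_pos_pos) auto
    qed
    also have "\<dots> = 2 * inverse (1 + z\<^sup>2)" by (simp add: divide_inverse)
    finally show ?thesis using s0[of n] by (simp add: W_def z_def)
  qed
  have Cint: "integrable lborel (C n)" for n
  proof (rule Bochner_Integration.integrable_bound)
    show "integrable lborel (\<lambda>x. \<sigma> n * W x)" using Wint by simp
    show "AE x in lborel. norm (C n x) \<le> norm (\<sigma> n * W x)"
      using Cb by (intro AE_I2) (smt (verit, best) real_norm_def)
  qed (simp add: C_def[abs_def])
  have Clim: "(\<lambda>n. integral\<^sup>L lborel (C n)) \<longlonglongrightarrow> 0"
  proof (rule Lim_null_comparison)
    show "\<forall>\<^sub>F n in sequentially. norm (integral\<^sup>L lborel (C n)) \<le> \<sigma> n * integral\<^sup>L lborel W"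
    proof (intro always_eventually allI)
      fix n
      have "norm (integral\<^sup>L lborel (C n)) \<le> (\<integral>x. norm (C n x) \<partial>lborel)" by (rule integral_norm_bound)
      also have "\<dots> \<le> (\<integral>x. \<sigma> n * W x \<partial>lborel)"
        using Cint Wint Cb by (intro integral_mono) auto
      finally show "norm (integral\<^sup>L lborel (C n)) \<le> \<sigma> n * integral\<^sup>L lborel W" by simp
    qed
    show "(\<lambda>n. \<sigma> n * integral\<^sup>L lborel W) \<longlonglongrightarrow> 0" using tendsto_mult_left_zero[OF slim] by simp
  qed
  have split: "f x * normal_density a (\<sigma> n) x = A n x + C n x" for n x
    by (auto simp: A_def C_def indicator_def)
  show "integrable lborel (\<lambda>x. f x * normal_density a (inverse (real (Suc n))) x)"
    unfolding \<sigma>_def[symmetric] split using Aint Cint by (rule Bochner_Integration.integrable_add)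
  have "(\<integral>x. f x * normal_density a (\<sigma> n) x \<partial>lborel) = integral\<^sup>L lborel (A n) + integral\<^sup>L lborel (C n)" for n
    using Aint[of n] Cint[of n] by (simp add: split)
  thus "(\<lambda>n. \<integral>x. f x * normal_density a (inverse (real (Suc n))) x \<partial>lborel) \<longlonglongrightarrow> f a"
    using tendsto_add[OF Alim Clim] by (simp only: \<sigma>_def[symmetric] add_0_right)
qed

text \<open>Fubini's theorem for the truncated transforms, followed by the limit of the truncation. On the left the limit in
  the mean suffices, because the Gaussian weight is square integrable; on the right the truncation is dominated.\<close>

lemma fourier_transform_gaussian_duality:
  fixes f :: "real \<Rightarrow> real"
  assumes F: "is_fourier_transform f F" and Fint: "integrable lborel F"
    and cont: "continuous_on UNIV f" and \<sigma>: "\<sigma> > 0"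
    and fN: "integrable lborel (\<lambda>x. f x * normal_density a \<sigma> x)"
  shows "(\<integral>\<xi>. F \<xi> * (cis (a * \<xi>) * complex_of_real (exp (- (\<sigma> * \<xi>)\<^sup>2 / 2))) \<partial>lborel)
         = complex_of_real (2 * pi * (\<integral>x. f x * normal_density a \<sigma> x \<partial>lborel))"
proof -
  define \<gamma> where "\<gamma> \<xi> = exp (- (\<sigma> * \<xi>)\<^sup>2 / 2)" for \<xi> :: real
  define G where "G \<xi> = cis (a * \<xi>) * complex_of_real (\<gamma> \<xi>)" for \<xi>
  define K where "K = integral\<^sup>L lborel \<gamma>"
  define FR where "FR R \<xi> = (LBINT x:{-R..R}. complex_of_real (f x) * cis (- (x * \<xi>)))" for R \<xi>
  have g0: "\<gamma> \<xi> > 0" and g1: "\<gamma> \<xi> \<le> 1" for \<xi> by (auto simp: \<gamma>_def)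
  have gint: "integrable lborel \<gamma>" unfolding \<gamma>_def[abs_def] by (rule gaussian_integrable[OF \<sigma>])
  have K0: "K \<ge> 0" unfolding K_def using g0 by (intro integral_nonneg_AE AE_I2) (simp add: less_imp_le)
  have nG: "norm (G \<xi>) = \<gamma> \<xi>" for \<xi> using g0[of \<xi>] by (simp add: G_def norm_mult)
  have [measurable]: "f \<in> borel_measurable borel"
    using cont by (rule borel_measurable_continuous_onI)
  have [measurable]: "F \<in> borel_measurable borel"
    using F by (simp add: is_fourier_transform_def square_integrable_def)
  have [measurable]: "\<gamma> \<in> borel_measurable borel" by (simp add: \<gamma>_def[abs_def])
  have cism[measurable]: "cis \<in> borel_measurable borel"
    by (intro borel_measurable_continuous_onI continuous_intros)
  have [measurable]: "G \<in> borel_measurable borel" by (simp add: G_def[abs_def])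
  have Gint: "integrable lborel G"
    using nG g0 by (intro Bochner_Integration.integrable_bound[OF gint]) (auto simp: less_imp_le)
  have FRm[measurable]: "FR R \<in> borel_measurable borel" for R
    unfolding FR_def[abs_def] set_lebesgue_integral_def
    by (intro lborel.borel_measurable_lebesgue_integral) simp
  have fR: "integrable lborel (\<lambda>x. indicator {-R..R} x * f x)" for R
    using continuous_imp_set_integrable_Icc[OF cont, of "-R" R] by (simp add: set_integrable_def)
  have fRabs: "integrable lborel (\<lambda>x. indicator {-R..R} x * \<bar>f x\<bar>)" for R
    using integrable_norm[OF fR[of R]] by (simp add: abs_mult)
  have FRb: "norm (FR R \<xi>) \<le> (\<integral>x. indicator {-R..R} x * \<bar>f x\<bar> \<partial>lborel)" for R \<xi>
    unfolding FR_def set_lebesgue_integral_def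
    by (rule order_trans[OF integral_norm_bound]) (simp add: norm_mult)
  have FRG: "integrable lborel (\<lambda>\<xi>. FR R \<xi> * G \<xi>)" for R
  proof (rule Bochner_Integration.integrable_bound)
    show "integrable lborel (\<lambda>\<xi>. (\<integral>x. indicator {-R..R} x * \<bar>f x\<bar> \<partial>lborel) * \<gamma> \<xi>)"
      using gint by simp
    show "AE \<xi> in lborel. norm (FR R \<xi> * G \<xi>)
        \<le> norm ((\<integral>x. indicator {-R..R} x * \<bar>f x\<bar> \<partial>lborel) * \<gamma> \<xi>)"
      using FRb[of R] g0 nG
      by (intro AE_I2) (auto simp: norm_mult abs_mult less_imp_le intro!: mult_mono intro: order_trans[OF _ abs_ge_self])
  qed simp
  have FG: "integrable lborel (\<lambda>\<xi>. F \<xi> * G \<xi>)"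
    using g0 g1 nG by (intro Bochner_Integration.integrable_bound[OF Fint])
      (auto simp: norm_mult less_imp_le intro!: mult_right_le_one_le)
  \<comment> \<open>Cauchy--Schwarz in the form \<open>y \<gamma> \<le> y \<surd>\<gamma> \<le> \<mu> y\<^sup>2 + \<gamma> / \<mu>\<close>, with \<open>\<mu>\<close> so large that the second term is below \<open>e/2\<close>.\<close>
  have lim1: "((\<lambda>R. \<integral>\<xi>. FR R \<xi> * G \<xi> \<partial>lborel) \<longlongrightarrow> (\<integral>\<xi>. F \<xi> * G \<xi> \<partial>lborel)) at_top"
  proof (rule LIM_zero_cancel, rule tendstoI)
    fix e :: real assume e: "e > 0"
    define \<mu> where "\<mu> = (2 * K + 1) / e"
    have l0: "\<mu> > 0" and l1: "K / \<mu> < e / 2" using e K0 by (auto simp: \<mu>_def field_simps)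
    have "((\<lambda>R. \<integral>\<^sup>+\<xi>. ennreal ((norm (F \<xi> - FR R \<xi>))\<^sup>2) \<partial>lborel) \<longlongrightarrow> 0) at_top"
      using F by (simp add: is_fourier_transform_def FR_def)
    hence "\<forall>\<^sub>F R in at_top. (\<integral>\<^sup>+\<xi>. ennreal ((norm (F \<xi> - FR R \<xi>))\<^sup>2) \<partial>lborel) < ennreal (e / (2 * \<mu>))"
      by (rule order_tendstoD) (use e l0 in auto)
    thus "\<forall>\<^sub>F R in at_top. dist ((\<integral>\<xi>. FR R \<xi> * G \<xi> \<partial>lborel) - (\<integral>\<xi>. F \<xi> * G \<xi> \<partial>lborel)) 0 < e"
    proof eventually_elim
      case (elim R)
      have "ennreal (norm (\<integral>\<xi>. FR R \<xi> * G \<xi> - F \<xi> * G \<xi> \<partial>lborel))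
          \<le> (\<integral>\<^sup>+\<xi>. norm (FR R \<xi> * G \<xi> - F \<xi> * G \<xi>) \<partial>lborel)"
        by (intro integral_norm_bound_ennreal Bochner_Integration.integrable_diff FRG FG)
      also have "\<dots> \<le> (\<integral>\<^sup>+\<xi>. ennreal \<mu> * ennreal ((norm (F \<xi> - FR R \<xi>))\<^sup>2) + ennreal (\<gamma> \<xi> / \<mu>) \<partial>lborel)"
      proof (rule nn_integral_mono)
        fix \<xi>
        define y where "y = norm (F \<xi> - FR R \<xi>)"
        have "norm (FR R \<xi> * G \<xi> - F \<xi> * G \<xi>) = y * \<gamma> \<xi>"
          by (simp add: y_def left_diff_distrib[symmetric] norm_mult nG norm_minus_commute)
        also have "\<dots> \<le> y * sqrt (\<gamma> \<xi>)"
          using g0[of \<xi>] g1[of \<xi>] real_le_rsqrt[of "\<gamma> \<xi>" "\<gamma> \<xi>"]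
          by (intro mult_left_mono) (auto simp: y_def power2_eq_square mult_left_le)
        also have "\<dots> \<le> \<mu> * y\<^sup>2 + \<gamma> \<xi> / \<mu>"
        proof -
          have "2 * (sqrt \<mu> * y) * (sqrt (\<gamma> \<xi>) / sqrt \<mu>) \<le> (sqrt \<mu> * y)\<^sup>2 + (sqrt (\<gamma> \<xi>) / sqrt \<mu>)\<^sup>2"
            by (rule sum_squares_bound)
          hence "2 * (y * sqrt (\<gamma> \<xi>)) \<le> \<mu> * y\<^sup>2 + \<gamma> \<xi> / \<mu>"
            using l0 g0[of \<xi>] by (simp add: power_mult_distrib power_divide less_imp_le)
          moreover have "y * sqrt (\<gamma> \<xi>) \<ge> 0" using g0[of \<xi>] by (simp add: y_def)
          ultimately show ?thesis by linarith
        qed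
        finally show "ennreal (norm (FR R \<xi> * G \<xi> - F \<xi> * G \<xi>))
             \<le> ennreal \<mu> * ennreal ((norm (F \<xi> - FR R \<xi>))\<^sup>2) + ennreal (\<gamma> \<xi> / \<mu>)"
          using l0 g0[of \<xi>] by (simp add: y_def ennreal_mult'[symmetric] ennreal_plus[symmetric] del: ennreal_plus)
      qed
      also have "\<dots> = ennreal \<mu> * (\<integral>\<^sup>+\<xi>. ennreal ((norm (F \<xi> - FR R \<xi>))\<^sup>2) \<partial>lborel)
            + (\<integral>\<^sup>+\<xi>. ennreal (\<gamma> \<xi> / \<mu>) \<partial>lborel)"
        by (subst nn_integral_add) (auto simp: nn_integral_cmult)
      also have "(\<integral>\<^sup>+\<xi>. ennreal (\<gamma> \<xi> / \<mu>) \<partial>lborel) = ennreal (K / \<mu>)"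
        unfolding K_def using gint g0 l0
        by (subst nn_integral_eq_integral) (auto simp: less_imp_le)
      also have "ennreal \<mu> * (\<integral>\<^sup>+\<xi>. ennreal ((norm (F \<xi> - FR R \<xi>))\<^sup>2) \<partial>lborel)
          \<le> ennreal \<mu> * ennreal (e / (2 * \<mu>))"
        using less_imp_le[OF elim] by (intro mult_left_mono) auto
      also have "\<dots> = ennreal (e / 2)" using l0 e by (simp add: ennreal_mult[symmetric])
      also have "ennreal (e / 2) + ennreal (K / \<mu>) = ennreal (e / 2 + K / \<mu>)"
        using e K0 l0 by (simp add: ennreal_plus)
      finally have "ennreal (norm (\<integral>\<xi>. FR R \<xi> * G \<xi> - F \<xi> * G \<xi> \<partial>lborel)) \<le> ennreal (e / 2 + K / \<mu>)"
        by (simp add: add_right_mono)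
      hence "norm (\<integral>\<xi>. FR R \<xi> * G \<xi> - F \<xi> * G \<xi> \<partial>lborel) \<le> e / 2 + K / \<mu>"
        using e K0 l0 by (subst (asm) ennreal_le_iff) auto
      hence "norm (\<integral>\<xi>. FR R \<xi> * G \<xi> - F \<xi> * G \<xi> \<partial>lborel) < e" using l1 by linarith
      thus ?case by (simp add: dist_norm FRG FG)
    qed
  qed
  have fub: "(\<integral>\<xi>. FR R \<xi> * G \<xi> \<partial>lborel)
      = (\<integral>x. indicator {-R..R} x *\<^sub>R complex_of_real (2 * pi * (f x * normal_density a \<sigma> x)) \<partial>lborel)" for R
  proof -
    define h where "h x \<xi> = indicator {-R..R} x *\<^sub>R (complex_of_real (f x) * cis (- (x * \<xi>))) * G \<xi>" for x \<xi>
    have hm[measurable]: "case_prod h \<in> borel_measurable (lborel \<Otimes>\<^sub>M lborel)"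
      unfolding h_def by measurable
    have nh: "norm (h x \<xi>) = indicator {-R..R} x * \<bar>f x\<bar> * \<gamma> \<xi>" for x \<xi>
      by (simp add: h_def norm_mult nG)
    have "(\<integral>\<xi>. FR R \<xi> * G \<xi> \<partial>lborel) = (\<integral>\<xi>. (\<integral>x. h x \<xi> \<partial>lborel) \<partial>lborel)"
      unfolding FR_def set_lebesgue_integral_def h_def
      by (simp only: integral_mult_left_zero)
    also have "\<dots> = (\<integral>x. (\<integral>\<xi>. h x \<xi> \<partial>lborel) \<partial>lborel)"
    proof (intro lborel_pair.Fubini_integral lborel_pair.Fubini_integrable)
      show "integrable lborel (\<lambda>x. \<integral>y. norm (case (x, y) of (x, y) \<Rightarrow> h x y) \<partial>lborel)"
        using fRabs[of R] by (simp add: nh K_def)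
      show "AE x in lborel. integrable lborel (\<lambda>y. case (x, y) of (x, y) \<Rightarrow> h x y)"
      proof (intro AE_I2)
        fix x
        have "integrable lborel (\<lambda>\<xi>. indicator {-R..R} x * \<bar>f x\<bar> * \<gamma> \<xi>)" using gint by simp
        thus "integrable lborel (\<lambda>y. case (x, y) of (x, y) \<Rightarrow> h x y)"
        proof (rule Bochner_Integration.integrable_bound)
          have "h x \<in> borel_measurable lborel" by (simp add: h_def[abs_def])
          thus "(\<lambda>y. case (x, y) of (x, y) \<Rightarrow> h x y) \<in> borel_measurable lborel" by simp
        qed (use g0 in \<open>auto simp: nh abs_mult less_imp_le\<close>)
      qed
    qed (rule hm)
    also have "\<dots> = (\<integral>x. indicator {-R..R} x *\<^sub>R complex_of_real (2 * pi * (f x * normal_density a \<sigma> x)) \<partial>lborel)"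
    proof (rule Bochner_Integration.integral_cong[OF refl])
      fix x
      have "h x \<xi> = (indicator {-R..R} x *\<^sub>R complex_of_real (f x)) * (cis ((a - x) * \<xi>) * complex_of_real (\<gamma> \<xi>))" for \<xi>
        by (simp add: h_def G_def scaleR_conv_of_real cis_mult left_diff_distrib flip: mult.assoc)
      hence "(\<integral>\<xi>. h x \<xi> \<partial>lborel) = (indicator {-R..R} x *\<^sub>R complex_of_real (f x)) *
          (\<integral>\<xi>. cis ((a - x) * \<xi>) * complex_of_real (exp (- (\<sigma> * \<xi>)\<^sup>2 / 2)) \<partial>lborel)"
        by (simp add: \<gamma>_def)
      also have "\<dots> = indicator {-R..R} x *\<^sub>R complex_of_real (2 * pi * (f x * normal_density a \<sigma> x))"
        unfolding gaussian_fourier_transform[OF \<sigma>] by (simp add: mult_ac)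
      finally show "(\<integral>\<xi>. h x \<xi> \<partial>lborel) = indicator {-R..R} x *\<^sub>R complex_of_real (2 * pi * (f x * normal_density a \<sigma> x))" .
    qed
    finally show ?thesis .
  qed
  have lim2: "((\<lambda>R. \<integral>\<xi>. FR R \<xi> * G \<xi> \<partial>lborel) \<longlongrightarrow>
      (\<integral>x. complex_of_real (2 * pi * (f x * normal_density a \<sigma> x)) \<partial>lborel)) at_top"
    unfolding fub
  proof (rule integral_dominated_convergence_at_top[where w="\<lambda>x. norm (2 * pi * (f x * normal_density a \<sigma> x))"])
    show "integrable lborel (\<lambda>x. norm (2 * pi * (f x * normal_density a \<sigma> x)))"
      using fN by (intro integrable_norm integrable_mult_right)
    show "\<forall>\<^sub>F R in at_top. AE x in lborel.
        norm (indicator {-R..R} x *\<^sub>R complex_of_real (2 * pi * (f x * normal_density a \<sigma> x)))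
          \<le> norm (2 * pi * (f x * normal_density a \<sigma> x))"
      by (auto simp: indicator_def norm_mult abs_mult)
    show "AE x in lborel. ((\<lambda>R. indicator {-R..R} x *\<^sub>R complex_of_real (2 * pi * (f x * normal_density a \<sigma> x)))
       \<longlongrightarrow> complex_of_real (2 * pi * (f x * normal_density a \<sigma> x))) at_top"
    proof (intro AE_I2 tendsto_eventually)
      fix x :: real
      show "\<forall>\<^sub>F R in at_top. indicator {-R..R} x *\<^sub>R complex_of_real (2 * pi * (f x * normal_density a \<sigma> x))
          = complex_of_real (2 * pi * (f x * normal_density a \<sigma> x))"
        using eventually_ge_at_top[of "\<bar>x\<bar>"] by eventually_elim (auto simp: indicator_def)
    qed
  qed auto
  have "(\<integral>\<xi>. F \<xi> * G \<xi> \<partial>lborel) = (\<integral>x. complex_of_real (2 * pi * (f x * normal_density a \<sigma> x)) \<partial>lborel)"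
    by (rule tendsto_unique[OF _ lim1 lim2]) simp
  also have "\<dots> = complex_of_real (\<integral>x. 2 * pi * (f x * normal_density a \<sigma> x) \<partial>lborel)"
    by (rule integral_complex_of_real)
  finally show ?thesis by (simp add: G_def \<gamma>_def)
qed

text \<open>Let the width of the Gaussian tend to \<open>0\<close> in the duality: the summation factor tends to \<open>1\<close> on the left,
  and the right side is an approximate identity applied to \<open>f\<close>.\<close>

lemma fourier_inversion:
  fixes f :: "real \<Rightarrow> real"
  assumes F: "is_fourier_transform f F" and Fint: "integrable lborel F"
    and cont: "continuous_on UNIV f"
  shows "complex_of_real (2 * pi * f a) = (\<integral>\<xi>. F \<xi> * cis (a * \<xi>) \<partial>lborel)"
proof -
  define \<sigma> where "\<sigma> n = inverse (real (Suc n))" for n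
  have s0: "\<sigma> n > 0" for n by (auto simp: \<sigma>_def)
  have slim: "\<sigma> \<longlonglongrightarrow> 0" unfolding \<sigma>_def by (rule LIMSEQ_inverse_real_of_nat)
  have [measurable]: "F \<in> borel_measurable borel" using Fint by (auto dest: borel_measurable_integrable)
  have [measurable]: "cis \<in> borel_measurable borel"
    by (intro borel_measurable_continuous_onI continuous_intros)
  have L2: "integrable lborel (\<lambda>x. (f x)\<^sup>2)"
    using F by (simp add: is_fourier_transform_def square_integrable_def)
  have "(\<lambda>n. complex_of_real (2 * pi * (\<integral>x. f x * normal_density a (\<sigma> n) x \<partial>lborel)))
      \<longlonglongrightarrow> complex_of_real (2 * pi * f a)"
    unfolding \<sigma>_def by (intro tendsto_intros gaussian_approximate_identity[OF cont L2])
  moreover have "complex_of_real (2 * pi * (\<integral>x. f x * normal_density a (\<sigma> n) x \<partial>lborel))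
      = (\<integral>\<xi>. F \<xi> * (cis (a * \<xi>) * complex_of_real (exp (- (\<sigma> n * \<xi>)\<^sup>2 / 2))) \<partial>lborel)" for n
    using gaussian_approximate_identity(1)[OF cont L2, of a n]
    by (subst fourier_transform_gaussian_duality[OF F Fint cont s0]) (auto simp: \<sigma>_def)
  ultimately have l1: "(\<lambda>n. \<integral>\<xi>. F \<xi> * (cis (a * \<xi>) * complex_of_real (exp (- (\<sigma> n * \<xi>)\<^sup>2 / 2))) \<partial>lborel)
      \<longlonglongrightarrow> complex_of_real (2 * pi * f a)" by (simp only:)
  have l2: "(\<lambda>n. \<integral>\<xi>. F \<xi> * (cis (a * \<xi>) * complex_of_real (exp (- (\<sigma> n * \<xi>)\<^sup>2 / 2))) \<partial>lborel)
      \<longlonglongrightarrow> (\<integral>\<xi>. F \<xi> * cis (a * \<xi>) \<partial>lborel)"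
  proof (rule integral_dominated_convergence[where w="\<lambda>\<xi>. norm (F \<xi>)"])
    show "AE \<xi> in lborel. (\<lambda>n. F \<xi> * (cis (a * \<xi>) * complex_of_real (exp (- (\<sigma> n * \<xi>)\<^sup>2 / 2))))
        \<longlonglongrightarrow> F \<xi> * cis (a * \<xi>)"
      by (intro AE_I2) (auto intro!: tendsto_eq_intros slim)
    show "AE \<xi> in lborel. norm (F \<xi> * (cis (a * \<xi>) * complex_of_real (exp (- (\<sigma> n * \<xi>)\<^sup>2 / 2)))) \<le> norm (F \<xi>)" for n
      by (intro AE_I2) (auto simp: norm_mult intro!: mult_right_le_one_le)
  qed (use Fint in auto)
  show ?thesis by (rule LIMSEQ_unique[OF l1 l2])
qed

section \<open>Sobolev embedding\<close>

lemma has_real_derivative_integral: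
  fixes k :: "real \<Rightarrow> 'a \<Rightarrow> real"
  assumes int: "\<And>x. integrable M (k x)"
    and der: "\<And>x \<xi>. ((\<lambda>x. k x \<xi>) has_real_derivative k' x \<xi>) (at x)"
    and bnd: "\<And>x \<xi>. \<bar>k' x \<xi>\<bar> \<le> w \<xi>" and w: "integrable M w"
    and meas: "k' x0 \<in> borel_measurable M"
  shows "((\<lambda>x. \<integral>\<xi>. k x \<xi> \<partial>M) has_real_derivative (\<integral>\<xi>. k' x0 \<xi> \<partial>M)) (at x0)"
  unfolding DERIV_def tendsto_at_iff_sequentially
proof (intro allI impI)
  fix X :: "nat \<Rightarrow> real" assume X: "\<forall>i. X i \<in> UNIV - {0}" and X0: "X \<longlonglongrightarrow> 0"
  have "(\<lambda>i. \<integral>\<xi>. (k (x0 + X i) \<xi> - k x0 \<xi>) / X i \<partial>M) \<longlonglongrightarrow> (\<integral>\<xi>. k' x0 \<xi> \<partial>M)"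
  proof (rule integral_dominated_convergence[where w=w])
    show "AE \<xi> in M. (\<lambda>i. (k (x0 + X i) \<xi> - k x0 \<xi>) / X i) \<longlonglongrightarrow> k' x0 \<xi>"
    proof (rule AE_I2)
      fix \<xi>
      show "(\<lambda>i. (k (x0 + X i) \<xi> - k x0 \<xi>) / X i) \<longlonglongrightarrow> k' x0 \<xi>"
        using der[of \<xi> x0] X X0 unfolding DERIV_def tendsto_at_iff_sequentially comp_def by auto
    qed
    show "AE \<xi> in M. norm ((k (x0 + X i) \<xi> - k x0 \<xi>) / X i) \<le> w \<xi>" for i
    proof (rule AE_I2)
      fix \<xi>
      have "norm (k (x0 + X i) \<xi> - k x0 \<xi>) \<le> w \<xi> * norm (x0 + X i - x0)"
        using der[of \<xi>] bnd[of _ \<xi>]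
        by (intro field_differentiable_bound[where S=UNIV]) (auto intro: has_field_derivative_at_within)
      thus "norm ((k (x0 + X i) \<xi> - k x0 \<xi>) / X i) \<le> w \<xi>"
        using X[rule_format, of i] by (simp add: field_simps)
    qed
    show "(\<lambda>\<xi>. (k (x0 + X i) \<xi> - k x0 \<xi>) / X i) \<in> borel_measurable M" for i
      using int by (auto dest: borel_measurable_integrable)
  qed (fact meas, fact w)
  thus "((\<lambda>h. ((\<integral>\<xi>. k (x0 + h) \<xi> \<partial>M) - (\<integral>\<xi>. k x0 \<xi> \<partial>M)) / h) \<circ> X) \<longlonglongrightarrow> (\<integral>\<xi>. k' x0 \<xi> \<partial>M)"
    using int by (simp add: comp_def)
qed

lemma continuous_on_integral_dominated:
  fixes k :: "'c::metric_space \<Rightarrow> 'a \<Rightarrow> 'b::{banach, second_countable_topology}"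
  assumes meas: "\<And>x. k x \<in> borel_measurable M"
    and cont: "\<And>\<xi>. continuous_on UNIV (\<lambda>x. k x \<xi>)"
    and bnd: "\<And>x \<xi>. norm (k x \<xi>) \<le> w \<xi>" and w: "integrable M w"
  shows "continuous_on UNIV (\<lambda>x. \<integral>\<xi>. k x \<xi> \<partial>M)"
proof (rule continuous_on_sequentiallyI)
  fix X :: "nat \<Rightarrow> 'c" and x assume X: "X \<longlonglongrightarrow> x"
  show "(\<lambda>n. \<integral>\<xi>. k (X n) \<xi> \<partial>M) \<longlonglongrightarrow> (\<integral>\<xi>. k x \<xi> \<partial>M)"
    using X cont bnd w meas
    by (intro integral_dominated_convergence[where w=w] AE_I2)
       (auto intro: continuous_on_tendsto_compose[where s=UNIV])
qed

lemma integrable_bessel_weight: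
  fixes s :: real
  assumes "s > 1 / 2"
  shows "integrable lborel (\<lambda>\<xi>::real. (1 + \<xi>\<^sup>2) powr (- s))"
proof -
  define h where "h x = indicator {1..} x * x powr (- 2 * s)" for x :: real
  have "(\<lambda>x. x powr (- 2 * s)) integrable_on {1::real..}"
    using has_integral_powr_to_inf[of "- 2 * s" 1] assms by (auto simp: integrable_on_def)
  hence "(\<lambda>x. x powr (- 2 * s)) absolutely_integrable_on {1::real..}"
    by (intro nonnegative_absolutely_integrable_1) auto
  hence "integrable lebesgue h" by (simp add: set_integrable_def h_def[abs_def])
  hence h: "integrable lborel h"
    by (subst (asm) integrable_completion) (auto simp: h_def[abs_def])
  have "integrable lborel (\<lambda>x. h x + h (0 + (- 1) * x) + 2 * inverse (1 + x\<^sup>2))"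
    by (intro Bochner_Integration.integrable_add integrable_mult_right h
        lborel_integrable_real_affine[OF h] integrable_inverse_1_plus_square_lborel) simp
  thus ?thesis
  proof (rule Bochner_Integration.integrable_bound)
    show "AE x in lborel. norm ((1 + x\<^sup>2) powr (- s))
        \<le> norm (h x + h (0 + (- 1) * x) + 2 * inverse (1 + x\<^sup>2))"
    proof (rule AE_I2)
      fix x :: real
      have h0: "h x \<ge> 0" "h (- x) \<ge> 0" by (auto simp: h_def)
      have i0: "2 * inverse (1 + x\<^sup>2) \<ge> 0" by (simp add: add_nonneg_nonneg)
      have "(1 + x\<^sup>2) powr (- s) \<le> h x + h (- x) + 2 * inverse (1 + x\<^sup>2)"
      proof (cases "\<bar>x\<bar> \<ge> 1")
        case True
        have "(1 + x\<^sup>2) powr (- s) \<le> (x\<^sup>2) powr (- s)"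
          using True assms by (intro powr_mono2') auto
        also have "(x\<^sup>2) powr (- s) = (\<bar>x\<bar> powr 2) powr (- s)" using True by (subst powr_numeral) auto
        also have "(\<bar>x\<bar> powr 2) powr (- s) = \<bar>x\<bar> powr (- 2 * s)" by (simp only: powr_powr) simp
        also have "\<dots> \<le> h x + h (- x)"
          using True h0 by (cases "x \<ge> 0") (auto simp: h_def indicator_def)
        finally show ?thesis using i0 by linarith
      next
        case False
        hence "x\<^sup>2 \<le> 1" by (simp add: abs_square_le_1)
        moreover have "0 < 1 + x\<^sup>2" by (simp add: add_pos_nonneg)
        ultimately have "1 \<le> 2 * inverse (1 + x\<^sup>2)"
          by (simp only: divide_inverse[symmetric] le_divide_eq_1_pos)
        moreover have "(1 + x\<^sup>2) powr (- s) \<le> 1"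
          using assms powr_mono2'[of "-s" 1 "1 + x\<^sup>2"] by simp
        ultimately show ?thesis using h0 by linarith
      qed
      thus "norm ((1 + x\<^sup>2) powr (- s)) \<le> norm (h x + h (0 + (- 1) * x) + 2 * inverse (1 + x\<^sup>2))"
        using h0 i0 by simp
    qed
  qed simp
qed

text \<open>Cauchy--Schwarz against the weight \<open>(1 + \<xi>\<^sup>2)\<^sup>-\<^sup>s\<close>, whose integral is finite exactly for \<open>s > 1/2\<close>.\<close>

lemma weighted_L2_imp_L1:
  fixes F :: "real \<Rightarrow> complex"
  assumes s: "s > 1 / 2" and [measurable]: "F \<in> borel_measurable borel" and N: "N > 0"
    and L2: "(\<integral>\<^sup>+\<xi>. ennreal ((1 + \<xi>\<^sup>2) powr s * (norm (F \<xi>))\<^sup>2) \<partial>lborel) \<le> ennreal N"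
  shows "integrable lborel F"
    and "(\<integral>\<xi>. norm (F \<xi>) \<partial>lborel) \<le> (1 + (\<integral>\<xi>. (1 + \<xi>\<^sup>2) powr (- s) \<partial>lborel)) * sqrt N"
proof -
  define K where "K = (\<integral>\<xi>. (1 + \<xi>\<^sup>2) powr (- s) \<partial>lborel)"
  \<comment> \<open>The weight that balances both terms of \<open>y \<le> \<mu> p y\<^sup>2 + 1 / (p \<mu>)\<close> up to a constant.\<close>
  define \<mu> where "\<mu> = 1 / sqrt N"
  have l0: "\<mu> > 0" using N by (simp add: \<mu>_def)
  have K0: "K \<ge> 0" unfolding K_def by (rule integral_nonneg_AE) auto
  have "(\<integral>\<^sup>+\<xi>. ennreal (norm (F \<xi>)) \<partial>lborel)
      \<le> (\<integral>\<^sup>+\<xi>. ennreal \<mu> * ennreal ((1 + \<xi>\<^sup>2) powr s * (norm (F \<xi>))\<^sup>2) + ennreal ((1 + \<xi>\<^sup>2) powr (- s) / \<mu>) \<partial>lborel)"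
  proof (rule nn_integral_mono)
    fix \<xi> :: real
    define y p where "y = norm (F \<xi>)" and "p = (1 + \<xi>\<^sup>2) powr s"
    have "1 + \<xi>\<^sup>2 > 0" by (simp add: add_pos_nonneg)
    hence p0: "p > 0" by (simp add: p_def)
    have pm: "(1 + \<xi>\<^sup>2) powr (- s) = 1 / p" by (simp add: p_def powr_minus field_simps)
    have "2 * (sqrt (\<mu> * p) * y) * (1 / sqrt (\<mu> * p)) \<le> (sqrt (\<mu> * p) * y)\<^sup>2 + (1 / sqrt (\<mu> * p))\<^sup>2"
      by (rule sum_squares_bound)
    hence "2 * y \<le> \<mu> * (p * y\<^sup>2) + 1 / p / \<mu>"
      using l0 p0 by (simp add: power_mult_distrib power_divide mult_ac)
    moreover have "y \<ge> 0" by (simp add: y_def)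
    ultimately have "y \<le> \<mu> * (p * y\<^sup>2) + (1 + \<xi>\<^sup>2) powr (- s) / \<mu>" by (simp add: pm)
    thus "ennreal (norm (F \<xi>))
        \<le> ennreal \<mu> * ennreal ((1 + \<xi>\<^sup>2) powr s * (norm (F \<xi>))\<^sup>2) + ennreal ((1 + \<xi>\<^sup>2) powr (- s) / \<mu>)"
      using l0 p0 by (simp add: y_def p_def ennreal_mult'[symmetric] ennreal_plus[symmetric] del: ennreal_plus)
  qed
  also have "\<dots> = ennreal \<mu> * (\<integral>\<^sup>+\<xi>. ennreal ((1 + \<xi>\<^sup>2) powr s * (norm (F \<xi>))\<^sup>2) \<partial>lborel)
      + (\<integral>\<^sup>+\<xi>. ennreal ((1 + \<xi>\<^sup>2) powr (- s) / \<mu>) \<partial>lborel)"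
    by (subst nn_integral_add) (auto simp: nn_integral_cmult)
  also have "(\<integral>\<^sup>+\<xi>. ennreal ((1 + \<xi>\<^sup>2) powr (- s) / \<mu>) \<partial>lborel) = ennreal (K / \<mu>)"
    unfolding K_def using integrable_bessel_weight[OF s] l0
    by (subst nn_integral_eq_integral) auto
  also have "ennreal \<mu> * (\<integral>\<^sup>+\<xi>. ennreal ((1 + \<xi>\<^sup>2) powr s * (norm (F \<xi>))\<^sup>2) \<partial>lborel) \<le> ennreal \<mu> * ennreal N"
    by (intro mult_left_mono L2) simp
  also have "ennreal \<mu> * ennreal N + ennreal (K / \<mu>) = ennreal ((1 + K) * sqrt N)"
    using l0 N K0 by (simp add: ennreal_mult'[symmetric] ennreal_plus[symmetric] \<mu>_def real_div_sqrt distrib_right del: ennreal_plus)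
  finally have nn: "(\<integral>\<^sup>+\<xi>. ennreal (norm (F \<xi>)) \<partial>lborel) \<le> ennreal ((1 + K) * sqrt N)"
    by (auto simp: add_right_mono)
  show int: "integrable lborel F"
    by (rule integrableI_bounded) (use nn in \<open>auto intro: le_less_trans\<close>)
  have "ennreal (\<integral>\<xi>. norm (F \<xi>) \<partial>lborel) \<le> ennreal ((1 + K) * sqrt N)"
    using nn int by (subst nn_integral_eq_integral[symmetric]) auto
  thus "(\<integral>\<xi>. norm (F \<xi>) \<partial>lborel) \<le> (1 + (\<integral>\<xi>. (1 + \<xi>\<^sup>2) powr (- s) \<partial>lborel)) * sqrt N"
    using K0 N by (simp add: K_def)
qed

text \<open>Finiteness of the infimum in particular provides a transform.\<close>

lemma sobolev_norm_sq_lessE: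
  assumes "sobolev_norm_sq s f < ennreal N"
  obtains F where "is_fourier_transform f F" and "F \<in> borel_measurable borel"
    and "(\<integral>\<^sup>+\<xi>. ennreal ((1 + \<xi>\<^sup>2) powr s * (norm (F \<xi>))\<^sup>2) \<partial>lborel) \<le> ennreal N"
proof -
  from assms obtain F where "is_fourier_transform f F"
      and "(\<integral>\<^sup>+\<xi>. ennreal ((1 + \<xi>\<^sup>2) powr s * (norm (F \<xi>))\<^sup>2) \<partial>lborel) < ennreal N"
    unfolding sobolev_norm_sq_def INF_less_iff by auto
  thus ?thesis by (intro that) (auto simp: is_fourier_transform_def square_integrable_def)
qed

definition sobolev_constant :: "real \<Rightarrow> real" where
  "sobolev_constant s = 1 + (\<integral>\<xi>. (1 + \<xi>\<^sup>2) powr (- s) \<partial>lborel)"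

lemma sobolev_constant_pos: "sobolev_constant s > 0"
proof -
  have "(\<integral>\<xi>. (1 + \<xi>\<^sup>2) powr (- s) \<partial>lborel) \<ge> 0" by (rule integral_nonneg_AE) auto
  thus ?thesis unfolding sobolev_constant_def by linarith
qed

lemma sobolev_imp_bounded:
  fixes f :: "real \<Rightarrow> real"
  assumes s: "s > 1 / 2" and cont: "continuous_on UNIV f"
    and less: "sobolev_norm_sq s f < ennreal N" and N: "N > 0"
  shows "\<bar>f x\<bar> \<le> sobolev_constant s * sqrt N"
proof -
  from less obtain F where F: "is_fourier_transform f F" "F \<in> borel_measurable borel"
    "(\<integral>\<^sup>+\<xi>. ennreal ((1 + \<xi>\<^sup>2) powr s * (norm (F \<xi>))\<^sup>2) \<partial>lborel) \<le> ennreal N"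
    by (rule sobolev_norm_sq_lessE)
  note L1 = weighted_L2_imp_L1[OF s F(2) N F(3), folded sobolev_constant_def]
  have "1 * \<bar>f x\<bar> \<le> 2 * pi * \<bar>f x\<bar>" using pi_gt3 by (intro mult_right_mono) auto
  also have "\<dots> = norm (complex_of_real (2 * pi * f x))" by (simp only: norm_of_real abs_mult) simp
  also have "\<dots> \<le> (\<integral>\<xi>. norm (F \<xi> * cis (x * \<xi>)) \<partial>lborel)"
    unfolding fourier_inversion[OF F(1) L1(1) cont] by (rule integral_norm_bound)
  also have "\<dots> \<le> sobolev_constant s * sqrt N" using L1(2) by (simp add: norm_mult)
  finally show ?thesis by simp
qed

text \<open>The derivative is the inverse transform of \<open>\<i> \<xi> F(\<xi>)\<close>, and multiplication by \<open>\<xi>\<close> costs one power of the weight,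
  so \<open>\<xi> F\<close> is integrable as soon as \<open>s - 1 > 1/2\<close>.\<close>

lemma sobolev_imp_C1:
  fixes f :: "real \<Rightarrow> real"
  assumes s: "s > 3 / 2" and cont: "continuous_on UNIV f"
    and less: "sobolev_norm_sq s f < ennreal N" and N: "N > 0"
  shows "(f has_real_derivative deriv f x) (at x)"
    and "continuous_on UNIV (deriv f)"
    and "\<bar>deriv f x\<bar> \<le> sobolev_constant (s - 1) * sqrt N"
proof -
  from less obtain F where F: "is_fourier_transform f F" and Fm[measurable]: "F \<in> borel_measurable borel"
    and L2: "(\<integral>\<^sup>+\<xi>. ennreal ((1 + \<xi>\<^sup>2) powr s * (norm (F \<xi>))\<^sup>2) \<partial>lborel) \<le> ennreal N"
    by (rule sobolev_norm_sq_lessE)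
  define F1 where "F1 \<xi> = \<xi> *\<^sub>R F \<xi>" for \<xi>
  have [measurable]: "F1 \<in> borel_measurable borel" by (simp add: F1_def[abs_def])
  have [measurable]: "cis \<in> borel_measurable borel"
    by (intro borel_measurable_continuous_onI continuous_intros)
  have "(\<integral>\<^sup>+\<xi>. ennreal ((1 + \<xi>\<^sup>2) powr (s - 1) * (norm (F1 \<xi>))\<^sup>2) \<partial>lborel)
      \<le> (\<integral>\<^sup>+\<xi>. ennreal ((1 + \<xi>\<^sup>2) powr s * (norm (F \<xi>))\<^sup>2) \<partial>lborel)"
  proof (intro nn_integral_mono ennreal_leI)
    fix \<xi> :: real
    have p: "1 + \<xi>\<^sup>2 > 0" by (simp add: add_pos_nonneg)
    have "(1 + \<xi>\<^sup>2) powr (s - 1) * (norm (F1 \<xi>))\<^sup>2 = (1 + \<xi>\<^sup>2) powr (s - 1) * \<xi>\<^sup>2 * (norm (F \<xi>))\<^sup>2"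
      by (simp add: F1_def power_mult_distrib)
    also have "\<dots> \<le> (1 + \<xi>\<^sup>2) powr (s - 1) * (1 + \<xi>\<^sup>2) * (norm (F \<xi>))\<^sup>2"
      by (intro mult_right_mono mult_left_mono) auto
    also have "(1 + \<xi>\<^sup>2) powr (s - 1) * (1 + \<xi>\<^sup>2) = (1 + \<xi>\<^sup>2) powr s"
      using p by (simp add: powr_diff)
    finally show "(1 + \<xi>\<^sup>2) powr (s - 1) * (norm (F1 \<xi>))\<^sup>2 \<le> (1 + \<xi>\<^sup>2) powr s * (norm (F \<xi>))\<^sup>2" .
  qed
  note L2' = order_trans[OF this L2]
  have s1: "s > 1 / 2" and s2: "s - 1 > 1 / 2" using s by auto
  note Fint = weighted_L2_imp_L1(1)[OF s1 Fm N L2]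
  note F1int = weighted_L2_imp_L1[OF s2 _ N L2', folded sobolev_constant_def]
  define k where "k x \<xi> = Re (F \<xi> * cis (x * \<xi>)) / (2 * pi)" for x \<xi>
  define k' where "k' x \<xi> = Re (\<i> * F1 \<xi> * cis (x * \<xi>)) / (2 * pi)" for x \<xi>
  have Fc: "integrable lborel (\<lambda>\<xi>. F \<xi> * cis (x * \<xi>))" for x
    by (rule Bochner_Integration.integrable_bound[OF Fint]) (auto simp: norm_mult)
  have kint: "integrable lborel (k x)" for x
    unfolding k_def[abs_def] by (intro integrable_divide_zero integrable_Re Fc)
  have "2 * pi * f x = Re (\<integral>\<xi>. F \<xi> * cis (x * \<xi>) \<partial>lborel)" for x
    by (simp only: fourier_inversion[OF F Fint cont, symmetric] Re_complex_of_real)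
  also have "\<And>x. Re (\<integral>\<xi>. F \<xi> * cis (x * \<xi>) \<partial>lborel) = (\<integral>\<xi>. Re (F \<xi> * cis (x * \<xi>)) \<partial>lborel)"
    by (rule integral_Re[symmetric, OF Fc])
  finally have fk: "f = (\<lambda>x. \<integral>\<xi>. k x \<xi> \<partial>lborel)"
    by (simp add: fun_eq_iff k_def field_simps)
  have kd: "((\<lambda>x. k x \<xi>) has_real_derivative k' x \<xi>) (at x)" for x \<xi>
    unfolding k_def k'_def F1_def
    by (auto intro!: derivative_eq_intros simp: scaleR_conv_of_real field_simps)
  have kb: "\<bar>k' x \<xi>\<bar> \<le> norm (F1 \<xi>)" for x \<xi>
  proof -
    have "\<bar>k' x \<xi>\<bar> = \<bar>Re (\<i> * F1 \<xi> * cis (x * \<xi>))\<bar> / (2 * pi)" by (simp add: k'_def)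
    also have "\<dots> \<le> \<bar>Re (\<i> * F1 \<xi> * cis (x * \<xi>))\<bar> / 1"
      using pi_gt3 by (intro divide_left_mono) auto
    also have "\<dots> \<le> norm (\<i> * F1 \<xi> * cis (x * \<xi>))" by (simp only: div_by_1 abs_Re_le_cmod)
    also have "\<dots> = norm (F1 \<xi>)" by (simp add: norm_mult)
    finally show ?thesis .
  qed
  have km: "k' x \<in> borel_measurable lborel" for x by (simp add: k'_def[abs_def])
  have d: "(f has_real_derivative (\<integral>\<xi>. k' x \<xi> \<partial>lborel)) (at x)" for x
    unfolding fk using F1int(1)
    by (intro has_real_derivative_integral[OF kint kd kb _ km] integrable_norm) auto
  hence df: "deriv f = (\<lambda>x. \<integral>\<xi>. k' x \<xi> \<partial>lborel)" using DERIV_imp_deriv by blast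
  show "(f has_real_derivative deriv f x) (at x)" using d df by simp
  show "continuous_on UNIV (deriv f)" unfolding df
    using F1int(1) kb by (intro continuous_on_integral_dominated[OF km, where w="\<lambda>\<xi>. norm (F1 \<xi>)"])
      (auto simp: k'_def intro!: continuous_intros)
  have "\<bar>deriv f x\<bar> \<le> (\<integral>\<xi>. \<bar>k' x \<xi>\<bar> \<partial>lborel)" unfolding df by (rule integral_abs_bound)
  also have "\<dots> \<le> (\<integral>\<xi>. norm (F1 \<xi>) \<partial>lborel)"
    using F1int(1) kb km by (intro integral_mono integrable_norm) 
      (auto intro!: Bochner_Integration.integrable_bound[OF integrable_norm[OF F1int(1)]])
  also have "\<dots> \<le> sobolev_constant (s - 1) * sqrt N" using F1int(2) by simp
  finally show "\<bar>deriv f x\<bar> \<le> sobolev_constant (s - 1) * sqrt N" .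
qed

section \<open>The operator \<open>(1 - d \<partial>\<^sub>x\<^sup>2)\<^sup>-\<^sup>1\<close>\<close>

lemma integrable_exp_decay:
  fixes c :: real
  assumes "c > 0"
  shows "integrable lborel (\<lambda>z. indicator {0..} z * exp (- z / c))"
    and "(\<integral>z. indicator {0..} z * exp (- z / c) \<partial>lborel) = c"
proof -
  have lim: "((\<lambda>z. - c * exp (- z / c)) \<longlongrightarrow> - c * 0) at_top"
    using assms by (intro tendsto_intros) real_asymp
  have "(\<integral>\<^sup>+z. ennreal (exp (- z / c)) * indicator {0..} z \<partial>lborel)
      = ennreal (0 - (- c * exp (- 0 / c)))"
    using lim assms
    by (intro nn_integral_FTC_atLeast[where F="\<lambda>z. - c * exp (- z / c)"])
       (auto intro!: derivative_eq_intros)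
  also have "(\<lambda>z. ennreal (exp (- z / c)) * indicator {0..} z) = (\<lambda>z. ennreal (indicator {0..} z * exp (- z / c)))"
    by (auto simp: indicator_def)
  finally have nn: "(\<integral>\<^sup>+z. ennreal (indicator {0..} z * exp (- z / c)) \<partial>lborel) = ennreal c" by simp
  have "has_bochner_integral lborel (\<lambda>z. indicator {0..} z * exp (- z / c)) c"
    using assms nn by (intro has_bochner_integral_nn_integral) auto
  thus "integrable lborel (\<lambda>z. indicator {0..} z * exp (- z / c))"
    and "(\<integral>z. indicator {0..} z * exp (- z / c) \<partial>lborel) = c"
    by (auto simp: has_bochner_integral_iff)
qed

text \<open>Convolution with the restriction to \<open>[0, \<infinity>)\<close> of \<open>exp(- |x|/c) / (2c)\<close>. The other half of the kernel is obtained by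
  reflection, see \<open>inverse_helmholtz_split\<close>.\<close>

definition half_resolvent :: "real \<Rightarrow> (real \<Rightarrow> real) \<Rightarrow> real \<Rightarrow> real" where
  "half_resolvent c F x = (\<integral>z. indicator {0..} z * exp (- z / c) * F (x - z) \<partial>lborel) / (2 * c)"

context
  fixes c M :: real and F :: "real \<Rightarrow> real"
  assumes c: "c > 0" and cont: "continuous_on UNIV F" and bnd: "\<And>x. \<bar>F x\<bar> \<le> M"
begin

lemma half_resolvent_measurable: "F \<in> borel_measurable borel"
  using cont by (rule borel_measurable_continuous_onI)

lemma half_resolvent_integrable:
  "integrable lborel (\<lambda>z. indicator {0..} z * exp (- z / c) * F (x - z))"
proof (rule Bochner_Integration.integrable_bound)
  note half_resolvent_measurable[measurable]
  show "integrable lborel (\<lambda>z. M * (indicator {0..} z * exp (- z / c)))"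
    using integrable_exp_decay[OF c] by simp
  show "(\<lambda>z. indicator {0..} z * exp (- z / c) * F (x - z)) \<in> borel_measurable lborel" by simp
  show "AE z in lborel. norm (indicator {0..} z * exp (- z / c) * F (x - z))
     \<le> norm (M * (indicator {0..} z * exp (- z / c)))"
    using order_trans[OF bnd abs_ge_self] by (intro AE_I2) (auto simp: abs_mult indicator_def)
qed

lemma half_resolvent_bound: "\<bar>half_resolvent c F x\<bar> \<le> M / 2"
proof -
  have "\<bar>\<integral>z. indicator {0..} z * exp (- z / c) * F (x - z) \<partial>lborel\<bar>
      \<le> (\<integral>z. \<bar>indicator {0..} z * exp (- z / c) * F (x - z)\<bar> \<partial>lborel)" by (rule integral_abs_bound)
  also have "\<dots> \<le> (\<integral>z. M * (indicator {0..} z * exp (- z / c)) \<partial>lborel)"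
  proof (rule integral_mono[OF integrable_abs[OF half_resolvent_integrable]
        integrable_mult_right[OF integrable_exp_decay(1)[OF c]]])
    show "\<bar>indicator {0..} z * exp (- z / c) * F (x - z)\<bar> \<le> M * (indicator {0..} z * exp (- z / c))" for z
      using bnd[of "x - z"] by (simp add: abs_mult indicator_def)
  qed
  also have "\<dots> = M * c" using integrable_exp_decay[OF c] by simp
  finally show ?thesis using c by (simp add: half_resolvent_def abs_mult field_simps)
qed

text \<open>Up to a factor, the half kernel is a fundamental solution of a first order operator. As \<open>F\<close> is only continuous,
  the derivative is not taken inside the convolution: the substitution \<open>y = x - z\<close> moves \<open>x\<close> into the endpoint of the integral.\<close>

lemma half_resolvent_DERIV:
  "(half_resolvent c F has_real_derivative F x / (2 * c) - half_resolvent c F x / c) (at x)"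
proof -
  note half_resolvent_measurable[measurable]
  define g where "g y = exp (y / c) * F y" for y
  have gc: "continuous_on S g" for S
    unfolding g_def using c by (intro continuous_intros continuous_on_subset[OF cont]) auto
  define J where "J x = (\<integral>y. indicator {..x} y * g y \<partial>lborel)" for x
  have eq: "indicator {0..} (x + (- 1) * y) * exp (- (x + (- 1) * y) / c) * F (x - (x + (- 1) * y))
      = exp (- x / c) * (indicator {..x} y * g y)" for x y
    by (auto simp: indicator_def g_def exp_add[symmetric] diff_divide_distrib)
  have Jint: "integrable lborel (\<lambda>y. indicator {..x} y * g y)" for x
    using lborel_integrable_real_affine[OF half_resolvent_integrable[of x], of "-1" x]
    unfolding eq by simp
  have LJ: "half_resolvent c F x = exp (- x / c) * J x / (2 * c)" for x
    unfolding half_resolvent_def J_def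
    by (subst lborel_integral_real_affine[where c="-1" and t=x]) (simp_all only: eq, simp_all)
  have split: "J y = J a + integral {a..y} g" if "a \<le> y" for a y
  proof -
    have i: "set_integrable lborel {a..y} g"
      by (rule borel_integrable_atLeastAtMost'[OF gc])
    have "J y = (\<integral>z. indicator {..a} z * g z + indicator {a<..y} z * g z \<partial>lborel)"
      unfolding J_def using that by (intro Bochner_Integration.integral_cong) (auto simp: indicator_def)
    also have "\<dots> = (\<integral>z. indicator {..a} z * g z + indicator {a..y} z * g z \<partial>lborel)"
      by (intro integral_cong_AE) (use AE_lborel_singleton[of a] in \<open>auto simp: indicator_def g_def[abs_def] elim!: eventually_mono\<close>)
    also have "\<dots> = J a + (LBINT z:{a..y}. g z)"
      unfolding J_def set_lebesgue_integral_def using i Jint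
      by (subst Bochner_Integration.integral_add) (auto simp: set_integrable_def)
    also have "(LBINT z:{a..y}. g z) = integral {a..y} g"
      by (rule set_borel_integral_eq_integral(2)[OF i])
    finally show ?thesis .
  qed
  have "((\<lambda>y. integral {x-1..y} g) has_real_derivative g x) (at x within {x-1..x+1})"
    by (rule integral_has_real_derivative[OF gc]) simp
  hence "((\<lambda>y. integral {x-1..y} g) has_real_derivative g x) (at x)"
    by (simp add: at_within_Icc_at)
  hence 1: "((\<lambda>y. J (x-1) + integral {x-1..y} g) has_real_derivative g x) (at x)"
    by (auto intro!: derivative_eq_intros)
  have 2: "\<forall>\<^sub>F y in nhds x. J (x-1) + integral {x-1..y} g = J y"
    using eventually_nhds_in_open[of "{x-1<..}" x] by (auto elim!: eventually_mono intro: split[symmetric])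
  have "(J has_real_derivative g x) (at x)"
    using 1 DERIV_cong_ev[OF refl 2 refl] by blast
  hence "((\<lambda>x. exp (- x / c) * J x / (2 * c)) has_real_derivative
      F x / (2 * c) - exp (- x / c) * J x / (2 * c) / c) (at x)"
    using c by (auto intro!: derivative_eq_intros simp: g_def field_simps exp_minus)
  thus ?thesis unfolding LJ[symmetric] .
qed

end

lemma half_resolvent_diff:
  assumes c: "c > 0" and F: "continuous_on UNIV F" "\<And>x. \<bar>F x\<bar> \<le> M"
    and G: "continuous_on UNIV G" "\<And>x. \<bar>G x\<bar> \<le> N"
    and e: "\<And>x. \<bar>F x - G x\<bar> \<le> e"
  shows "\<bar>half_resolvent c F x - half_resolvent c G x\<bar> \<le> e / 2"
proof -
  have "half_resolvent c F x - half_resolvent c G x = half_resolvent c (\<lambda>x. F x - G x) x"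
    unfolding half_resolvent_def right_diff_distrib diff_divide_distrib[symmetric]
    by (subst Bochner_Integration.integral_diff[OF half_resolvent_integrable[OF c F]
        half_resolvent_integrable[OF c G]]) (rule refl)
  thus ?thesis
    using half_resolvent_bound[OF c _ e] F G by (simp add: continuous_intros)
qed

text \<open>For \<open>d = c\<^sup>2\<close> the right-hand side is the half convolution of the source with velocity \<open>f\<close>.
  The derivative of \<open>exp(y/c) (L - c\<^sup>2 f\<^sup>2/4)\<close>, where \<open>L\<close> is that convolution, is
  \<open>exp(y/c) (c/4) (f - c f')\<^sup>2 \<ge> 0\<close>, and this function tends to \<open>0\<close> at \<open>-\<infinity>\<close>. The factor \<open>1/4\<close> is what
  makes the remainder a perfect square.\<close>

lemma half_resolvent_lower_bound:
  fixes f :: "real \<Rightarrow> real"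
  assumes c: "c > 0" and der: "\<And>x. (f has_real_derivative f' x) (at x)"
    and cont: "continuous_on UNIV f'" and bnd: "\<And>x. \<bar>f x\<bar> \<le> B" "\<And>x. \<bar>f' x\<bar> \<le> B'"
  shows "c\<^sup>2 * (f x)\<^sup>2 / 4 \<le> half_resolvent c (\<lambda>y. c\<^sup>2 * (f y)\<^sup>2 + (c\<^sup>2)\<^sup>2 / 2 * (f' y)\<^sup>2) x"
proof -
  define F where "F y = c\<^sup>2 * (f y)\<^sup>2 + (c\<^sup>2)\<^sup>2 / 2 * (f' y)\<^sup>2" for y
  define M where "M = c\<^sup>2 * B\<^sup>2 + (c\<^sup>2)\<^sup>2 / 2 * B'\<^sup>2"
  have fc: "continuous_on UNIV f"
    using der by (meson DERIV_isCont continuous_at_imp_continuous_on)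
  have Fc: "continuous_on UNIV F" unfolding F_def by (intro continuous_intros fc cont)
  have sq: "(f y)\<^sup>2 \<le> B\<^sup>2" "(f' y)\<^sup>2 \<le> B'\<^sup>2" for y
    using power_mono[OF bnd(1)[of y], of 2] power_mono[OF bnd(2)[of y], of 2] by simp_all
  have Fb: "\<bar>F y\<bar> \<le> M" for y
  proof -
    have "F y \<ge> 0" by (simp add: F_def)
    moreover have "F y \<le> M" unfolding F_def M_def using sq[of y] by (intro add_mono mult_left_mono) auto
    ultimately show ?thesis by simp
  qed
  define \<psi> where "\<psi> y = exp (y / c) * (half_resolvent c F y - c\<^sup>2 * (f y)\<^sup>2 / 4)" for y
  have d\<psi>: "(\<psi> has_real_derivative exp (y / c) * (c / 4) * (f y - c * f' y)\<^sup>2) (at y)" for y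
  proof -
    note [derivative_intros] = half_resolvent_DERIV[OF c Fc Fb] der
    have "(\<psi> has_real_derivative (exp (y / c) / c) * (half_resolvent c F y - c\<^sup>2 * (f y)\<^sup>2 / 4)
        + exp (y / c) * ((F y / (2 * c) - half_resolvent c F y / c) - c\<^sup>2 * (2 * f y * f' y) / 4)) (at y)"
      unfolding \<psi>_def[abs_def] using c by (auto intro!: derivative_eq_intros)
    moreover have "(E / c) * (L - c\<^sup>2 * p\<^sup>2 / 4) + E * (((c\<^sup>2 * p\<^sup>2 + (c\<^sup>2)\<^sup>2 / 2 * q\<^sup>2) / (2 * c) - L / c) - c\<^sup>2 * (2 * p * q) / 4)
        = E * (c / 4) * (p - c * q)\<^sup>2" for E L p q
      using c by (simp add: field_simps power2_eq_square)
    ultimately show ?thesis by (simp only: F_def)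
  qed
  have mono: "\<psi> a \<le> \<psi> b" if "a \<le> b" for a b
    using that d\<psi> c by (intro DERIV_nonneg_imp_nondecreasing[OF that]) (auto intro!: exI mult_nonneg_nonneg)
  define E where "E = M / 2 + c\<^sup>2 * B\<^sup>2 / 4"
  have low: "- E * exp (y / c) \<le> \<psi> y" for y
  proof -
    have "- (M / 2) \<le> half_resolvent c F y" using half_resolvent_bound[OF c Fc Fb, of y] by linarith
    moreover have "c\<^sup>2 * (f y)\<^sup>2 \<le> c\<^sup>2 * B\<^sup>2" using sq[of y] by (intro mult_left_mono) auto
    ultimately have "- E \<le> half_resolvent c F y - c\<^sup>2 * (f y)\<^sup>2 / 4" unfolding E_def by linarith
    hence "- E * exp (y / c) \<le> (half_resolvent c F y - c\<^sup>2 * (f y)\<^sup>2 / 4) * exp (y / c)"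
      by (intro mult_right_mono) auto
    thus ?thesis by (simp add: \<psi>_def mult.commute)
  qed
  have "((\<lambda>t. - E * exp t) \<longlongrightarrow> - E * 0) at_bot"
    by (intro tendsto_intros exp_at_bot)
  moreover have "\<forall>\<^sub>F t in at_bot. - E * exp t \<le> \<psi> x"
    using eventually_le_at_bot[of "x / c"]
  proof eventually_elim
    case (elim t)
    hence "c * t \<le> x" using c by (simp add: field_simps)
    thus ?case using low[of "c * t"] mono[of "c * t" x] c by simp
  qed
  ultimately have "- E * 0 \<le> \<psi> x" by (rule tendsto_upperbound) simp
  thus ?thesis by (simp add: \<psi>_def F_def[abs_def] zero_le_mult_iff)
qed

text \<open>The two halves of the kernel overlap at the origin only, a null set.\<close>

lemma inverse_helmholtz_split:
  assumes d: "d > 0" and cont: "continuous_on UNIV F" and bnd: "\<And>x. \<bar>F x\<bar> \<le> M"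
  shows "inverse_helmholtz d F x
      = half_resolvent (sqrt d) F x + half_resolvent (sqrt d) (\<lambda>y. F (- y)) (- x)"
proof -
  define c where "c = sqrt d"
  have c: "c > 0" using d by (simp add: c_def)
  have [measurable]: "F \<in> borel_measurable borel"
    using cont by (rule borel_measurable_continuous_onI)
  have cont': "continuous_on UNIV (\<lambda>y. F (- y))"
    by (intro continuous_on_compose2[OF cont] continuous_intros) auto
  have i1: "integrable lborel (\<lambda>z. indicator {0..} z * exp (- z / c) * F (x - z))"
    by (rule half_resolvent_integrable[OF c cont bnd])
  have i2': "integrable lborel (\<lambda>z. indicator {0..} z * exp (- z / c) * F (- (- x - z)))"
    by (rule half_resolvent_integrable[OF c cont']) (rule bnd)
  have i2: "integrable lborel (\<lambda>z. indicator {0..} (- z) * exp (z / c) * F (x - z))"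
    using lborel_integrable_real_affine[OF i2', of "-1" 0] by simp
  have "inverse_helmholtz d F x = (\<integral>z. green_kernel d (x - (x + (- 1) * z)) * F (x + (- 1) * z) \<partial>lborel)"
    unfolding inverse_helmholtz_def by (subst lborel_integral_real_affine[where c="-1" and t=x]) simp_all
  also have "\<dots> = (\<integral>z. (indicator {0..} z * exp (- z / c) * F (x - z)
       + indicator {0..} (- z) * exp (z / c) * F (x - z)) / (2 * c) \<partial>lborel)"
    using c by (intro integral_cong_AE)
      (use AE_lborel_singleton[of 0] in \<open>auto simp: indicator_def green_kernel_def c_def elim!: eventually_mono\<close>)
  also have "\<dots> = (\<integral>z. indicator {0..} z * exp (- z / c) * F (x - z) \<partial>lborel) / (2 * c)
       + (\<integral>z. indicator {0..} (- z) * exp (z / c) * F (x - z) \<partial>lborel) / (2 * c)"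
    using i1 i2 by (simp add: add_divide_distrib)
  also have "(\<integral>z. indicator {0..} (- z) * exp (z / c) * F (x - z) \<partial>lborel)
      = (\<integral>z. indicator {0..} z * exp (- z / c) * F (- (- x - z)) \<partial>lborel)"
    by (subst lborel_integral_real_affine[where c="-1" and t=0]) simp_all
  finally show ?thesis by (simp add: half_resolvent_def c_def)
qed

section \<open>Ordinary differential equations and uniform limits\<close>

lemma nondecreasing_on_Icc:
  fixes f :: "real \<Rightarrow> real"
  assumes der: "\<And>t. t \<in> {0..S} \<Longrightarrow> (f has_real_derivative f' t) (at t within {0..S})"
    and nonneg: "\<And>t. t \<in> {0..S} \<Longrightarrow> 0 \<le> f' t" and t: "t \<in> {0..S}"
  shows "f 0 \<le> f t"
proof -
  have "\<exists>x\<in>{0..t}. f t - f 0 = (*) (f' x) (t - 0)"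
  proof (rule mvt_very_simple)
    show "0 \<le> t" using t by simp
    show "(f has_derivative (*) (f' x)) (at x within {0..t})" if "0 \<le> x" "x \<le> t" for x
      using DERIV_subset[OF der, of x "{0..t}"] that t by (auto simp: has_field_derivative_def)
  qed
  then obtain x where x: "x \<in> {0..t}" "f t - f 0 = f' x * t" by auto
  have "0 \<le> f' x * t" using x t nonneg[of x] by (intro mult_nonneg_nonneg) auto
  thus ?thesis using x by linarith
qed

text \<open>Banach's fixed point theorem for bounded continuous functions. The unknown \<open>z\<close> is related to the solution by
  \<open>q(t) = x0 + exp(2Kt) z(t)\<close>; this exponential weight makes the Picard operator a contraction with factor
  \<open>1/2\<close> on the whole interval at once.\<close>

lemma picard_lindelof_Icc:
  fixes f :: "real \<Rightarrow> real \<Rightarrow> real"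
  assumes S: "0 \<le> S" and K: "0 < K"
    and cont: "\<And>q. continuous_on {0..S} q \<Longrightarrow> continuous_on {0..S} (\<lambda>t. f t (q t))"
    and lip: "\<And>t x y. t \<in> {0..S} \<Longrightarrow> \<bar>f t x - f t y\<bar> \<le> K * \<bar>x - y\<bar>"
  obtains q where "q 0 = x0"
    and "\<And>t. t \<in> {0..S} \<Longrightarrow> (q has_real_derivative f t (q t)) (at t within {0..S})"
proof -
  \<comment> \<open>Clamping to \<open>[0, S]\<close> lets the Picard operator act on bounded continuous functions on the whole line.\<close>
  define cl where "cl t = max 0 (min S t)" for t :: real
  have cl: "cl t \<in> {0..S}" for t using S by (auto simp: cl_def)
  have cl_id: "t \<in> {0..S} \<Longrightarrow> cl t = t" for t by (auto simp: cl_def)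
  have clc: "continuous_on UNIV cl" unfolding cl_def by (intro continuous_intros)
  define E where "E t = exp (2 * K * t)" for t
  define rhs where "rhs z t = f t (x0 + E t * apply_bcontfun z t)" for z :: "real \<Rightarrow>\<^sub>C real" and t
  define I where "I z t = integral {0..t} (rhs z)" for z t
  have rc: "continuous_on {0..S} (rhs z)" for z
    unfolding rhs_def E_def by (intro cont continuous_intros continuous_on_apply_bcontfun)
  have ri: "rhs z integrable_on {0..t}" if "t \<in> {0..S}" for z t
    using that by (intro integrable_continuous_interval continuous_on_subset[OF rc]) auto
  have Id: "(I z has_real_derivative rhs z t) (at t within {0..S})" if "t \<in> {0..S}" for z t
    unfolding I_def using that by (intro integral_has_real_derivative rc)
  have Ic: "continuous_on {0..S} (I z)" for z
    using Id by (meson DERIV_continuous continuous_on_eq_continuous_within)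
  define \<Phi> where "\<Phi> z t = exp (- (2 * K * cl t)) * I z (cl t)" for z t
  have \<Phi>c: "continuous_on UNIV (\<Phi> z)" for z
    unfolding \<Phi>_def using cl
    by (intro continuous_intros clc continuous_on_compose2[OF Ic clc]) auto
  have \<Phi>b: "\<Phi> z \<in> bcontfun" for z
  proof -
    have "compact (I z ` {0..S})" by (intro compact_continuous_image Ic) simp
    then obtain B where B: "\<forall>y \<in> I z ` {0..S}. norm y \<le> B" using compact_imp_bounded bounded_iff by metis
    have "norm (\<Phi> z t) \<le> B" for t
    proof -
      have "norm (\<Phi> z t) = exp (- (2 * K * cl t)) * \<bar>I z (cl t)\<bar>" by (simp add: \<Phi>_def abs_mult)
      also have "\<dots> \<le> \<bar>I z (cl t)\<bar>" using cl[of t] K by (intro mult_left_le_one_le) auto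
      also have "\<dots> \<le> B" using B cl[of t] by auto
      finally show ?thesis .
    qed
    thus ?thesis by (intro bcontfun_normI \<Phi>c) 
  qed
  define \<Psi> where "\<Psi> z = Bcontfun (\<Phi> z)" for z
  have ap: "apply_bcontfun (\<Psi> z) = \<Phi> z" for z
    unfolding \<Psi>_def by (rule Bcontfun_inverse[OF \<Phi>b])
  have contr: "dist (\<Psi> y) (\<Psi> z) \<le> 1/2 * dist y z" for y z
  proof (rule dist_bound)
    fix t
    define \<tau> where "\<tau> = cl t"
    have \<tau>: "\<tau> \<in> {0..S}" unfolding \<tau>_def by (rule cl)
    define D where "D = dist y z"
    have D0: "D \<ge> 0" by (simp add: D_def)
    have "((\<lambda>r. K * E r * D) has_integral (E \<tau> * D / 2 - E 0 * D / 2)) {0..\<tau>}"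
      unfolding E_def using \<tau>
      by (intro fundamental_theorem_of_calculus)
         (auto intro!: derivative_eq_intros simp: has_real_derivative_iff_has_vector_derivative[symmetric])
    note int = this
    have "\<bar>I y \<tau> - I z \<tau>\<bar> = norm (integral {0..\<tau>} (\<lambda>r. rhs y r - rhs z r))"
      unfolding I_def by (subst Henstock_Kurzweil_Integration.integral_diff) (auto intro: ri[OF \<tau>])
    also have "\<dots> \<le> integral {0..\<tau>} (\<lambda>r. K * E r * D)"
    proof (rule integral_norm_bound_integral)
      fix r assume r: "r \<in> {0..\<tau>}"
      have "\<bar>rhs y r - rhs z r\<bar> \<le> K * \<bar>(x0 + E r * y r) - (x0 + E r * z r)\<bar>"
        unfolding rhs_def using r \<tau> by (intro lip) auto
      also have "(x0 + E r * y r) - (x0 + E r * z r) = E r * (y r - z r)" by (simp add: algebra_simps)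
      also have "\<bar>E r * (y r - z r)\<bar> = E r * dist (y r) (z r)" by (simp add: abs_mult E_def dist_real_def)
      also have "K * (E r * dist (y r) (z r)) \<le> K * (E r * D)"
        unfolding D_def using K by (intro mult_left_mono dist_bounded) (auto simp: E_def)
      finally show "norm (rhs y r - rhs z r) \<le> K * E r * D" by (simp add: mult.assoc)
    qed (use int in \<open>auto intro!: Henstock_Kurzweil_Integration.integrable_diff ri[OF \<tau>] simp: has_integral_integrable\<close>)
    also have "\<dots> = E \<tau> * D / 2 - E 0 * D / 2" by (rule integral_unique[OF int])
    also have "\<dots> \<le> E \<tau> * D / 2" using D0 by (simp add: E_def)
    finally have le: "\<bar>I y \<tau> - I z \<tau>\<bar> \<le> E \<tau> * D / 2" .
    have "dist (\<Phi> y t) (\<Phi> z t) = exp (- (2 * K * \<tau>)) * \<bar>I y \<tau> - I z \<tau>\<bar>"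
      unfolding \<Phi>_def \<tau>_def dist_real_def by (simp add: abs_mult right_diff_distrib[symmetric])
    also have "\<dots> \<le> exp (- (2 * K * \<tau>)) * (E \<tau> * D / 2)" using le by (intro mult_left_mono) auto
    also have "\<dots> = 1/2 * D" by (simp add: E_def exp_minus)
    finally show "dist (apply_bcontfun (\<Psi> y) t) (apply_bcontfun (\<Psi> z) t) \<le> 1/2 * dist y z"
      by (simp add: ap D_def)
  qed
  obtain z where z: "\<Psi> z = z" using banach_fix_type[of "1/2" \<Psi>] contr by auto
  define q where "q t = x0 + I z t" for t
  have zq: "E t * apply_bcontfun z t = I z t" if "t \<in> {0..S}" for t
  proof -
    have "apply_bcontfun z t = \<Phi> z t" using ap[of z] z by simp
    thus ?thesis using that by (simp add: \<Phi>_def cl_id E_def exp_minus)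
  qed
  show ?thesis
  proof
    show "q 0 = x0" by (simp add: q_def I_def)
    show "(q has_real_derivative f t (q t)) (at t within {0..S})" if "t \<in> {0..S}" for t
      using Id[OF that, of z] zq[OF that] unfolding q_def[abs_def] rhs_def
      by (auto intro!: derivative_eq_intros)
  qed
qed

text \<open>The upper bound and the non-vanishing are both read off from the monotone functions
  \<open>exp(\<plusminus>2Kt) \<delta>\<^sup>2\<close>.\<close>

lemma linear_growth_bounds:
  fixes \<delta> :: "real \<Rightarrow> real"
  assumes der: "\<And>t. t \<in> {0..S} \<Longrightarrow> (\<delta> has_real_derivative \<delta>' t) (at t within {0..S})"
    and bnd: "\<And>t. t \<in> {0..S} \<Longrightarrow> \<bar>\<delta>' t\<bar> \<le> K * \<bar>\<delta> t\<bar>"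
    and t: "t \<in> {0..S}"
  shows "\<bar>\<delta> t\<bar> \<le> exp (K * t) * \<bar>\<delta> 0\<bar>" and "\<delta> 0 \<noteq> 0 \<Longrightarrow> \<delta> t \<noteq> 0"
proof -
  have b: "\<bar>\<delta> t * \<delta>' t\<bar> \<le> K * (\<delta> t)\<^sup>2" if "t \<in> {0..S}" for t
    using mult_left_mono[OF bnd[OF that], of "\<bar>\<delta> t\<bar>"] by (simp add: abs_mult power2_eq_square mult_ac)
  define e where "e t = - (exp (- 2 * K * t) * (\<delta> t)\<^sup>2)" for t
  have "e 0 \<le> e t"
  proof (rule nondecreasing_on_Icc[OF _ _ t])
    fix t assume t: "t \<in> {0..S}"
    show "(e has_real_derivative 2 * exp (- 2 * K * t) * (K * (\<delta> t)\<^sup>2 - \<delta> t * \<delta>' t)) (at t within {0..S})"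
      unfolding e_def[abs_def] by (auto intro!: derivative_eq_intros der[OF t] simp: algebra_simps)
    show "0 \<le> 2 * exp (- 2 * K * t) * (K * (\<delta> t)\<^sup>2 - \<delta> t * \<delta>' t)"
      using b[OF t] by (intro mult_nonneg_nonneg) auto
  qed
  hence "exp (- 2 * K * t) * (\<delta> t)\<^sup>2 \<le> (\<delta> 0)\<^sup>2" by (simp add: e_def)
  hence "exp (2 * K * t) * (exp (- 2 * K * t) * (\<delta> t)\<^sup>2) \<le> exp (2 * K * t) * (\<delta> 0)\<^sup>2"
    by (intro mult_left_mono) auto
  hence "(\<delta> t)\<^sup>2 \<le> exp (2 * K * t) * (\<delta> 0)\<^sup>2" by (simp add: mult.assoc[symmetric] exp_add[symmetric])
  also have "\<dots> = (exp (K * t) * \<bar>\<delta> 0\<bar>)\<^sup>2" by (simp add: power_mult_distrib exp_double[symmetric] mult_ac)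
  finally show "\<bar>\<delta> t\<bar> \<le> exp (K * t) * \<bar>\<delta> 0\<bar>"
    using abs_le_square_iff[of "\<delta> t" "exp (K * t) * \<bar>\<delta> 0\<bar>"] by (simp add: abs_mult)
  define g where "g t = exp (2 * K * t) * (\<delta> t)\<^sup>2" for t
  have "g 0 \<le> g t"
  proof (rule nondecreasing_on_Icc[OF _ _ t])
    fix t assume t: "t \<in> {0..S}"
    show "(g has_real_derivative 2 * exp (2 * K * t) * (K * (\<delta> t)\<^sup>2 + \<delta> t * \<delta>' t)) (at t within {0..S})"
      unfolding g_def[abs_def] by (auto intro!: derivative_eq_intros der[OF t] simp: algebra_simps)
    show "0 \<le> 2 * exp (2 * K * t) * (K * (\<delta> t)\<^sup>2 + \<delta> t * \<delta>' t)"
      using b[OF t] by (intro mult_nonneg_nonneg) auto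
  qed
  thus "\<delta> t \<noteq> 0" if "\<delta> 0 \<noteq> 0" using that by (auto simp: g_def)
qed

text \<open>The signs of \<open>a\<close> and \<open>b\<close> persist by integrating factors: \<open>a' \<ge> (- k b) a\<close> and \<open>b' \<le> (k a) b\<close> are linear inequalities
  with continuous coefficients. Then \<open>(1/a - 1/b)' \<le> - k (r + 1/r) \<le> - 2k\<close> with \<open>r = - b/a\<close>.\<close>

lemma riccati_pair_lifespan:
  fixes a b :: "real \<Rightarrow> real"
  assumes k: "k > 0" and S: "0 \<le> S"
    and a: "\<And>t. t \<in> {0..S} \<Longrightarrow> (a has_real_derivative a' t) (at t within {0..S})"
    and b: "\<And>t. t \<in> {0..S} \<Longrightarrow> (b has_real_derivative b' t) (at t within {0..S})"
    and a': "\<And>t. t \<in> {0..S} \<Longrightarrow> - k * (a t * b t) \<le> a' t"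
    and b': "\<And>t. t \<in> {0..S} \<Longrightarrow> b' t \<le> k * (a t * b t)"
    and init: "0 < a 0" "b 0 < 0"
  shows "2 * k * S < 1 / a 0 - 1 / b 0"
proof -
  have ac: "continuous_on {0..S} a" and bc: "continuous_on {0..S} b"
    using a b by (meson DERIV_continuous continuous_on_eq_continuous_within)+
  define A where "A t = integral {0..t} a" for t
  define B where "B t = integral {0..t} b" for t
  have A: "(A has_real_derivative a t) (at t within {0..S})" if "t \<in> {0..S}" for t
    unfolding A_def using that by (intro integral_has_real_derivative ac)
  have B: "(B has_real_derivative b t) (at t within {0..S})" if "t \<in> {0..S}" for t
    unfolding B_def using that by (intro integral_has_real_derivative bc)
  have apos: "a t > 0" if t: "t \<in> {0..S}" for t
  proof -
    define g where "g t = exp (k * B t) * a t" for t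
    have "g 0 \<le> g t"
    proof (rule nondecreasing_on_Icc[OF _ _ t])
      fix t assume t: "t \<in> {0..S}"
      show "(g has_real_derivative exp (k * B t) * (a' t + k * (a t * b t))) (at t within {0..S})"
        unfolding g_def[abs_def] by (auto intro!: derivative_eq_intros a[OF t] B[OF t] simp: algebra_simps)
      show "0 \<le> exp (k * B t) * (a' t + k * (a t * b t))"
        using a'[OF t] by (intro mult_nonneg_nonneg) auto
    qed
    moreover have "g 0 > 0" using init by (simp add: g_def)
    ultimately have "g t > 0" by linarith
    thus ?thesis by (simp add: g_def zero_less_mult_iff)
  qed
  have bneg: "b t < 0" if t: "t \<in> {0..S}" for t
  proof -
    define g where "g t = - (exp (- k * A t) * b t)" for t
    have "g 0 \<le> g t"
    proof (rule nondecreasing_on_Icc[OF _ _ t])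
      fix t assume t: "t \<in> {0..S}"
      show "(g has_real_derivative exp (- k * A t) * (k * (a t * b t) - b' t)) (at t within {0..S})"
        unfolding g_def[abs_def] by (auto intro!: derivative_eq_intros b[OF t] A[OF t] simp: algebra_simps)
      show "0 \<le> exp (- k * A t) * (k * (a t * b t) - b' t)"
        using b'[OF t] by (intro mult_nonneg_nonneg) auto
    qed
    moreover have "g 0 > 0" using init mult_pos_neg[of "exp (- k * A 0)" "b 0"] by (simp add: g_def)
    ultimately have "g t > 0" by linarith
    thus ?thesis by (simp add: g_def mult_less_0_iff)
  qed
  define g where "g t = - (1 / a t - 1 / b t) - 2 * k * t" for t
  have "g 0 \<le> g S"
  proof (rule nondecreasing_on_Icc)
    fix t assume t: "t \<in> {0..S}"
    have ap: "a t > 0" and bn: "b t < 0" using apos[OF t] bneg[OF t] by auto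
    show "(g has_real_derivative a' t / (a t)\<^sup>2 - b' t / (b t)\<^sup>2 - 2 * k) (at t within {0..S})"
      unfolding g_def[abs_def] using ap bn
      by (auto intro!: derivative_eq_intros a[OF t] b[OF t] simp: power2_eq_square)
    define r where "r = - b t / a t"
    have r: "r > 0" using ap bn by (simp add: r_def divide_neg_pos)
    have "- k * (a t * b t) / (a t)\<^sup>2 \<le> a' t / (a t)\<^sup>2" using a'[OF t] by (intro divide_right_mono) auto
    moreover have "- k * (a t * b t) / (a t)\<^sup>2 = k * r" using ap by (simp add: r_def power2_eq_square)
    moreover have "b' t / (b t)\<^sup>2 \<le> k * (a t * b t) / (b t)\<^sup>2" using b'[OF t] by (intro divide_right_mono) auto
    moreover have "k * (a t * b t) / (b t)\<^sup>2 = - k / r" using ap bn by (simp add: r_def power2_eq_square)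
    moreover have "2 * k \<le> k * r + k / r"
    proof -
      have "2 * r \<le> r * r + 1" using sum_squares_bound[of r 1] by (simp add: power2_eq_square)
      hence "2 \<le> (r * r + 1) / r" using r by (simp add: pos_le_divide_eq)
      also have "\<dots> = r + 1 / r" using r by (simp add: field_simps)
      finally have "k * 2 \<le> k * (r + 1 / r)" using k by (intro mult_left_mono) auto
      thus ?thesis by (simp add: algebra_simps)
    qed
    ultimately show "0 \<le> a' t / (a t)\<^sup>2 - b' t / (b t)\<^sup>2 - 2 * k" by linarith
  qed (use S in simp)
  moreover have "1 / a S > 0" "1 / b S < 0" using apos[of S] bneg[of S] S by auto
  ultimately show ?thesis unfolding g_def by linarith
qed

text \<open>Each time has a neighbourhood in which the bound at that time holds up to \<open>1\<close>; finitely many of them cover \<open>K\<close>.\<close>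

lemma uniform_limit_locally_bounded_imp_bounded:
  fixes g :: "real \<Rightarrow> real \<Rightarrow> real"
  assumes K: "compact K" "K \<subseteq> J"
    and lim: "\<And>t. t \<in> J \<Longrightarrow> uniform_limit UNIV g (g t) (at t within J)"
    and bnd: "\<And>t. t \<in> J \<Longrightarrow> \<exists>B. \<forall>x. \<bar>g t x\<bar> \<le> B"
  obtains B where "\<And>t x. t \<in> K \<Longrightarrow> \<bar>g t x\<bar> \<le> B"
proof -
  have "\<exists>U B. open U \<and> t \<in> U \<and> (\<forall>\<tau>\<in>U \<inter> J. \<forall>x. \<bar>g \<tau> x\<bar> \<le> B)" if t: "t \<in> K" for t
  proof -
    have tJ: "t \<in> J" using t K by auto
    obtain B where B: "\<forall>x. \<bar>g t x\<bar> \<le> B" using bnd[OF tJ] by blast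
    have "\<forall>\<^sub>F \<tau> in at t within J. \<forall>x\<in>UNIV. dist (g \<tau> x) (g t x) < 1"
      using uniform_limitD[OF lim[OF tJ], of 1] by simp
    then obtain U where U: "open U" "t \<in> U"
      and *: "\<And>\<tau>. \<tau> \<in> U \<Longrightarrow> \<tau> \<noteq> t \<Longrightarrow> \<tau> \<in> J \<Longrightarrow> \<forall>x. dist (g \<tau> x) (g t x) < 1"
      unfolding eventually_at_topological by auto
    have "\<bar>g \<tau> x\<bar> \<le> B + 1" if "\<tau> \<in> U \<inter> J" for \<tau> x
    proof (cases "\<tau> = t")
      case True thus ?thesis using B[rule_format, of x] by simp
    next
      case False
      hence "dist (g \<tau> x) (g t x) < 1" using * that by auto
      thus ?thesis using B[rule_format, of x] by (simp add: dist_real_def)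
    qed
    thus ?thesis using U by blast
  qed
  then obtain U B where U: "\<And>t. t \<in> K \<Longrightarrow> open (U t)" "\<And>t. t \<in> K \<Longrightarrow> t \<in> U t"
    and B: "\<And>t \<tau> x. t \<in> K \<Longrightarrow> \<tau> \<in> U t \<inter> J \<Longrightarrow> \<bar>g \<tau> x\<bar> \<le> B t" by metis
  obtain C where C: "C \<subseteq> K" "finite C" "K \<subseteq> (\<Union>t\<in>C. U t)"
    by (rule compactE_image[OF K(1), of K U]) (use U in auto)
  show ?thesis
  proof
    fix t x assume t: "t \<in> K"
    then obtain s where s: "s \<in> C" "t \<in> U s" using C by blast
    have "\<bar>g t x\<bar> \<le> \<bar>B s\<bar>" using order_trans[OF B[of s t x] abs_ge_self] s t C K by auto
    also have "\<dots> \<le> (\<Sum>s\<in>C. \<bar>B s\<bar>)" using s C by (intro member_le_sum) auto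
    finally show "\<bar>g t x\<bar> \<le> (\<Sum>s\<in>C. \<bar>B s\<bar>)" .
  qed
qed

lemma continuous_on_uniform_limit_compose:
  fixes g :: "real \<Rightarrow> real \<Rightarrow> real"
  assumes lim: "\<And>t. t \<in> J \<Longrightarrow> uniform_limit UNIV g (g t) (at t within J)"
    and cont: "\<And>t. t \<in> J \<Longrightarrow> continuous_on UNIV (g t)" and q: "continuous_on K q" and KJ: "K \<subseteq> J"
  shows "continuous_on K (\<lambda>t. g t (q t))"
  unfolding continuous_on_def
proof
  fix t assume t: "t \<in> K"
  hence tJ: "t \<in> J" using KJ by auto
  have qt: "(q \<longlongrightarrow> q t) (at t within K)" using q t by (simp add: continuous_on_def)
  have 1: "((\<lambda>\<tau>. g t (q \<tau>)) \<longlongrightarrow> g t (q t)) (at t within K)"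
    by (rule continuous_on_tendsto_compose[OF cont[OF tJ] qt]) auto
  have 2: "((\<lambda>\<tau>. g \<tau> (q \<tau>) - g t (q \<tau>)) \<longlongrightarrow> 0) (at t within K)"
  proof (rule tendstoI)
    fix e :: real assume "e > 0"
    from uniform_limitD[OF lim[OF tJ] this]
    have "\<forall>\<^sub>F \<tau> in at t within K. \<forall>x\<in>UNIV. dist (g \<tau> x) (g t x) < e"
      using at_le[OF KJ] by (rule filter_leD[rotated])
    thus "\<forall>\<^sub>F \<tau> in at t within K. dist (g \<tau> (q \<tau>) - g t (q \<tau>)) 0 < e"
      by eventually_elim (auto simp: dist_real_def)
  qed
  show "((\<lambda>t. g t (q t)) \<longlongrightarrow> g t (q t)) (at t within K)"
    using tendsto_add[OF 2 1] by simp
qed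

section \<open>Evolution along characteristics\<close>

lemma lipschitz_of_bounded_deriv:
  fixes f :: "real \<Rightarrow> real"
  assumes "\<And>x. (f has_real_derivative f' x) (at x)" "\<And>x. \<bar>f' x\<bar> \<le> B"
  shows "\<bar>f x - f y\<bar> \<le> B * \<bar>x - y\<bar>"
  using field_differentiable_bound[of UNIV f f' B x y] assms by simp

text \<open>Classical solutions \<open>v\<close> of the scalar equation on a set \<open>J\<close> of times, with \<open>v'\<close> their slope. All statements about the
  dependence on time are uniform in space, which is what convergence in Sobolev norms yields. The second
  derivative in space and the time derivative of the slope may fail to exist as functions.\<close>

locale rod_solution =
  fixes d :: real and J :: "real set" and v v' :: "real \<Rightarrow> real \<Rightarrow> real"
  assumes d: "d > 0"
    and space_deriv: "\<And>t x. t \<in> J \<Longrightarrow> (v t has_real_derivative v' t x) (at x)"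
    and slope_continuous: "\<And>t. t \<in> J \<Longrightarrow> continuous_on UNIV (v' t)"
    and velocity_bounded: "\<And>t. t \<in> J \<Longrightarrow> \<exists>B. \<forall>x. \<bar>v t x\<bar> \<le> B"
    and slope_bounded: "\<And>t. t \<in> J \<Longrightarrow> \<exists>B. \<forall>x. \<bar>v' t x\<bar> \<le> B"
    and time_continuous: "\<And>t. t \<in> J \<Longrightarrow> uniform_limit UNIV v (v t) (at t within J)"
    and slope_time_continuous: "\<And>t. t \<in> J \<Longrightarrow> uniform_limit UNIV v' (v' t) (at t within J)"
    and time_deriv: "\<And>t. t \<in> J \<Longrightarrow>
      uniform_limit UNIV (\<lambda>\<tau> x. (v \<tau> x - v t x) / (\<tau> - t))
        (\<lambda>x. - d * v t x * v' t x
             - deriv (inverse_helmholtz d (\<lambda>y. d * (v t y)\<^sup>2 + d\<^sup>2 / 2 * (v' t y)\<^sup>2)) x)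
        (at t within J)"
begin

definition source :: "real \<Rightarrow> real \<Rightarrow> real" where
  "source t y = d * (v t y)\<^sup>2 + d\<^sup>2 / 2 * (v' t y)\<^sup>2"

definition pressure :: "real \<Rightarrow> real \<Rightarrow> real" where
  "pressure t = inverse_helmholtz d (source t)"

definition left_pressure :: "real \<Rightarrow> real \<Rightarrow> real" where
  "left_pressure t = half_resolvent (sqrt d) (source t)"

definition right_pressure :: "real \<Rightarrow> real \<Rightarrow> real" where
  "right_pressure t x = half_resolvent (sqrt d) (\<lambda>y. source t (- y)) (- x)"

definition pressure_slope :: "real \<Rightarrow> real \<Rightarrow> real" where
  "pressure_slope t x = (right_pressure t x - left_pressure t x) / sqrt d"

lemma sqrt_d_pos: "sqrt d > 0"
  using d by simp

lemma velocity_continuous: "t \<in> J \<Longrightarrow> continuous_on UNIV (v t)"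
  using space_deriv by (meson DERIV_isCont continuous_at_imp_continuous_on)

lemma source_continuous: "t \<in> J \<Longrightarrow> continuous_on UNIV (source t)"
  unfolding source_def[abs_def] by (intro continuous_intros velocity_continuous slope_continuous)

lemma source_le:
  assumes "\<bar>v t x\<bar> \<le> B" "\<bar>v' t x\<bar> \<le> B'"
  shows "\<bar>source t x\<bar> \<le> d * B\<^sup>2 + d\<^sup>2 / 2 * B'\<^sup>2"
proof -
  have "(v t x)\<^sup>2 \<le> B\<^sup>2" "(v' t x)\<^sup>2 \<le> B'\<^sup>2"
    using power_mono[OF assms(1), of 2] power_mono[OF assms(2), of 2] by simp_all
  hence "source t x \<le> d * B\<^sup>2 + d\<^sup>2 / 2 * B'\<^sup>2"
    unfolding source_def using d by (intro add_mono mult_left_mono) auto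
  moreover have "source t x \<ge> 0" using d by (simp add: source_def)
  ultimately show ?thesis by simp
qed

lemma source_bounded: "t \<in> J \<Longrightarrow> \<exists>M. \<forall>x. \<bar>source t x\<bar> \<le> M"
  using velocity_bounded slope_bounded source_le by metis

lemma source_time_continuous:
  assumes "t \<in> J"
  shows "uniform_limit UNIV source (source t) (at t within J)"
proof -
  have "bounded (range (v t))" "bounded (range (v' t))"
    using velocity_bounded[OF assms] slope_bounded[OF assms] by (auto simp: bounded_iff)
  hence "uniform_limit UNIV (\<lambda>\<tau> x. d * (v \<tau> x * v \<tau> x) + d\<^sup>2 / 2 * (v' \<tau> x * v' \<tau> x))
      (\<lambda>x. d * (v t x * v t x) + d\<^sup>2 / 2 * (v' t x * v' t x)) (at t within J)"
    by (intro uniform_limit_add bounded_linear.uniform_limit[OF bounded_linear_mult_right]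
        uniform_lim_mult time_continuous slope_time_continuous assms)
  thus ?thesis by (simp add: source_def[abs_def] power2_eq_square)
qed

lemma pressure_split: "t \<in> J \<Longrightarrow> pressure t x = left_pressure t x + right_pressure t x"
  unfolding pressure_def left_pressure_def right_pressure_def
  using inverse_helmholtz_split[OF d source_continuous] source_bounded by blast

lemma reflected_source_continuous: "t \<in> J \<Longrightarrow> continuous_on UNIV (\<lambda>y. source t (- y))"
  by (intro continuous_on_compose2[OF source_continuous] continuous_intros) auto

lemma left_pressure_DERIV:
  assumes "t \<in> J"
  shows "(left_pressure t has_real_derivative
    source t x / (2 * sqrt d) - left_pressure t x / sqrt d) (at x)"
  unfolding left_pressure_def
  using half_resolvent_DERIV[OF sqrt_d_pos source_continuous[OF assms]] source_bounded[OF assms] by blast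

lemma right_pressure_DERIV:
  assumes "t \<in> J"
  shows "(right_pressure t has_real_derivative
    right_pressure t x / sqrt d - source t x / (2 * sqrt d)) (at x)"
proof -
  have "(half_resolvent (sqrt d) (\<lambda>y. source t (- y)) has_real_derivative
      source t (- (- x)) / (2 * sqrt d) - half_resolvent (sqrt d) (\<lambda>y. source t (- y)) (- x) / sqrt d) (at (- x))"
    using half_resolvent_DERIV[OF sqrt_d_pos reflected_source_continuous[OF assms]] source_bounded[OF assms] by blast
  moreover have "(uminus has_real_derivative - 1) (at x)"
    by (auto intro!: derivative_eq_intros)
  ultimately show ?thesis
    using DERIV_chain2[where g=uminus and x=x and Db="-1" and s=UNIV]
    by (fastforce simp: right_pressure_def[abs_def])
qed

lemma pressure_DERIV:
  assumes "t \<in> J"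
  shows "(pressure t has_real_derivative pressure_slope t x) (at x)"
proof -
  have "pressure t = (\<lambda>x. left_pressure t x + right_pressure t x)"
    using pressure_split[OF assms] by (simp add: fun_eq_iff)
  thus ?thesis
    using DERIV_add[OF left_pressure_DERIV[OF assms] right_pressure_DERIV[OF assms], of x]
    by (simp add: pressure_slope_def diff_divide_distrib)
qed

lemma pressure_slope_DERIV:
  assumes "t \<in> J"
  shows "(pressure_slope t has_real_derivative (pressure t x - source t x) / d) (at x)"
proof -
  have "(pressure_slope t has_real_derivative
     ((right_pressure t x / sqrt d - source t x / (2 * sqrt d))
      - (source t x / (2 * sqrt d) - left_pressure t x / sqrt d)) / sqrt d) (at x)"
    unfolding pressure_slope_def[abs_def]
    by (intro DERIV_cdivide DERIV_diff left_pressure_DERIV right_pressure_DERIV assms)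
  also have "((right_pressure t x / sqrt d - source t x / (2 * sqrt d))
      - (source t x / (2 * sqrt d) - left_pressure t x / sqrt d)) / sqrt d
      = (left_pressure t x + right_pressure t x - source t x) / (sqrt d * sqrt d)"
  proof -
    have "((r / k - s / (2 * k)) - (s / (2 * k) - l / k)) / k = (l + r - s) / (k * k)" if "k > 0" for k l r s :: real
      using that by (simp add: field_simps)
    thus ?thesis using sqrt_d_pos by blast
  qed
  finally show ?thesis using d by (simp add: pressure_split[OF assms])
qed

lemma pressure_slope_continuous: "t \<in> J \<Longrightarrow> continuous_on UNIV (pressure_slope t)"
  using pressure_slope_DERIV by (meson DERIV_isCont continuous_at_imp_continuous_on)

lemma pressure_continuous: "t \<in> J \<Longrightarrow> continuous_on UNIV (pressure t)"
  using pressure_DERIV by (meson DERIV_isCont continuous_at_imp_continuous_on)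

lemma pressure_le:
  assumes "t \<in> J" "\<And>x. \<bar>source t x\<bar> \<le> M"
  shows "\<bar>pressure t x\<bar> \<le> M"
  using half_resolvent_bound[OF sqrt_d_pos source_continuous, of t M x]
    half_resolvent_bound[OF sqrt_d_pos reflected_source_continuous, of t M "- x"] assms
  unfolding pressure_split[OF assms(1)] left_pressure_def right_pressure_def by fastforce

text \<open>The kernel has total mass \<open>1\<close>, so the pressures of two times are at least as close as the sources.\<close>

lemma pressure_time_continuous:
  assumes t: "t \<in> J"
  shows "uniform_limit UNIV pressure (pressure t) (at t within J)"
proof (rule uniform_limitI)
  fix e :: real assume e: "e > 0"
  have "\<forall>\<^sub>F \<tau> in at t within J. \<forall>x\<in>UNIV. dist (source \<tau> x) (source t x) < e / 2"
    using uniform_limitD[OF source_time_continuous[OF t], of "e/2"] e by simp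
  moreover have "\<forall>\<^sub>F \<tau> in at t within J. \<tau> \<in> J" by (auto simp: eventually_at_filter)
  ultimately show "\<forall>\<^sub>F \<tau> in at t within J. \<forall>x\<in>UNIV. dist (pressure \<tau> x) (pressure t x) < e"
  proof eventually_elim
    case (elim \<tau>)
    have *: "\<bar>source \<tau> x - source t x\<bar> \<le> e / 2" for x using elim by (auto simp: dist_real_def less_imp_le)
    obtain M N where M: "\<And>x. \<bar>source \<tau> x\<bar> \<le> M" and N: "\<And>x. \<bar>source t x\<bar> \<le> N"
      using source_bounded[OF t] source_bounded[OF elim(2)] by blast
    have "\<bar>left_pressure \<tau> x - left_pressure t x\<bar> \<le> e / 2 / 2" for x
      unfolding left_pressure_def
      by (rule half_resolvent_diff[OF sqrt_d_pos source_continuous[OF elim(2)] M source_continuous[OF t] N *])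
    moreover have "\<bar>right_pressure \<tau> x - right_pressure t x\<bar> \<le> e / 2 / 2" for x
      unfolding right_pressure_def
      by (rule half_resolvent_diff[OF sqrt_d_pos reflected_source_continuous[OF elim(2)] M
            reflected_source_continuous[OF t] N *])
    ultimately have *: "\<bar>pressure \<tau> x - pressure t x\<bar> \<le> e / 2" for x
      unfolding pressure_split[OF elim(2)] pressure_split[OF t]
      by (smt (verit) field_sum_of_halves)
    have "\<bar>pressure \<tau> x - pressure t x\<bar> < e" for x
      using *[of x] e by linarith
    thus ?case by (simp add: dist_real_def)
  qed
qed

lemma evolution:
  assumes "t \<in> J"
  shows "uniform_limit UNIV (\<lambda>\<tau> x. (v \<tau> x - v t x) / (\<tau> - t))
    (\<lambda>x. - d * v t x * v' t x - pressure_slope t x) (at t within J)"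
proof -
  have "deriv (inverse_helmholtz d (\<lambda>y. d * (v t y)\<^sup>2 + d\<^sup>2 / 2 * (v' t y)\<^sup>2)) x = pressure_slope t x" for x
    using pressure_DERIV[OF assms, of x]
    by (intro DERIV_imp_deriv) (simp add: pressure_def source_def[abs_def])
  thus ?thesis using time_deriv[OF assms] by simp
qed

text \<open>The chain rule without joint differentiability: the increment is split at \<open>v t (q \<tau>)\<close>. The first part is a
  difference quotient in time at a moving point, for which uniformity in space is needed.\<close>

lemma velocity_along_characteristic:
  assumes SJ: "{0..S} \<subseteq> J" and t: "t \<in> {0..S}"
    and q: "(q has_real_derivative d * v t (q t)) (at t within {0..S})"
  shows "((\<lambda>\<tau>. v \<tau> (q \<tau>)) has_real_derivative - pressure_slope t (q t)) (at t within {0..S})"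
proof -
  have tJ: "t \<in> J" using SJ t by auto
  define A where "A x = - d * v t x * v' t x - pressure_slope t x" for x
  have Ac: "continuous_on UNIV A" unfolding A_def
    by (intro continuous_intros velocity_continuous slope_continuous pressure_slope_continuous tJ)
  have qt: "(q \<longlongrightarrow> q t) (at t within {0..S})"
    using DERIV_continuous[OF q] by (simp add: continuous_within)
  have 1: "((\<lambda>\<tau>. A (q \<tau>)) \<longlongrightarrow> A (q t)) (at t within {0..S})"
    by (rule continuous_on_tendsto_compose[OF Ac qt]) auto
  have 2: "((\<lambda>\<tau>. (v \<tau> (q \<tau>) - v t (q \<tau>)) / (\<tau> - t) - A (q \<tau>)) \<longlongrightarrow> 0) (at t within {0..S})"
  proof (rule tendstoI)
    fix e :: real assume "e > 0"
    from uniform_limitD[OF evolution[OF tJ] this]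
    have "\<forall>\<^sub>F \<tau> in at t within {0..S}. \<forall>x\<in>UNIV. dist ((v \<tau> x - v t x) / (\<tau> - t)) (A x) < e"
      unfolding A_def using at_le[OF SJ] by (rule filter_leD[rotated])
    thus "\<forall>\<^sub>F \<tau> in at t within {0..S}. dist ((v \<tau> (q \<tau>) - v t (q \<tau>)) / (\<tau> - t) - A (q \<tau>)) 0 < e"
      by eventually_elim (auto simp: dist_real_def)
  qed
  have 3: "((\<lambda>\<tau>. (v t (q \<tau>) - v t (q t)) / (\<tau> - t)) \<longlongrightarrow> v' t (q t) * (d * v t (q t))) (at t within {0..S})"
    using DERIV_chain2[OF space_deriv[OF tJ] q] by (simp add: has_field_derivative_iff)
  have "((\<lambda>\<tau>. (v \<tau> (q \<tau>) - v t (q \<tau>)) / (\<tau> - t) - A (q \<tau>) + A (q \<tau>)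
          + (v t (q \<tau>) - v t (q t)) / (\<tau> - t))
      \<longlongrightarrow> 0 + A (q t) + v' t (q t) * (d * v t (q t))) (at t within {0..S})"
    by (intro tendsto_intros 1 2 3)
  moreover have "0 + A (q t) + v' t (q t) * (d * v t (q t)) = - pressure_slope t (q t)"
    by (simp add: A_def)
  ultimately show ?thesis
    by (simp add: has_field_derivative_iff add_divide_distrib[symmetric])
qed

lemma uniform_bounds:
  assumes "{0..S} \<subseteq> J"
  obtains B B' where "\<And>t x. t \<in> {0..S} \<Longrightarrow> \<bar>v t x\<bar> \<le> B" "\<And>t x. t \<in> {0..S} \<Longrightarrow> \<bar>v' t x\<bar> \<le> B'"
proof -
  obtain B where "\<And>t x. t \<in> {0..S} \<Longrightarrow> \<bar>v t x\<bar> \<le> B"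
    using uniform_limit_locally_bounded_imp_bounded[OF compact_Icc assms time_continuous velocity_bounded] by blast
  moreover obtain B' where "\<And>t x. t \<in> {0..S} \<Longrightarrow> \<bar>v' t x\<bar> \<le> B'"
    using uniform_limit_locally_bounded_imp_bounded[OF compact_Icc assms slope_time_continuous slope_bounded] by blast
  ultimately show ?thesis by (rule that)
qed

lemma characteristic_exists:
  assumes SJ: "{0..S} \<subseteq> J" and S: "0 \<le> S"
  obtains q where "q 0 = x0"
    and "\<And>t. t \<in> {0..S} \<Longrightarrow> (q has_real_derivative d * v t (q t)) (at t within {0..S})"
proof -
  obtain B B' where B': "\<And>t x. t \<in> {0..S} \<Longrightarrow> \<bar>v' t x\<bar> \<le> B'"
    using uniform_bounds[OF SJ] by metis
  have B'0: "0 \<le> B'" using order_trans[OF abs_ge_zero B'[of 0 0]] S by simp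
  show ?thesis
  proof (rule picard_lindelof_Icc[of S "d * B' + 1" "\<lambda>t x. d * v t x" x0])
    show "0 < d * B' + 1" using d B'0 by (simp add: add_nonneg_pos)
    show "continuous_on {0..S} (\<lambda>t. d * v t (q t))" if "continuous_on {0..S} q" for q
      by (intro continuous_intros continuous_on_uniform_limit_compose[OF time_continuous velocity_continuous that SJ])
    show "\<bar>d * v t x - d * v t y\<bar> \<le> (d * B' + 1) * \<bar>x - y\<bar>" if t: "t \<in> {0..S}" for t x y
    proof -
      have "\<bar>v t x - v t y\<bar> \<le> B' * \<bar>x - y\<bar>"
        using t SJ B'[OF t] by (intro lipschitz_of_bounded_deriv[OF space_deriv]) auto
      hence "d * \<bar>v t x - v t y\<bar> \<le> d * (B' * \<bar>x - y\<bar>)" using d by (intro mult_left_mono) auto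
      moreover have "\<bar>d * v t x - d * v t y\<bar> = d * \<bar>v t x - v t y\<bar>"
        using d by (simp add: right_diff_distrib[symmetric] abs_mult)
      ultimately show ?thesis using abs_ge_zero[of "x - y"] by (simp add: distrib_right)
    qed
  qed (use S that in auto)
qed

end

context rod_solution
begin

text \<open>For a second characteristic \<open>r\<close> put \<open>\<delta> = r - q\<close>, \<open>D = (v(r) - v(q))/\<delta>\<close> and let \<open>E\<close> be the same quotient of the
  pressure slope. Then \<open>D' = - E - d D\<^sup>2\<close>, because \<open>\<delta>' = d D \<delta>\<close>. As the starting points approach each other, \<open>\<delta>\<close>
  tends to \<open>0\<close> without vanishing, \<open>D\<close> tends to \<open>v\<^sub>x\<close> and \<open>E\<close> to \<open>H\<^sub>x\<^sub>x\<close> along \<open>q\<close>; the integrated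
  equation passes to the limit by dominated convergence, and its integrand is continuous.\<close>

lemma slope_along_characteristic:
  assumes SJ: "{0..S} \<subseteq> J"
    and q: "\<And>t. t \<in> {0..S} \<Longrightarrow> (q has_real_derivative d * v t (q t)) (at t within {0..S})"
    and t: "t \<in> {0..S}"
  shows "((\<lambda>\<tau>. v' \<tau> (q \<tau>)) has_real_derivative
      (source t (q t) - pressure t (q t)) / d - d * (v' t (q t))\<^sup>2) (at t within {0..S})"
proof -
  have S: "0 \<le> S" using t by auto
  obtain B B' where B: "\<And>t x. t \<in> {0..S} \<Longrightarrow> \<bar>v t x\<bar> \<le> B"
    and B': "\<And>t x. t \<in> {0..S} \<Longrightarrow> \<bar>v' t x\<bar> \<le> B'"
    using uniform_bounds[OF SJ] by metis
  define M where "M = d * B\<^sup>2 + d\<^sup>2 / 2 * B'\<^sup>2"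
  have M: "\<bar>source t x\<bar> \<le> M" if "t \<in> {0..S}" for t x
    unfolding M_def by (intro source_le B B' that)
  have J: "t \<in> J" if "t \<in> {0..S}" for t using SJ that by auto
  have lip: "\<bar>v t x - v t y\<bar> \<le> B' * \<bar>x - y\<bar>" if "t \<in> {0..S}" for t x y
    using that by (intro lipschitz_of_bounded_deriv[OF space_deriv[OF J] B'])
  have plip: "\<bar>pressure_slope t x - pressure_slope t y\<bar> \<le> 2 * M / d * \<bar>x - y\<bar>" if t: "t \<in> {0..S}" for t x y
  proof (rule lipschitz_of_bounded_deriv[OF pressure_slope_DERIV[OF J[OF t]]])
    fix z
    have "\<bar>pressure t z - source t z\<bar> \<le> 2 * M"
      using M[OF t, of z] pressure_le[OF J[OF t] M[OF t], of z] by linarith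
    thus "\<bar>(pressure t z - source t z) / d\<bar> \<le> 2 * M / d"
      using d by (simp add: abs_div divide_right_mono)
  qed
  define h where "h n = inverse (real (Suc n))" for n
  have h0: "h n > 0" for n by (simp add: h_def)
  have "\<exists>r. r 0 = q 0 + h n \<and> (\<forall>t\<in>{0..S}. (r has_real_derivative d * v t (r t)) (at t within {0..S}))" for n
    by (rule characteristic_exists[OF SJ S, of "q 0 + h n"]) blast
  then obtain r where r0: "\<And>n. r n 0 = q 0 + h n"
    and r: "\<And>n t. t \<in> {0..S} \<Longrightarrow> (r n has_real_derivative d * v t (r n t)) (at t within {0..S})"
    by metis
  define \<delta> where "\<delta> n t = r n t - q t" for n t
  define p where "p n t = v t (r n t) - v t (q t)" for n t
  have d\<delta>: "(\<delta> n has_real_derivative d * p n t) (at t within {0..S})" if "t \<in> {0..S}" for n t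
    unfolding \<delta>_def[abs_def] p_def right_diff_distrib by (intro DERIV_diff r q that)
  have \<delta>'b: "\<bar>d * p n t\<bar> \<le> d * B' * \<bar>\<delta> n t\<bar>" if "t \<in> {0..S}" for n t
    using lip[OF that, of "r n t" "q t"] d by (simp add: p_def \<delta>_def abs_mult)
  have \<delta>0: "\<delta> n t \<noteq> 0" if "t \<in> {0..S}" for n t
    using linear_growth_bounds(2)[OF d\<delta> \<delta>'b that] h0[of n] by (simp add: \<delta>_def r0)
  have \<delta>lim: "(\<lambda>n. \<delta> n t) \<longlonglongrightarrow> 0" if t: "t \<in> {0..S}" for t
  proof (rule Lim_null_comparison)
    show "\<forall>\<^sub>F n in sequentially. norm (\<delta> n t) \<le> exp (d * B' * t) * h n"
      using linear_growth_bounds(1)[OF d\<delta> \<delta>'b t] h0 by (auto simp: \<delta>_def r0 less_imp_le)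
    show "(\<lambda>n. exp (d * B' * t) * h n) \<longlonglongrightarrow> 0"
      unfolding h_def by (intro tendsto_mult_right_zero LIMSEQ_inverse_real_of_nat)
  qed
  define D where "D n t = p n t / \<delta> n t" for n t
  define E where "E n t = (pressure_slope t (r n t) - pressure_slope t (q t)) / \<delta> n t" for n t
  have dp: "(p n has_real_derivative - pressure_slope t (r n t) + pressure_slope t (q t)) (at t within {0..S})"
    if "t \<in> {0..S}" for n t
    using DERIV_diff[OF velocity_along_characteristic[OF SJ that r[OF that]]
        velocity_along_characteristic[OF SJ that q[OF that]]]
    by (simp add: p_def[abs_def])
  have dD: "(D n has_real_derivative - E n t - d * (D n t)\<^sup>2) (at t within {0..S})" if "t \<in> {0..S}" for n t
  proof -
    have "(x * z - y * (d * y)) / (z * z) = x / z - d * (y / z)\<^sup>2" if "z \<noteq> 0" for x y z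
      using that by (simp add: field_simps power2_eq_square)
    note alg = this[OF \<delta>0[OF that, of n], of "- pressure_slope t (r n t) + pressure_slope t (q t)" "p n t"]
    have "(- pressure_slope t (r n t) + pressure_slope t (q t)) / \<delta> n t = - E n t"
      unfolding E_def minus_divide_left by simp
    thus ?thesis
      using DERIV_divide[OF dp[OF that] d\<delta>[OF that] \<delta>0[OF that], of n n]
      unfolding alg D_def[abs_def] by simp
  qed
  have quot: "(\<lambda>n. (f (r n t) - f (q t)) / \<delta> n t) \<longlonglongrightarrow> f'"
    if t: "t \<in> {0..S}" and f: "(f has_real_derivative f') (at (q t))" for f f' t
  proof -
    have "((\<lambda>h. (f (q t + h) - f (q t)) / h) \<longlongrightarrow> f') (at 0)" using f by (simp add: DERIV_def)
    hence "((\<lambda>h. (f (q t + h) - f (q t)) / h) \<circ> (\<lambda>n. \<delta> n t)) \<longlonglongrightarrow> f'"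
      using \<delta>lim[OF t] \<delta>0[OF t] by (simp add: tendsto_at_iff_sequentially)
    thus ?thesis by (simp add: comp_def \<delta>_def)
  qed
  have Dlim: "(\<lambda>n. D n t) \<longlonglongrightarrow> v' t (q t)" if "t \<in> {0..S}" for t
    unfolding D_def p_def by (rule quot[OF that space_deriv[OF J[OF that]]])
  have Elim: "(\<lambda>n. E n t) \<longlonglongrightarrow> (pressure t (q t) - source t (q t)) / d" if "t \<in> {0..S}" for t
    unfolding E_def by (rule quot[OF that pressure_slope_DERIV[OF J[OF that]]])
  have Db: "\<bar>D n t\<bar> \<le> B'" if "t \<in> {0..S}" for n t
    using lip[OF that, of "r n t" "q t"] \<delta>0[OF that, of n]
    by (simp add: D_def p_def \<delta>_def abs_div pos_divide_le_eq)
  have Eb: "\<bar>E n t\<bar> \<le> 2 * M / d" if "t \<in> {0..S}" for n t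
    using plip[OF that, of "r n t" "q t"] \<delta>0[OF that, of n]
    by (simp add: E_def \<delta>_def abs_div pos_divide_le_eq)
  define G where "G t = (source t (q t) - pressure t (q t)) / d - d * (v' t (q t))\<^sup>2" for t
  have qc: "continuous_on {0..S} q"
    using q by (meson DERIV_continuous continuous_on_eq_continuous_within)
  have Gc: "continuous_on {0..S} G"
    unfolding G_def using d
    by (intro continuous_intros
        continuous_on_uniform_limit_compose[OF source_time_continuous source_continuous qc SJ]
        continuous_on_uniform_limit_compose[OF pressure_time_continuous pressure_continuous qc SJ]
        continuous_on_uniform_limit_compose[OF slope_time_continuous slope_continuous qc SJ]) auto
  have main: "v' t (q t) = v' 0 (q 0) + integral {0..t} G" if t: "t \<in> {0..S}" for t
  proof -
    have hi: "((\<lambda>s. - E n s - d * (D n s)\<^sup>2) has_integral (D n t - D n 0)) {0..t}" for n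
      using t by (intro fundamental_theorem_of_calculus)
        (auto simp: has_real_derivative_iff_has_vector_derivative[symmetric]
          intro!: DERIV_subset[OF dD, of _ "{0..t}"])
    have "(\<lambda>n. integral {0..t} (\<lambda>s. - E n s - d * (D n s)\<^sup>2)) \<longlonglongrightarrow> integral {0..t} G"
    proof (rule dominated_convergence(2))
      show "(\<lambda>s. - E n s - d * (D n s)\<^sup>2) integrable_on {0..t}" for n
        using hi by (rule has_integral_integrable)
      show "(\<lambda>s. 2 * M / d + d * B'\<^sup>2) integrable_on {0..t}" by (rule integrable_const_ivl)
      fix s assume "s \<in> {0..t}"
      hence s: "s \<in> {0..S}" using t by auto
      show "norm (- E n s - d * (D n s)\<^sup>2) \<le> 2 * M / d + d * B'\<^sup>2" for n
      proof -
        have "(D n s)\<^sup>2 \<le> B'\<^sup>2" using power_mono[OF Db[OF s, of n], of 2] by simp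
        hence "d * (D n s)\<^sup>2 \<le> d * B'\<^sup>2" using d by (intro mult_left_mono) auto
        moreover have "0 \<le> d * (D n s)\<^sup>2" using d by simp
        ultimately show ?thesis using Eb[OF s, of n] unfolding real_norm_def by linarith
      qed
      have "(\<lambda>n. - E n s - d * (D n s)\<^sup>2) \<longlonglongrightarrow> - ((pressure s (q s) - source s (q s)) / d) - d * (v' s (q s))\<^sup>2"
        by (intro tendsto_intros Elim Dlim s)
      also have "- ((pressure s (q s) - source s (q s)) / d) - d * (v' s (q s))\<^sup>2 = G s"
        by (simp add: G_def diff_divide_distrib)
      finally show "(\<lambda>n. - E n s - d * (D n s)\<^sup>2) \<longlonglongrightarrow> G s" .
    qed
    hence "(\<lambda>n. D n t - D n 0) \<longlonglongrightarrow> integral {0..t} G" using integral_unique[OF hi] by simp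
    moreover have "(\<lambda>n. D n t - D n 0) \<longlonglongrightarrow> v' t (q t) - v' 0 (q 0)"
      using S by (intro tendsto_diff Dlim t) auto
    ultimately show ?thesis using LIMSEQ_unique by fastforce
  qed
  have "((\<lambda>t. v' 0 (q 0) + integral {0..t} G) has_real_derivative G t) (at t within {0..S})"
    using integral_has_real_derivative[OF Gc t] by (auto intro!: derivative_eq_intros)
  hence "((\<lambda>\<tau>. v' \<tau> (q \<tau>)) has_real_derivative G t) (at t within {0..S})"
    by (rule has_field_derivative_transform_within[OF _ zero_less_one t]) (rule main[symmetric])
  thus ?thesis by (simp add: G_def)
qed

end

section \<open>Finite lifespan\<close>

context rod_solution
begin

lemma left_pressure_lower_bound:
  assumes t: "t \<in> J"
  shows "d * (v t x)\<^sup>2 / 4 \<le> left_pressure t x"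
proof -
  obtain B B' where B: "\<And>x. \<bar>v t x\<bar> \<le> B" "\<And>x. \<bar>v' t x\<bar> \<le> B'"
    using velocity_bounded[OF t] slope_bounded[OF t] by blast
  from half_resolvent_lower_bound[OF sqrt_d_pos space_deriv[OF t] slope_continuous[OF t] B]
  show ?thesis using d by (simp add: left_pressure_def source_def[abs_def])
qed

lemma right_pressure_lower_bound:
  assumes t: "t \<in> J"
  shows "d * (v t x)\<^sup>2 / 4 \<le> right_pressure t x"
proof -
  obtain B B' where B: "\<And>x. \<bar>v t x\<bar> \<le> B" "\<And>x. \<bar>v' t x\<bar> \<le> B'"
    using velocity_bounded[OF t] slope_bounded[OF t] by blast
  have "((\<lambda>y. v t (- y)) has_real_derivative - v' t (- y)) (at y)" for y
  proof -
    have "(uminus has_real_derivative - 1) (at y)" by (auto intro!: derivative_eq_intros)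
    from DERIV_chain2[OF space_deriv[OF t] this] show ?thesis by simp
  qed
  moreover have "continuous_on UNIV (\<lambda>y. - v' t (- y))"
    by (intro continuous_intros continuous_on_compose2[OF slope_continuous[OF t]]) auto
  ultimately have "(sqrt d)\<^sup>2 * (v t (- (- x)))\<^sup>2 / 4
      \<le> half_resolvent (sqrt d) (\<lambda>y. (sqrt d)\<^sup>2 * (v t (- y))\<^sup>2 + ((sqrt d)\<^sup>2)\<^sup>2 / 2 * (- v' t (- y))\<^sup>2) (- x)"
    by (rule half_resolvent_lower_bound[OF sqrt_d_pos]) (use B in auto)
  thus ?thesis using d by (simp add: right_pressure_def source_def[abs_def])
qed

text \<open>\<open>riccati_pair_lifespan\<close> for \<open>a = v - c v\<^sub>x\<close> and \<open>b = v + c v\<^sub>x\<close> with \<open>k = c/2\<close>. In \<open>a'\<close> the right half of the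
  pressure cancels and in \<open>b'\<close> the left one; the other half is estimated from below by \<open>d v\<^sup>2/4\<close>.\<close>

lemma lifespan_bound:
  assumes SJ: "{0..S} \<subseteq> J" and S: "0 \<le> S" and init: "v' 0 x0 < - (1 / sqrt d) * \<bar>v 0 x0\<bar>"
  shows "sqrt d * S < 1 / (v 0 x0 - sqrt d * v' 0 x0) - 1 / (v 0 x0 + sqrt d * v' 0 x0)"
proof -
  define c where "c = sqrt d"
  have c: "c > 0" and dcc: "d = c * c" using d by (auto simp: c_def)
  obtain q where q0: "q 0 = x0"
    and q: "\<And>t. t \<in> {0..S} \<Longrightarrow> (q has_real_derivative d * v t (q t)) (at t within {0..S})"
    using characteristic_exists[OF SJ S] by metis
  define a where "a t = v t (q t) - c * v' t (q t)" for t
  define b where "b t = v t (q t) + c * v' t (q t)" for t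
  define W where "W t = (source t (q t) - pressure t (q t)) / d - d * (v' t (q t))\<^sup>2" for t
  have J: "t \<in> J" if "t \<in> {0..S}" for t using SJ that by auto
  note dv = velocity_along_characteristic[OF SJ _ q]
  note dv' = slope_along_characteristic[OF SJ q, folded W_def]
  have W: "c * W t = c * (v t (q t))\<^sup>2 - c * d / 2 * (v' t (q t))\<^sup>2
      - (left_pressure t (q t) + right_pressure t (q t)) / c" if "t \<in> {0..S}" for t
  proof -
    have "c * ((d * V\<^sup>2 + d\<^sup>2 / 2 * V'\<^sup>2 - (l + r)) / d - d * V'\<^sup>2)
        = c * V\<^sup>2 - c * d / 2 * V'\<^sup>2 - (l + r) / c" for V V' l r
      using c unfolding dcc by (simp add: field_simps power2_eq_square)
    thus ?thesis unfolding W_def pressure_split[OF J[OF that]] source_def .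
  qed
  have ab: "a t * b t = (v t (q t))\<^sup>2 - d * (v' t (q t))\<^sup>2" for t
    unfolding a_def b_def dcc by (simp add: algebra_simps power2_eq_square)
  have low: "c / 4 * (v t (q t))\<^sup>2 \<le> left_pressure t (q t) / c"
       "c / 4 * (v t (q t))\<^sup>2 \<le> right_pressure t (q t) / c" if "t \<in> {0..S}" for t
    using left_pressure_lower_bound[OF J[OF that], of "q t"] right_pressure_lower_bound[OF J[OF that], of "q t"] c
    unfolding dcc by (simp_all add: field_simps)
  have "2 * (c / 2) * S < 1 / a 0 - 1 / b 0"
  proof (rule riccati_pair_lifespan)
    show "0 < c / 2" using c by simp
    fix t assume t: "t \<in> {0..S}"
    show "(a has_real_derivative - pressure_slope t (q t) - c * W t) (at t within {0..S})"
      unfolding a_def[abs_def] by (auto intro!: derivative_eq_intros dv dv' t)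
    show "(b has_real_derivative - pressure_slope t (q t) + c * W t) (at t within {0..S})"
      unfolding b_def[abs_def] by (auto intro!: derivative_eq_intros dv dv' t)
    have ps: "pressure_slope t (q t) = right_pressure t (q t) / c - left_pressure t (q t) / c"
      by (simp add: pressure_slope_def c_def diff_divide_distrib)
    have k: "c / 2 * (a t * b t) = c / 2 * (v t (q t))\<^sup>2 - c * d / 2 * (v' t (q t))\<^sup>2"
      unfolding ab by (simp add: algebra_simps)
    show "- (c / 2) * (a t * b t) \<le> - pressure_slope t (q t) - c * W t"
      using low[OF t] k unfolding W[OF t] ps add_divide_distrib by linarith
    show "- pressure_slope t (q t) + c * W t \<le> c / 2 * (a t * b t)"
      using low[OF t] k unfolding W[OF t] ps add_divide_distrib by linarith
  next
    have "c * v' 0 x0 < c * (- (1 / c) * \<bar>v 0 x0\<bar>)"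
      using init c by (intro mult_strict_left_mono) (auto simp: c_def)
    hence "c * v' 0 x0 < - \<bar>v 0 x0\<bar>" using c by simp
    thus "0 < a 0" "b 0 < 0" by (auto simp: a_def b_def q0)
  qed (rule S)
  thus ?thesis by (simp add: a_def b_def q0 c_def)
qed

lemma not_global:
  assumes "v' 0 x0 < - (1 / sqrt d) * \<bar>v 0 x0\<bar>"
  shows "\<not> {0..} \<subseteq> J"
proof
  assume J: "{0..} \<subseteq> J"
  define C where "C = 1 / (v 0 x0 - sqrt d * v' 0 x0) - 1 / (v 0 x0 + sqrt d * v' 0 x0)"
  have "sqrt d * S < C" if "0 \<le> S" for S
    unfolding C_def using J that by (intro lifespan_bound assms) auto
  from this[of "\<bar>C\<bar> / sqrt d"] show False using sqrt_d_pos by simp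
qed

end

section \<open>Plane waves tested against compactly supported functions\<close>

definition coordinate_sum :: "real^'n::finite \<Rightarrow> real" where
  "coordinate_sum x = (\<Sum>i\<in>UNIV. x $ i)"

lemma coordinate_sum_add: "coordinate_sum (x + y) = coordinate_sum x + coordinate_sum y"
  by (simp add: coordinate_sum_def sum.distrib)

lemma coordinate_sum_scaleR: "coordinate_sum (r *\<^sub>R x) = r * coordinate_sum x"
  by (simp add: coordinate_sum_def sum_distrib_left)

lemma coordinate_sum_axis [simp]: "coordinate_sum (axis k 1) = 1"
  by (simp add: coordinate_sum_def axis_def if_distrib cong: if_cong)

lemma bounded_linear_coordinate_sum: "bounded_linear (coordinate_sum :: real^'n::finite \<Rightarrow> real)"
  by (rule linear_conv_bounded_linear[THEN iffD1])
     (auto intro!: linearI simp: coordinate_sum_add coordinate_sum_scaleR)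

lemma continuous_on_coordinate_sum:
  "continuous_on UNIV g \<Longrightarrow> continuous_on S (\<lambda>x::real^'n::finite. g (coordinate_sum x))"
  by (rule continuous_on_compose2[of UNIV g])
     (auto intro!: linear_continuous_on bounded_linear_coordinate_sum)

lemma directional_derivative:
  fixes f :: "real^'n::finite \<Rightarrow> real"
  assumes "f differentiable (at (x + h *\<^sub>R b))"
  shows "((\<lambda>h. f (x + h *\<^sub>R b)) has_real_derivative frechet_derivative f (at (x + h *\<^sub>R b)) b) (at h)"
proof -
  have 1: "(f has_derivative frechet_derivative f (at (x + h *\<^sub>R b))) (at (x + h *\<^sub>R b))"
    using assms by (simp add: frechet_derivative_works)
  have 2: "((\<lambda>h. x + h *\<^sub>R b) has_derivative (\<lambda>h. h *\<^sub>R b)) (at h)"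
    by (auto intro!: derivative_eq_intros)
  have "((\<lambda>h. f (x + h *\<^sub>R b)) has_derivative (\<lambda>h'. frechet_derivative f (at (x + h *\<^sub>R b)) (h' *\<^sub>R b))) (at h)"
    by (rule has_derivative_compose[OF 2 1])
  moreover have "frechet_derivative f (at (x + h *\<^sub>R b)) (h' *\<^sub>R b) = frechet_derivative f (at (x + h *\<^sub>R b)) b * h'" for h'
    using linear_frechet_derivative[OF assms] by (simp add: linear_cmul)
  ultimately show ?thesis by (simp add: has_field_derivative_def)
qed

lemma partial_deriv_eq_frechet:
  fixes f :: "real^'n::finite \<Rightarrow> real"
  assumes "f differentiable (at x)"
  shows "partial_deriv k f x = frechet_derivative f (at x) (axis k 1)"
  using directional_derivative[of f x 0 "axis k 1"] assms
  by (auto simp: partial_deriv_def intro!: DERIV_imp_deriv)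

lemma partial_deriv_mult:
  fixes f g :: "real^'n::finite \<Rightarrow> real"
  assumes "f differentiable (at x)" "g differentiable (at x)"
  shows "partial_deriv k (\<lambda>x. f x * g x) x = partial_deriv k f x * g x + f x * partial_deriv k g x"
proof -
  have f: "((\<lambda>h. f (x + h *\<^sub>R axis k 1)) has_real_derivative partial_deriv k f x) (at 0)"
    and g: "((\<lambda>h. g (x + h *\<^sub>R axis k 1)) has_real_derivative partial_deriv k g x) (at 0)"
    using directional_derivative[of f x 0 "axis k 1"] directional_derivative[of g x 0 "axis k 1"] assms
    by (auto simp: partial_deriv_eq_frechet)
  show ?thesis unfolding partial_deriv_def[of k "\<lambda>x. f x * g x"]
    using DERIV_mult[OF f g] by (intro DERIV_imp_deriv) (simp add: mult.commute[of "f x"])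
qed

lemma plane_wave_differentiable:
  assumes "\<And>s. (g has_real_derivative g' s) (at s)"
  shows "(\<lambda>x::real^'n::finite. g (coordinate_sum x)) differentiable (at x)"
  using has_derivative_compose[OF bounded_linear_imp_has_derivative[OF bounded_linear_coordinate_sum],
      of g "(*) (g' (coordinate_sum x))" x UNIV] assms
  by (auto simp: has_field_derivative_def differentiable_def)

lemma partial_deriv_plane_wave:
  fixes x :: "real^'n::finite"
  assumes "\<And>s. (g has_real_derivative g' s) (at s)"
  shows "partial_deriv k (\<lambda>x. g (coordinate_sum x)) x = g' (coordinate_sum x)"
proof -
  have "((\<lambda>h. g (coordinate_sum x + h)) has_real_derivative g' (coordinate_sum x)) (at 0)"
    using DERIV_shift[of g "g' (coordinate_sum x)" 0 "coordinate_sum x"] assms by (simp add: add.commute)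
  thus ?thesis
    by (auto simp: partial_deriv_def coordinate_sum_add coordinate_sum_scaleR intro!: DERIV_imp_deriv)
qed

text \<open>The space of functions against which the momentum of a \<open>C\<^sup>1\<close> field can be tested.\<close>

definition compact_C1 :: "(real^'n::finite \<Rightarrow> real) \<Rightarrow> bool" where
  "compact_C1 \<psi> \<longleftrightarrow> times_cont_diff 1 \<psi> \<and> compact (closure {x. \<psi> x \<noteq> 0})"

lemma compact_C1_differentiable: "compact_C1 \<psi> \<Longrightarrow> \<psi> differentiable (at x)"
  by (simp add: compact_C1_def)

lemma compact_C1_continuous: "compact_C1 \<psi> \<Longrightarrow> continuous_on S \<psi>"
  by (meson compact_C1_differentiable continuous_at_imp_continuous_on differentiable_imp_continuous_within)

lemma compact_C1_continuous_partial: "compact_C1 \<psi> \<Longrightarrow> continuous_on S (partial_deriv k \<psi>)"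
  by (auto simp: compact_C1_def intro: continuous_on_subset)

lemma notin_closure_support: "x \<notin> closure {x. f x \<noteq> 0} \<Longrightarrow> f x = 0"
  using closure_subset[of "{x. f x \<noteq> 0}"] by auto

lemma partial_deriv_support:
  fixes \<psi> :: "real^'n::finite \<Rightarrow> real"
  shows "partial_deriv k \<psi> x \<noteq> 0 \<Longrightarrow> x \<in> closure {x. \<psi> x \<noteq> 0}"
proof (rule ccontr)
  assume nz: "partial_deriv k \<psi> x \<noteq> 0" and x: "x \<notin> closure {x. \<psi> x \<noteq> 0}"
  let ?l = "\<lambda>h::real. x + h *\<^sub>R axis k 1"
  have "open (?l -` (- closure {x. \<psi> x \<noteq> 0}))"
    by (intro open_vimage continuous_intros) auto
  hence "\<forall>\<^sub>F h in nhds 0. h \<in> ?l -` (- closure {x. \<psi> x \<noteq> 0})"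
    using x by (intro eventually_nhds_in_open) auto
  hence "\<forall>\<^sub>F h in nhds 0. \<psi> (?l h) = 0"
    by eventually_elim (rule notin_closure_support, simp)
  hence "deriv (\<lambda>h. \<psi> (?l h)) 0 = deriv (\<lambda>h. 0) 0" by (rule deriv_cong_ev) simp
  thus False using nz by (simp add: partial_deriv_def)
qed

lemma test_function_imp_compact_C1:
  assumes "test_function \<phi>"
  shows "compact_C1 \<phi>" and "compact_C1 (partial_deriv k \<phi>)"
proof -
  have t1: "times_cont_diff (Suc 0) \<phi>" and t2: "times_cont_diff (Suc (Suc 0)) \<phi>"
    and cp: "compact (closure {x. \<phi> x \<noteq> 0})"
    using assms by (auto simp only: test_function_def)
  show "compact_C1 \<phi>" using t1 cp by (simp add: compact_C1_def)
  have "compact (closure {x. partial_deriv k \<phi> x \<noteq> 0})"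
    using compact_imp_bounded[OF cp] unfolding compact_closure
    by (rule bounded_subset) (use partial_deriv_support[of k \<phi>] in auto)
  thus "compact_C1 (partial_deriv k \<phi>)" using t2 by (simp add: compact_C1_def)
qed

lemma integrable_compact_support:
  fixes f :: "real^'n::finite \<Rightarrow> real"
  assumes "continuous_on UNIV f" "compact C" "\<And>x. x \<notin> C \<Longrightarrow> f x = 0"
  shows "integrable lborel f"
proof -
  have "integrable lborel (\<lambda>x. indicator C x *\<^sub>R f x)"
    using assms by (intro borel_integrable_compact) (auto intro: continuous_on_subset)
  moreover have "(\<lambda>x. indicator C x *\<^sub>R f x) = f" using assms by (auto simp: fun_eq_iff indicator_def)
  ultimately show ?thesis by simp
qed

lemma compact_C1_integrable:
  fixes \<psi> :: "real^'n::finite \<Rightarrow> real"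
  assumes \<psi>: "compact_C1 \<psi>" and G: "continuous_on UNIV G"
  shows "integrable lborel (\<lambda>x. G x * \<psi> x)" and "integrable lborel (\<lambda>x. G x * partial_deriv k \<psi> x)"
proof -
  have C: "compact (closure {x. \<psi> x \<noteq> 0})" using \<psi> by (simp add: compact_C1_def)
  show "integrable lborel (\<lambda>x. G x * \<psi> x)"
    by (rule integrable_compact_support[OF _ C])
       (auto dest: notin_closure_support intro!: continuous_on_mult G compact_C1_continuous[OF \<psi>])
  show "integrable lborel (\<lambda>x. G x * partial_deriv k \<psi> x)"
    by (rule integrable_compact_support[OF _ C])
       (auto dest: partial_deriv_support intro!: continuous_on_mult G compact_C1_continuous_partial[OF \<psi>])
qed

lemma lborel_integral_translation:
  fixes f :: "'a::euclidean_space \<Rightarrow> real"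
  assumes [measurable]: "f \<in> borel_measurable borel"
  shows "(\<integral>x. f (x + a) \<partial>lborel) = (\<integral>x. f x \<partial>lborel)"
proof -
  have "(\<integral>x. f x \<partial>lborel) = (\<integral>x. f x \<partial>distr lborel borel ((+) a))" by (simp add: lborel_distr_plus)
  also have "\<dots> = (\<integral>x. f (a + x) \<partial>lborel)" by (rule integral_distr) auto
  finally show ?thesis by (simp add: add.commute)
qed

text \<open>By translation invariance of Lebesgue measure, \<open>\<integral> G(x) \<psi>(x + h b) dx\<close> does not depend on \<open>h\<close> if \<open>G\<close> is constant in
  the direction \<open>b\<close>; its derivative at \<open>h = 0\<close> is the integral in question. Besides \<open>G = 1\<close>, the case of a plane wave \<open>G\<close> and
  a difference \<open>b\<close> of two coordinate vectors will be used.\<close>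

lemma integral_invariant_directional_derivative:
  fixes \<psi> G :: "real^'n::finite \<Rightarrow> real"
  assumes \<psi>: "compact_C1 \<psi>" and G: "continuous_on UNIV G" and inv: "\<And>x h. G (x + h *\<^sub>R b) = G x"
    and D: "\<And>x. frechet_derivative \<psi> (at x) b = D x" and Dc: "continuous_on UNIV D"
    and Ds: "\<And>x. D x \<noteq> 0 \<Longrightarrow> x \<in> closure {x. \<psi> x \<noteq> 0}"
  shows "(\<integral>x. G x * D x \<partial>lborel) = 0"
proof -
  define C where "C = closure {x. \<psi> x \<noteq> 0}"
  have C: "compact C" using \<psi> by (simp add: C_def compact_C1_def)
  have \<psi>C: "\<psi> x = 0" if "x \<notin> C" for x using that unfolding C_def by (rule notin_closure_support)
  obtain B where B: "\<And>x. \<bar>D x\<bar> \<le> B"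
  proof -
    have "compact (D ` C)" by (intro compact_continuous_image C continuous_on_subset[OF Dc]) auto
    then obtain B where "\<forall>y\<in>D ` C. norm y \<le> B" using compact_imp_bounded bounded_iff by metis
    hence "\<bar>D x\<bar> \<le> max B 0" for x using Ds[of x] by (cases "x \<in> C") (auto simp: C_def le_max_iff_disj)
    thus ?thesis by (rule that)
  qed
  have B0: "0 \<le> B" using order_trans[OF abs_ge_zero B] .
  obtain R where R: "\<And>x. x \<in> C \<Longrightarrow> norm x \<le> R"
    using compact_imp_bounded[OF C] by (auto simp: bounded_iff)
  \<comment> \<open>All translates of the support by \<open>h b\<close> with \<open>|h| \<le> 1\<close> lie in this ball.\<close>
  define K where "K = cball (0 :: real^'n) (R + norm b)"
  define h where "h n = inverse (real (Suc n))" for n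
  have h0: "h n > 0" and h1: "h n \<le> 1" for n by (auto simp: h_def field_simps)
  have hlim: "h \<longlonglongrightarrow> 0" unfolding h_def by (rule LIMSEQ_inverse_real_of_nat)
  have c: "continuous_on UNIV (\<lambda>x. G x * \<psi> x)" by (intro continuous_on_mult G compact_C1_continuous[OF \<psi>])
  have m: "(\<lambda>x. G x * \<psi> x) \<in> borel_measurable borel"
    using c by (rule borel_measurable_continuous_onI)
  have mq: "(\<lambda>x. G x * ((\<psi> (x + h n *\<^sub>R b) - \<psi> x) / h n)) \<in> borel_measurable lborel" for n
  proof -
    have [measurable]: "G \<in> borel_measurable borel" "\<psi> \<in> borel_measurable borel"
      by (intro borel_measurable_continuous_onI G compact_C1_continuous \<psi>)+
    show ?thesis by measurable
  qed
  have int: "integrable lborel (\<lambda>x. G x * \<psi> x)" by (rule compact_C1_integrable[OF \<psi> G])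
  have intt: "integrable lborel (\<lambda>x. G x * \<psi> (x + a *\<^sub>R b))" 
    and eqt: "(\<integral>x. G x * \<psi> (x + a *\<^sub>R b) \<partial>lborel) = (\<integral>x. G x * \<psi> x \<partial>lborel)" for a
  proof -
    have e: "G x * \<psi> (x + a *\<^sub>R b) = G (x + a *\<^sub>R b) * \<psi> (x + a *\<^sub>R b)" for x by (simp add: inv)
    show "(\<integral>x. G x * \<psi> (x + a *\<^sub>R b) \<partial>lborel) = (\<integral>x. G x * \<psi> x \<partial>lborel)"
      unfolding e using lborel_integral_translation[OF m] by simp
    show "integrable lborel (\<lambda>x. G x * \<psi> (x + a *\<^sub>R b))"
    proof (rule integrable_compact_support)
      show "compact ((\<lambda>y. y - a *\<^sub>R b) ` C)"
        by (intro compact_continuous_image C continuous_intros)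
      show "G x * \<psi> (x + a *\<^sub>R b) = 0" if "x \<notin> (\<lambda>y. y - a *\<^sub>R b) ` C" for x
      proof -
        have "x + a *\<^sub>R b \<notin> C" using that by (auto simp: image_iff)
        thus ?thesis by (simp add: \<psi>C)
      qed
      show "continuous_on UNIV (\<lambda>x. G x * \<psi> (x + a *\<^sub>R b))"
        by (intro continuous_intros G continuous_on_compose2[OF compact_C1_continuous[OF \<psi>, of UNIV]]) auto
    qed
  qed
  have zero: "(\<integral>x. G x * ((\<psi> (x + h n *\<^sub>R b) - \<psi> x) / h n) \<partial>lborel) = 0" for n
  proof -
    have "G x * ((\<psi> (x + h n *\<^sub>R b) - \<psi> x) / h n) = (G x * \<psi> (x + h n *\<^sub>R b) - G x * \<psi> x) / h n" for x
      by (simp add: right_diff_distrib diff_divide_distrib)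
    hence "(\<integral>x. G x * ((\<psi> (x + h n *\<^sub>R b) - \<psi> x) / h n) \<partial>lborel)
        = ((\<integral>x. G x * \<psi> (x + h n *\<^sub>R b) \<partial>lborel) - (\<integral>x. G x * \<psi> x \<partial>lborel)) / h n"
      by (simp only: integral_divide_zero Bochner_Integration.integral_diff[OF intt int])
    thus ?thesis by (simp add: eqt)
  qed
  have der: "((\<lambda>s. \<psi> (x + s *\<^sub>R b)) has_real_derivative D (x + s *\<^sub>R b)) (at s)" for x s
    unfolding D[symmetric] by (rule directional_derivative[OF compact_C1_differentiable[OF \<psi>]])
  obtain M where M: "\<And>x. x \<in> K \<Longrightarrow> \<bar>G x\<bar> \<le> M"
  proof -
    have "compact (G ` K)" unfolding K_def by (intro compact_continuous_image continuous_on_subset[OF G]) auto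
    then obtain M where "\<forall>y\<in>G ` K. norm y \<le> M" using compact_imp_bounded bounded_iff by metis
    thus ?thesis using that by auto
  qed
  have "(\<lambda>n. \<integral>x. G x * ((\<psi> (x + h n *\<^sub>R b) - \<psi> x) / h n) \<partial>lborel) \<longlonglongrightarrow> (\<integral>x. G x * D x \<partial>lborel)"
  proof (rule integral_dominated_convergence[where w="\<lambda>x. indicator K x *\<^sub>R (M * B)"])
    show "integrable lborel (\<lambda>x. indicator K x *\<^sub>R (M * B))"
      unfolding K_def by (intro borel_integrable_compact) auto
    show "(\<lambda>x. G x * D x) \<in> borel_measurable lborel"
      using borel_measurable_continuous_onI[OF continuous_on_mult[OF G Dc]] by simp
    show "AE x in lborel. (\<lambda>n. G x * ((\<psi> (x + h n *\<^sub>R b) - \<psi> x) / h n)) \<longlonglongrightarrow> G x * D x"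
    proof (intro AE_I2 tendsto_mult_left)
      fix x
      have "((\<lambda>s. (\<psi> (x + s *\<^sub>R b) - \<psi> x) / s) \<longlongrightarrow> D x) (at 0)"
        using der[of x 0] by (simp add: DERIV_def)
      hence "((\<lambda>s. (\<psi> (x + s *\<^sub>R b) - \<psi> x) / s) \<circ> h) \<longlonglongrightarrow> D x"
        using hlim h0 by (subst (asm) tendsto_at_iff_sequentially) (auto simp: less_imp_neq[symmetric])
      thus "(\<lambda>n. (\<psi> (x + h n *\<^sub>R b) - \<psi> x) / h n) \<longlonglongrightarrow> D x" by (simp add: comp_def)
    qed
    show "AE x in lborel. norm (G x * ((\<psi> (x + h n *\<^sub>R b) - \<psi> x) / h n)) \<le> indicator K x *\<^sub>R (M * B)" for n
    proof (rule AE_I2)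
      fix x
      show "norm (G x * ((\<psi> (x + h n *\<^sub>R b) - \<psi> x) / h n)) \<le> indicator K x *\<^sub>R (M * B)"
      proof (cases "x \<in> K")
        case True
        have "\<bar>\<psi> (x + h n *\<^sub>R b) - \<psi> (x + 0 *\<^sub>R b)\<bar> \<le> B * \<bar>h n - 0\<bar>"
          using lipschitz_of_bounded_deriv[OF der, of x B "h n" 0] B by blast
        hence "\<bar>(\<psi> (x + h n *\<^sub>R b) - \<psi> x) / h n\<bar> \<le> B"
          using h0[of n] by (simp add: abs_div pos_divide_le_eq)
        hence "\<bar>G x\<bar> * \<bar>(\<psi> (x + h n *\<^sub>R b) - \<psi> x) / h n\<bar> \<le> M * B"
          using M[OF True] by (intro mult_mono) auto
        thus ?thesis using True by (simp add: abs_mult)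
      next
        case False
        have hb: "norm (h n *\<^sub>R b) \<le> norm b" using h0[of n] h1[of n] by (simp add: mult_left_le_one_le)
        have "x \<notin> C" using False R[of x] norm_ge_zero[of b] by (force simp: K_def)
        moreover have "x + h n *\<^sub>R b \<notin> C"
        proof
          assume "x + h n *\<^sub>R b \<in> C"
          hence "norm (x + h n *\<^sub>R b) \<le> R" by (rule R)
          hence "norm x \<le> R + norm b" using hb norm_triangle_ineq4[of "x + h n *\<^sub>R b" "h n *\<^sub>R b"] by simp
          thus False using False by (simp add: K_def)
        qed
        ultimately show ?thesis using False by (simp add: \<psi>C)
      qed
    qed
  qed (rule mq)
  hence "(\<lambda>n. 0::real) \<longlonglongrightarrow> (\<integral>x. G x * D x \<partial>lborel)" unfolding zero .
  thus ?thesis using LIMSEQ_unique tendsto_const by blast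
qed

lemma integral_partial_deriv:
  fixes \<psi> :: "real^'n::finite \<Rightarrow> real"
  assumes "compact_C1 \<psi>"
  shows "(\<integral>x. partial_deriv k \<psi> x \<partial>lborel) = 0"
  using integral_invariant_directional_derivative[OF assms, of "\<lambda>x. 1" "axis k 1" "partial_deriv k \<psi>"]
    partial_deriv_eq_frechet[OF compact_C1_differentiable[OF assms]]
    compact_C1_continuous_partial[OF assms] partial_deriv_support[of k \<psi>] by simp

text \<open>A plane wave is constant in the direction \<open>e\<^sub>i - e\<^sub>j\<close>.\<close>

lemma integral_plane_wave_partial_deriv_cong:
  fixes \<psi> :: "real^'n::finite \<Rightarrow> real"
  assumes \<psi>: "compact_C1 \<psi>" and g: "continuous_on UNIV g"
  shows "(\<integral>x. g (coordinate_sum x) * partial_deriv i \<psi> x \<partial>lborel)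
       = (\<integral>x. g (coordinate_sum x) * partial_deriv j \<psi> x \<partial>lborel)"
proof -
  have G: "continuous_on UNIV (\<lambda>x::real^'n. g (coordinate_sum x))" by (rule continuous_on_coordinate_sum[OF g])
  have "(\<integral>x. g (coordinate_sum x) * (partial_deriv i \<psi> x - partial_deriv j \<psi> x) \<partial>lborel) = 0"
  proof (rule integral_invariant_directional_derivative[OF \<psi> G])
    show "g (coordinate_sum (x + h *\<^sub>R (axis i 1 - axis j 1))) = g (coordinate_sum x)" for x h
    proof -
      have "coordinate_sum (axis i 1 - axis j 1 :: real^'n) = 0"
        using coordinate_sum_add[of "axis i 1 - axis j 1" "axis j 1 :: real^'n"] by simp
      thus ?thesis by (simp only: coordinate_sum_add coordinate_sum_scaleR) simp
    qed
    show "frechet_derivative \<psi> (at x) (axis i 1 - axis j 1) = partial_deriv i \<psi> x - partial_deriv j \<psi> x" for x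
      using linear_frechet_derivative[OF compact_C1_differentiable[OF \<psi>], of x]
      by (simp add: partial_deriv_eq_frechet[OF compact_C1_differentiable[OF \<psi>]] linear_diff)
    show "continuous_on UNIV (\<lambda>x. partial_deriv i \<psi> x - partial_deriv j \<psi> x)"
      by (intro continuous_intros compact_C1_continuous_partial \<psi>)
    show "x \<in> closure {x. \<psi> x \<noteq> 0}" if "partial_deriv i \<psi> x - partial_deriv j \<psi> x \<noteq> 0" for x
      using that partial_deriv_support[of i \<psi> x] partial_deriv_support[of j \<psi> x] by fastforce
  qed
  thus ?thesis using compact_C1_integrable(2)[OF \<psi> G] by (simp add: right_diff_distrib)
qed

lemma compact_C1_plane_wave_mult:
  fixes \<psi> :: "real^'n::finite \<Rightarrow> real"
  assumes \<psi>: "compact_C1 \<psi>" and g: "\<And>s. (g has_real_derivative g' s) (at s)" "continuous_on UNIV g'"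
  shows "compact_C1 (\<lambda>x. g (coordinate_sum x) * \<psi> x)"
    and "partial_deriv k (\<lambda>x. g (coordinate_sum x) * \<psi> x) x
      = g' (coordinate_sum x) * \<psi> x + g (coordinate_sum x) * partial_deriv k \<psi> x"
proof -
  note dg = plane_wave_differentiable[OF g(1)] and d\<psi> = compact_C1_differentiable[OF \<psi>]
  show eq: "partial_deriv k (\<lambda>x. g (coordinate_sum x) * \<psi> x) x
      = g' (coordinate_sum x) * \<psi> x + g (coordinate_sum x) * partial_deriv k \<psi> x" for k x
    by (subst partial_deriv_mult[OF dg d\<psi>]) (simp add: partial_deriv_plane_wave[OF g(1)])
  have gc: "continuous_on UNIV g" using g(1) by (meson DERIV_isCont continuous_at_imp_continuous_on)
  have "compact (closure {x. g (coordinate_sum x) * \<psi> x \<noteq> 0})"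
    using \<psi> unfolding compact_C1_def compact_closure by (auto elim: bounded_subset)
  moreover have "continuous_on UNIV (partial_deriv k (\<lambda>x. g (coordinate_sum x) * \<psi> x))" for k
    unfolding eq[abs_def]
    by (intro continuous_intros continuous_on_coordinate_sum gc g compact_C1_continuous
        compact_C1_continuous_partial \<psi>)
  ultimately show "compact_C1 (\<lambda>x. g (coordinate_sum x) * \<psi> x)"
    using differentiable_mult[OF dg d\<psi>] by (simp add: compact_C1_def)
qed

lemma plane_wave_integral_by_parts:
  fixes \<psi> :: "real^'n::finite \<Rightarrow> real"
  assumes \<psi>: "compact_C1 \<psi>" and g: "\<And>s. (g has_real_derivative g' s) (at s)" "continuous_on UNIV g'"
  shows "(\<integral>x. g' (coordinate_sum x) * \<psi> x \<partial>lborel) = - (\<integral>x. g (coordinate_sum x) * partial_deriv k \<psi> x \<partial>lborel)"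
proof -
  have gc: "continuous_on UNIV g" using g(1) by (meson DERIV_isCont continuous_at_imp_continuous_on)
  have "(\<integral>x. g' (coordinate_sum x) * \<psi> x + g (coordinate_sum x) * partial_deriv k \<psi> x \<partial>lborel) = 0"
    using integral_partial_deriv[OF compact_C1_plane_wave_mult(1)[OF \<psi> g], of k]
    by (simp add: compact_C1_plane_wave_mult(2)[OF \<psi> g])
  thus ?thesis
    using compact_C1_integrable[OF \<psi> continuous_on_coordinate_sum[OF g(2)]]
      compact_C1_integrable[OF \<psi> continuous_on_coordinate_sum[OF gc]] by simp
qed

section \<open>The Euler--Poincare equations for diagonal fields\<close>

lemma momentum_diagonal_field:
  fixes \<psi> :: "real^'n::finite \<Rightarrow> real"
  assumes "\<And>s. (V has_real_derivative V' s) (at s)"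
  shows "momentum (diagonal_field V) i \<psi> = (\<integral>x. V (coordinate_sum x) * \<psi> x
      + (\<Sum>k\<in>UNIV. V' (coordinate_sum x) * partial_deriv k \<psi> x) \<partial>lborel)"
proof -
  have e: "diagonal_field V x $ j = V (coordinate_sum x)" for x :: "real^'n" and j
    by (simp add: diagonal_field_def coordinate_sum_def)
  show ?thesis unfolding momentum_def e partial_deriv_plane_wave[OF assms] ..
qed

definition laplacian :: "(real^'n::finite \<Rightarrow> real) \<Rightarrow> real^'n \<Rightarrow> real" where
  "laplacian \<phi> x = (\<Sum>k\<in>UNIV. partial_deriv k (partial_deriv k \<phi>) x)"

lemma integral_plane_wave_laplacian:
  fixes \<phi> :: "real^'n::finite \<Rightarrow> real"
  assumes \<phi>: "test_function \<phi>" and g: "continuous_on UNIV g"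
  shows "integrable lborel (\<lambda>x. g (coordinate_sum x) * laplacian \<phi> x)"
    and "(\<integral>x. g (coordinate_sum x) * laplacian \<phi> x \<partial>lborel)
      = (\<Sum>k\<in>UNIV. \<integral>x. g (coordinate_sum x) * partial_deriv k (partial_deriv k \<phi>) x \<partial>lborel)"
  using compact_C1_integrable(2)[OF test_function_imp_compact_C1(2)[OF \<phi>] continuous_on_coordinate_sum[OF g]]
  by (auto simp: laplacian_def sum_distrib_left)

lemma integrable_helmholtz_test:
  fixes \<phi> :: "real^'n::finite \<Rightarrow> real"
  assumes \<phi>: "test_function \<phi>" and g: "continuous_on UNIV g"
  shows "integrable lborel (\<lambda>x. g (coordinate_sum x) * (\<phi> x - laplacian \<phi> x))"
    and "(\<integral>x. g (coordinate_sum x) * (\<phi> x - laplacian \<phi> x) \<partial>lborel)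
      = (\<integral>x. g (coordinate_sum x) * \<phi> x \<partial>lborel) - (\<integral>x. g (coordinate_sum x) * laplacian \<phi> x \<partial>lborel)"
  using compact_C1_integrable(1)[OF test_function_imp_compact_C1(1)[OF \<phi>] continuous_on_coordinate_sum[OF g]]
    integral_plane_wave_laplacian(1)[OF \<phi> g]
  by (auto simp: right_diff_distrib)

text \<open>Both derivatives are moved to the test function, so that the momentum depends on the values of \<open>V\<close> only. This makes
  it differentiable in time although the time derivative of the slope need not be a function.\<close>

lemma momentum_test_function:
  fixes \<phi> :: "real^'n::finite \<Rightarrow> real"
  assumes \<phi>: "test_function \<phi>" and V: "\<And>s. (V has_real_derivative V' s) (at s)" "continuous_on UNIV V'"
  shows "momentum (diagonal_field V) i \<phi> = (\<integral>x. V (coordinate_sum x) * (\<phi> x - laplacian \<phi> x) \<partial>lborel)"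
proof -
  have Vc: "continuous_on UNIV V" using V(1) by (meson DERIV_isCont continuous_at_imp_continuous_on)
  note C = test_function_imp_compact_C1[OF \<phi>]
  have "momentum (diagonal_field V) i \<phi> = (\<integral>x. V (coordinate_sum x) * \<phi> x \<partial>lborel)
      + (\<Sum>k\<in>UNIV. \<integral>x. V' (coordinate_sum x) * partial_deriv k \<phi> x \<partial>lborel)"
    unfolding momentum_diagonal_field[OF V(1)]
    using compact_C1_integrable[OF C(1) continuous_on_coordinate_sum[OF Vc]]
      compact_C1_integrable[OF C(1) continuous_on_coordinate_sum[OF V(2)]]
    by (subst Bochner_Integration.integral_add) auto
  also have "(\<Sum>k\<in>UNIV. \<integral>x. V' (coordinate_sum x) * partial_deriv k \<phi> x \<partial>lborel)
      = - (\<Sum>k\<in>UNIV. \<integral>x. V (coordinate_sum x) * partial_deriv k (partial_deriv k \<phi>) x \<partial>lborel)"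
    unfolding sum_negf[symmetric] by (intro sum.cong refl plane_wave_integral_by_parts C V)
  finally show ?thesis
    by (simp add: integrable_helmholtz_test[OF \<phi> Vc] integral_plane_wave_laplacian[OF \<phi> Vc])
qed

text \<open>Derivatives \<open>\<partial>\<^sub>j\<phi>\<close> are exchanged for \<open>\<partial>\<^sub>i\<phi>\<close>, and mixed second derivatives \<open>\<partial>\<^sub>k\<partial>\<^sub>j\<phi>\<close> for
  \<open>\<partial>\<^sub>j\<partial>\<^sub>j\<phi>\<close>, by \<open>integral_plane_wave_partial_deriv_cong\<close>; each sum over an index then contributes a factor \<open>d\<close>.\<close>

lemma transport_term_diagonal_field:
  fixes \<phi> :: "real^'n::finite \<Rightarrow> real"
  assumes \<phi>: "test_function \<phi>" and V: "\<And>s. (V has_real_derivative V' s) (at s)" "continuous_on UNIV V'"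
  shows "transport_term (diagonal_field V) i \<phi> =
     - (real CARD('n) * (\<integral>x. (V (coordinate_sum x))\<^sup>2 * partial_deriv i \<phi> x \<partial>lborel)
      + (real CARD('n))\<^sup>2 * (\<integral>x. (V' (coordinate_sum x))\<^sup>2 * partial_deriv i \<phi> x \<partial>lborel)
      + real CARD('n) * (\<integral>x. V (coordinate_sum x) * V' (coordinate_sum x) * laplacian \<phi> x \<partial>lborel))"
proof -
  note C = test_function_imp_compact_C1[OF \<phi>]
  have Vc: "continuous_on UNIV V" using V(1) by (meson DERIV_isCont continuous_at_imp_continuous_on)
  have c1: "continuous_on UNIV (\<lambda>s. (V s)\<^sup>2)" and c2: "continuous_on UNIV (\<lambda>s. (V' s)\<^sup>2)"
    and c3: "continuous_on UNIV (\<lambda>s. V s * V' s)"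
    by (intro continuous_intros Vc V)+
  have e: "diagonal_field V x $ j = V (coordinate_sum x)" for x :: "real^'n" and j
    by (simp add: diagonal_field_def coordinate_sum_def)
  have "momentum (diagonal_field V) i (\<lambda>x. V (coordinate_sum x) * partial_deriv j \<phi> x)
      = (\<integral>x. (V (coordinate_sum x))\<^sup>2 * partial_deriv i \<phi> x \<partial>lborel)
      + real CARD('n) * (\<integral>x. (V' (coordinate_sum x))\<^sup>2 * partial_deriv i \<phi> x \<partial>lborel)
      + real CARD('n) * (\<integral>x. V (coordinate_sum x) * V' (coordinate_sum x) * partial_deriv j (partial_deriv j \<phi>) x \<partial>lborel)"
    (is "?m = _") for j
  proof -
    have "?m = (\<integral>x. (V (coordinate_sum x))\<^sup>2 * partial_deriv j \<phi> x
        + ((\<Sum>k\<in>(UNIV::'n set). (V' (coordinate_sum x))\<^sup>2 * partial_deriv j \<phi> x)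
        + (\<Sum>k\<in>UNIV. V (coordinate_sum x) * V' (coordinate_sum x) * partial_deriv k (partial_deriv j \<phi>) x)) \<partial>lborel)"
      unfolding momentum_diagonal_field[OF V(1)] compact_C1_plane_wave_mult(2)[OF C(2) V] sum.distrib[symmetric]
      by (simp add: power2_eq_square algebra_simps)
    also have "\<dots> = (\<integral>x. (V (coordinate_sum x))\<^sup>2 * partial_deriv j \<phi> x \<partial>lborel)
        + ((\<Sum>k\<in>(UNIV::'n set). \<integral>x. (V' (coordinate_sum x))\<^sup>2 * partial_deriv j \<phi> x \<partial>lborel)
        + (\<Sum>k\<in>UNIV. \<integral>x. V (coordinate_sum x) * V' (coordinate_sum x) * partial_deriv k (partial_deriv j \<phi>) x \<partial>lborel))"
      using compact_C1_integrable(2)[OF C(1) continuous_on_coordinate_sum[OF c1]]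
        compact_C1_integrable(2)[OF C(1) continuous_on_coordinate_sum[OF c2]]
        compact_C1_integrable(2)[OF C(2) continuous_on_coordinate_sum[OF c3]]
      by (simp del: sum_constant)
    also have "(\<Sum>k\<in>UNIV. \<integral>x. V (coordinate_sum x) * V' (coordinate_sum x) * partial_deriv k (partial_deriv j \<phi>) x \<partial>lborel)
       = (\<Sum>k\<in>(UNIV::'n set). \<integral>x. V (coordinate_sum x) * V' (coordinate_sum x) * partial_deriv j (partial_deriv j \<phi>) x \<partial>lborel)"
      by (intro sum.cong refl integral_plane_wave_partial_deriv_cong[OF C(2) c3])
    also have "(\<integral>x. (V (coordinate_sum x))\<^sup>2 * partial_deriv j \<phi> x \<partial>lborel) = (\<integral>x. (V (coordinate_sum x))\<^sup>2 * partial_deriv i \<phi> x \<partial>lborel)"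
      by (rule integral_plane_wave_partial_deriv_cong[OF C(1) c1])
    also have "(\<integral>x. (V' (coordinate_sum x))\<^sup>2 * partial_deriv j \<phi> x \<partial>lborel) = (\<integral>x. (V' (coordinate_sum x))\<^sup>2 * partial_deriv i \<phi> x \<partial>lborel)"
      by (rule integral_plane_wave_partial_deriv_cong[OF C(1) c2])
    finally show ?thesis by simp
  qed
  hence "(\<Sum>j\<in>UNIV. momentum (diagonal_field V) i (\<lambda>x. V (coordinate_sum x) * partial_deriv j \<phi> x))
      = real CARD('n) * (\<integral>x. (V (coordinate_sum x))\<^sup>2 * partial_deriv i \<phi> x \<partial>lborel)
      + real CARD('n) * (real CARD('n) * (\<integral>x. (V' (coordinate_sum x))\<^sup>2 * partial_deriv i \<phi> x \<partial>lborel))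
      + real CARD('n) * (\<integral>x. V (coordinate_sum x) * V' (coordinate_sum x) * laplacian \<phi> x \<partial>lborel)"
    by (simp add: sum.distrib sum_distrib_left[symmetric] integral_plane_wave_laplacian(2)[OF \<phi> c3] distrib_left)
  thus ?thesis by (simp add: transport_term_def e power2_eq_square[of "real CARD('n)"] mult.assoc)
qed

lemma stretching_term_diagonal_field:
  fixes \<phi> :: "real^'n::finite \<Rightarrow> real"
  assumes \<phi>: "test_function \<phi>" and V: "\<And>s. (V has_real_derivative V' s) (at s)" "continuous_on UNIV V'"
  shows "stretching_term (diagonal_field V) i \<phi> =
      real CARD('n) * (\<integral>x. V (coordinate_sum x) * V' (coordinate_sum x) * \<phi> x \<partial>lborel)
      + (real CARD('n))\<^sup>2 / 2 * (\<integral>x. (V' (coordinate_sum x))\<^sup>2 * partial_deriv i \<phi> x \<partial>lborel)"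
proof -
  let ?n = "real CARD('n)"
  note C = test_function_imp_compact_C1[OF \<phi>]
  have Vc: "continuous_on UNIV V" using V(1) by (meson DERIV_isCont continuous_at_imp_continuous_on)
  have c2: "continuous_on UNIV (\<lambda>s. (V' s)\<^sup>2)" and c3: "continuous_on UNIV (\<lambda>s. V s * V' s)"
    by (intro continuous_intros Vc V)+
  have e: "diagonal_field V x $ j = V (coordinate_sum x)" for x :: "real^'n" and j
    by (simp add: diagonal_field_def coordinate_sum_def)
  have "stretching_term (diagonal_field V) i \<phi> =
      (\<integral>x. ?n * (V (coordinate_sum x) * V' (coordinate_sum x) * \<phi> x)
        + (\<Sum>k\<in>UNIV. ?n * ((V' (coordinate_sum x))\<^sup>2 * partial_deriv k \<phi> x))
        - ?n\<^sup>2 / 2 * ((V' (coordinate_sum x))\<^sup>2 * partial_deriv i \<phi> x) \<partial>lborel)"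
    unfolding stretching_term_def e partial_deriv_plane_wave[OF V(1)] Let_def
    by (simp add: sum_distrib_left[symmetric] power2_eq_square algebra_simps)
  also have "\<dots> = ?n * (\<integral>x. V (coordinate_sum x) * V' (coordinate_sum x) * \<phi> x \<partial>lborel)
        + (\<Sum>k\<in>UNIV. ?n * (\<integral>x. (V' (coordinate_sum x))\<^sup>2 * partial_deriv k \<phi> x \<partial>lborel))
        - ?n\<^sup>2 / 2 * (\<integral>x. (V' (coordinate_sum x))\<^sup>2 * partial_deriv i \<phi> x \<partial>lborel)"
    using compact_C1_integrable(1)[OF C(1) continuous_on_coordinate_sum[OF c3]]
      compact_C1_integrable(2)[OF C(1) continuous_on_coordinate_sum[OF c2]]
    by (simp del: sum_constant)
  also have "(\<Sum>k\<in>UNIV. ?n * (\<integral>x. (V' (coordinate_sum x))\<^sup>2 * partial_deriv k \<phi> x \<partial>lborel))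
      = (\<Sum>k\<in>(UNIV::'n set). ?n * (\<integral>x. (V' (coordinate_sum x))\<^sup>2 * partial_deriv i \<phi> x \<partial>lborel))"
    by (intro sum.cong refl arg_cong[of _ _ "(*) ?n"] integral_plane_wave_partial_deriv_cong[OF C(1) c2])
  finally show ?thesis by (simp add: power2_eq_square)
qed

context rod_solution
begin

text \<open>The sum over the \<open>d\<close> coordinate directions turns the Laplacian of a plane wave into \<open>d\<close> times the second derivative of its profile,
  so that \<open>1 - \<Delta>\<close> acts on the pressure as \<open>1 - d \<partial>\<^sub>x\<^sup>2\<close> and returns the source.\<close>

lemma pressure_slope_helmholtz:
  fixes \<phi> :: "real^'n::finite \<Rightarrow> real"
  assumes \<phi>: "test_function \<phi>" and t: "t \<in> J" and dn: "d = real CARD('n)"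
  shows "(\<integral>x. pressure_slope t (coordinate_sum x) * (\<phi> x - laplacian \<phi> x) \<partial>lborel)
      = - (\<integral>x. source t (coordinate_sum x) * partial_deriv i \<phi> x \<partial>lborel)"
proof -
  note C = test_function_imp_compact_C1[OF \<phi>]
  define w where "w s = (pressure t s - source t s) / d" for s
  note cs = pressure_slope_continuous[OF t] and cp = pressure_continuous[OF t]
  have cw: "continuous_on UNIV w" unfolding w_def using d
    by (intro continuous_intros cp source_continuous[OF t]) auto
  have "(\<integral>x. pressure_slope t (coordinate_sum x) * laplacian \<phi> x \<partial>lborel)
      = (\<Sum>k\<in>UNIV. \<integral>x. pressure_slope t (coordinate_sum x) * partial_deriv k (partial_deriv k \<phi>) x \<partial>lborel)"
    by (rule integral_plane_wave_laplacian(2)[OF \<phi> cs])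
  also have "\<dots> = (\<Sum>k\<in>(UNIV::'n set). - (\<integral>x. w (coordinate_sum x) * partial_deriv i \<phi> x \<partial>lborel))"
  proof (intro sum.cong refl)
    fix k
    have "(\<integral>x. w (coordinate_sum x) * partial_deriv k \<phi> x \<partial>lborel)
        = - (\<integral>x. pressure_slope t (coordinate_sum x) * partial_deriv k (partial_deriv k \<phi>) x \<partial>lborel)"
      using cw by (intro plane_wave_integral_by_parts C) (auto simp: w_def pressure_slope_DERIV[OF t])
    moreover have "(\<integral>x. w (coordinate_sum x) * partial_deriv k \<phi> x \<partial>lborel)
        = (\<integral>x. w (coordinate_sum x) * partial_deriv i \<phi> x \<partial>lborel)"
      by (rule integral_plane_wave_partial_deriv_cong[OF C(1) cw])
    ultimately show "(\<integral>x. pressure_slope t (coordinate_sum x) * partial_deriv k (partial_deriv k \<phi>) x \<partial>lborel)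
        = - (\<integral>x. w (coordinate_sum x) * partial_deriv i \<phi> x \<partial>lborel)" by simp
  qed
  finally have lap: "(\<integral>x. pressure_slope t (coordinate_sum x) * laplacian \<phi> x \<partial>lborel)
      = - (\<integral>x. d * (w (coordinate_sum x) * partial_deriv i \<phi> x) \<partial>lborel)" by (simp add: dn)
  have "(\<integral>x. pressure_slope t (coordinate_sum x) * \<phi> x \<partial>lborel)
      = - (\<integral>x. pressure t (coordinate_sum x) * partial_deriv i \<phi> x \<partial>lborel)"
    by (intro plane_wave_integral_by_parts C pressure_DERIV t cs)
  hence "(\<integral>x. pressure_slope t (coordinate_sum x) * (\<phi> x - laplacian \<phi> x) \<partial>lborel)
      = (\<integral>x. d * (w (coordinate_sum x) * partial_deriv i \<phi> x) \<partial>lborel)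
        - (\<integral>x. pressure t (coordinate_sum x) * partial_deriv i \<phi> x \<partial>lborel)"
    unfolding integrable_helmholtz_test(2)[OF \<phi> cs] lap by simp
  also have "\<dots> = (\<integral>x. d * (w (coordinate_sum x) * partial_deriv i \<phi> x)
      - pressure t (coordinate_sum x) * partial_deriv i \<phi> x \<partial>lborel)"
    using compact_C1_integrable(2)[OF C(1) continuous_on_coordinate_sum[OF cw]]
      compact_C1_integrable(2)[OF C(1) continuous_on_coordinate_sum[OF cp]] by simp
  also have "\<dots> = (\<integral>x. - (source t (coordinate_sum x) * partial_deriv i \<phi> x) \<partial>lborel)"
  proof (intro Bochner_Integration.integral_cong refl)
    fix x :: "real^'n"
    have "d * w (coordinate_sum x) = pressure t (coordinate_sum x) - source t (coordinate_sum x)"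
      using d by (simp add: w_def)
    thus "d * (w (coordinate_sum x) * partial_deriv i \<phi> x) - pressure t (coordinate_sum x) * partial_deriv i \<phi> x
        = - (source t (coordinate_sum x) * partial_deriv i \<phi> x)"
      by (simp add: mult.assoc[symmetric] left_diff_distrib)
  qed
  finally show ?thesis by simp
qed

lemma momentum_time_derivative:
  fixes \<phi> :: "real^'n::finite \<Rightarrow> real"
  assumes \<phi>: "test_function \<phi>" and t: "t \<in> J"
  shows "((\<lambda>\<tau>. momentum (diagonal_field (v \<tau>)) i \<phi>) has_real_derivative
      (\<integral>x. (- d * v t (coordinate_sum x) * v' t (coordinate_sum x) - pressure_slope t (coordinate_sum x))
          * (\<phi> x - laplacian \<phi> x) \<partial>lborel)) (at t within J)"
proof -
  define \<eta> where "\<eta> x = \<phi> x - laplacian \<phi> x" for x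
  define A where "A s = - d * v t s * v' t s - pressure_slope t s" for s
  define N where "N = (\<integral>x. \<bar>\<eta> x\<bar> \<partial>lborel)"
  have Ac: "continuous_on UNIV A" unfolding A_def
    by (intro continuous_intros velocity_continuous slope_continuous pressure_slope_continuous t)
  have int: "integrable lborel (\<lambda>x. g (coordinate_sum x) * \<eta> x)" if "continuous_on UNIV g" for g
    unfolding \<eta>_def by (rule integrable_helmholtz_test[OF \<phi> that])
  have absint: "integrable lborel (\<lambda>x. \<bar>\<eta> x\<bar>)"
    using integrable_abs[OF int[of "\<lambda>x. 1"]] by simp
  have N0: "N \<ge> 0" unfolding N_def by simp
  have mom: "momentum (diagonal_field (v \<tau>)) i \<phi> = (\<integral>x. v \<tau> (coordinate_sum x) * \<eta> x \<partial>lborel)" if "\<tau> \<in> J" for \<tau>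
    unfolding \<eta>_def
    by (rule momentum_test_function[OF \<phi> space_deriv[OF that] slope_continuous[OF that]])
  have "((\<lambda>\<tau>. (momentum (diagonal_field (v \<tau>)) i \<phi> - momentum (diagonal_field (v t)) i \<phi>) / (\<tau> - t))
      \<longlongrightarrow> (\<integral>x. A (coordinate_sum x) * \<eta> x \<partial>lborel)) (at t within J)"
  proof (rule tendstoI)
    fix e :: real assume e: "e > 0"
    have "e / (N + 1) > 0" using e N0 by simp
    from uniform_limitD[OF evolution[OF t] this]
    have "\<forall>\<^sub>F \<tau> in at t within J. \<forall>s\<in>UNIV. dist ((v \<tau> s - v t s) / (\<tau> - t)) (A s) < e / (N + 1)"
      by (simp add: A_def)
    moreover have "\<forall>\<^sub>F \<tau> in at t within J. \<tau> \<in> J" by (auto simp: eventually_at_filter)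
    ultimately show "\<forall>\<^sub>F \<tau> in at t within J.
        dist ((momentum (diagonal_field (v \<tau>)) i \<phi> - momentum (diagonal_field (v t)) i \<phi>) / (\<tau> - t))
          (\<integral>x. A (coordinate_sum x) * \<eta> x \<partial>lborel) < e"
    proof eventually_elim
      case (elim \<tau>)
      note i1 = int[OF velocity_continuous[OF elim(2)]] and i2 = int[OF velocity_continuous[OF t]] and i3 = int[OF Ac]
      have "(momentum (diagonal_field (v \<tau>)) i \<phi> - momentum (diagonal_field (v t)) i \<phi>) / (\<tau> - t)
            - (\<integral>x. A (coordinate_sum x) * \<eta> x \<partial>lborel)
          = (\<integral>x. (v \<tau> (coordinate_sum x) * \<eta> x - v t (coordinate_sum x) * \<eta> x) / (\<tau> - t)
              - A (coordinate_sum x) * \<eta> x \<partial>lborel)"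
        unfolding mom[OF t] mom[OF elim(2)] using i1 i2 i3 by simp
      also have "\<dots> = (\<integral>x. ((v \<tau> (coordinate_sum x) - v t (coordinate_sum x)) / (\<tau> - t)
              - A (coordinate_sum x)) * \<eta> x \<partial>lborel)"
        by (simp add: left_diff_distrib diff_divide_distrib)
      finally have eq: "(momentum (diagonal_field (v \<tau>)) i \<phi> - momentum (diagonal_field (v t)) i \<phi>) / (\<tau> - t)
            - (\<integral>x. A (coordinate_sum x) * \<eta> x \<partial>lborel)
          = (\<integral>x. ((v \<tau> (coordinate_sum x) - v t (coordinate_sum x)) / (\<tau> - t)
              - A (coordinate_sum x)) * \<eta> x \<partial>lborel)" .
      have "norm (\<integral>x. ((v \<tau> (coordinate_sum x) - v t (coordinate_sum x)) / (\<tau> - t)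
              - A (coordinate_sum x)) * \<eta> x \<partial>lborel) \<le> (\<integral>x. e / (N + 1) * \<bar>\<eta> x\<bar> \<partial>lborel)"
      proof (rule Bochner_Integration.integral_norm_bound_integral)
        show "integrable lborel (\<lambda>x. ((v \<tau> (coordinate_sum x) - v t (coordinate_sum x)) / (\<tau> - t)
              - A (coordinate_sum x)) * \<eta> x)"
          unfolding left_diff_distrib diff_divide_distrib times_divide_eq_left[symmetric]
          using i1 i2 i3 by (simp add: left_diff_distrib diff_divide_distrib)
        show "integrable lborel (\<lambda>x. e / (N + 1) * \<bar>\<eta> x\<bar>)" using absint by simp
        show "norm (((v \<tau> (coordinate_sum x) - v t (coordinate_sum x)) / (\<tau> - t)
              - A (coordinate_sum x)) * \<eta> x) \<le> e / (N + 1) * \<bar>\<eta> x\<bar>" for x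
          unfolding real_norm_def abs_mult
          using elim(1) by (intro mult_right_mono) (auto simp: dist_real_def intro: less_imp_le)
      qed
      also have "\<dots> = e / (N + 1) * N" using absint by (simp add: N_def)
      also have "\<dots> < e" using e N0 by (simp add: field_simps)
      finally show ?case unfolding dist_norm eq .
    qed
  qed
  thus ?thesis by (simp add: has_field_derivative_iff A_def \<eta>_def)
qed

text \<open>The transport part \<open>- d v v\<^sub>x\<close> of the time derivative, tested against \<open>\<phi> - \<Delta>\<phi>\<close>, accounts for the terms with \<open>v v\<^sub>x\<close>, and
  \<open>- H\<^sub>x\<close> for the remaining ones, which combine to \<open>\<integral> F \<partial>\<^sub>i\<phi>\<close>.\<close>

lemma momentum_equation:
  fixes \<phi> :: "real^'n::finite \<Rightarrow> real"
  assumes \<phi>: "test_function \<phi>" and t: "t \<in> J" and dn: "d = real CARD('n)"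
  shows "((\<lambda>\<tau>. momentum (diagonal_field (v \<tau>)) i \<phi>) has_real_derivative
      - (transport_term (diagonal_field (v t)) i \<phi> + stretching_term (diagonal_field (v t)) i \<phi>)) (at t within J)"
proof -
  note C = test_function_imp_compact_C1[OF \<phi>] and V = space_deriv[OF t] slope_continuous[OF t]
  have cv: "continuous_on UNIV (\<lambda>s. (v t s)\<^sup>2)" and cv': "continuous_on UNIV (\<lambda>s. (v' t s)\<^sup>2)"
    and cvv: "continuous_on UNIV (\<lambda>s. v t s * v' t s)"
    by (intro continuous_intros velocity_continuous slope_continuous t)+
  let ?I = "\<lambda>g \<psi>. \<integral>x. g (coordinate_sum x) * \<psi> x \<partial>(lborel :: (real^'n) measure)"
  have "?I (\<lambda>s. - d * v t s * v' t s - pressure_slope t s) (\<lambda>x. \<phi> x - laplacian \<phi> x)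
      = (\<integral>x. - d * (v t (coordinate_sum x) * v' t (coordinate_sum x) * (\<phi> x - laplacian \<phi> x))
          - pressure_slope t (coordinate_sum x) * (\<phi> x - laplacian \<phi> x) \<partial>lborel)"
    by (intro Bochner_Integration.integral_cong refl) (simp add: algebra_simps)
  also have "\<dots> = - d * ?I (\<lambda>s. v t s * v' t s) (\<lambda>x. \<phi> x - laplacian \<phi> x)
      - ?I (pressure_slope t) (\<lambda>x. \<phi> x - laplacian \<phi> x)"
    using integrable_helmholtz_test(1)[OF \<phi> cvv]
      integrable_helmholtz_test(1)[OF \<phi> pressure_slope_continuous[OF t]]
    by (subst Bochner_Integration.integral_diff) auto
  also have "?I (pressure_slope t) (\<lambda>x. \<phi> x - laplacian \<phi> x) = - ?I (source t) (partial_deriv i \<phi>)"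
    by (rule pressure_slope_helmholtz[OF \<phi> t dn])
  also have "?I (source t) (partial_deriv i \<phi>)
      = (\<integral>x. d * ((v t (coordinate_sum x))\<^sup>2 * partial_deriv i \<phi> x)
         + d\<^sup>2 / 2 * ((v' t (coordinate_sum x))\<^sup>2 * partial_deriv i \<phi> x) \<partial>lborel)"
    by (simp add: source_def distrib_right mult.assoc)
  also have "\<dots> = d * ?I (\<lambda>s. (v t s)\<^sup>2) (partial_deriv i \<phi>) + d\<^sup>2 / 2 * ?I (\<lambda>s. (v' t s)\<^sup>2) (partial_deriv i \<phi>)"
    using compact_C1_integrable(2)[OF C(1) continuous_on_coordinate_sum[OF cv]]
      compact_C1_integrable(2)[OF C(1) continuous_on_coordinate_sum[OF cv']]
    by (subst Bochner_Integration.integral_add) auto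
  also have "?I (\<lambda>s. v t s * v' t s) (\<lambda>x. \<phi> x - laplacian \<phi> x)
      = ?I (\<lambda>s. v t s * v' t s) \<phi> - ?I (\<lambda>s. v t s * v' t s) (laplacian \<phi>)"
    by (rule integrable_helmholtz_test(2)[OF \<phi> cvv])
  finally have "?I (\<lambda>s. - d * v t s * v' t s - pressure_slope t s) (\<lambda>x. \<phi> x - laplacian \<phi> x)
      = - (transport_term (diagonal_field (v t)) i \<phi> + stretching_term (diagonal_field (v t)) i \<phi>)"
    unfolding transport_term_diagonal_field[OF \<phi> V] stretching_term_diagonal_field[OF \<phi> V] dn[symmetric]
    by (simp add: algebra_simps)
  thus ?thesis using momentum_time_derivative[OF \<phi> t, of i] by simp
qed

end

section \<open>Strong solutions\<close>

lemma sobolev_imp_bounded_C1: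
  assumes s: "s > 3 / 2" and f: "f \<in> sobolev s" "continuous_on UNIV f"
  shows "(f has_real_derivative deriv f x) (at x)" and "continuous_on UNIV (deriv f)"
    and "\<exists>B. \<forall>x. \<bar>f x\<bar> \<le> B" and "\<exists>B. \<forall>x. \<bar>deriv f x\<bar> \<le> B"
proof -
  have "sobolev_norm_sq s f < \<infinity>" using f by (simp add: sobolev_def)
  then obtain r where r: "r \<ge> 0" "sobolev_norm_sq s f = ennreal r"
    by (cases "sobolev_norm_sq s f") auto
  hence less: "sobolev_norm_sq s f < ennreal (r + 1)" and pos: "r + 1 > 0"
    by (auto intro: ennreal_lessI)
  note C1 = sobolev_imp_C1[OF s f(2) less pos]
  show "(f has_real_derivative deriv f x) (at x)" "continuous_on UNIV (deriv f)" by (rule C1)+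
  show "\<exists>B. \<forall>x. \<bar>deriv f x\<bar> \<le> B" using C1(3) by blast
  have "s > 1 / 2" using s by simp
  from sobolev_imp_bounded[OF this f(2) less pos] show "\<exists>B. \<forall>x. \<bar>f x\<bar> \<le> B" by blast
qed

text \<open>\<open>N\<close> is a bound for the squared norm that the embedding constant \<open>C\<close> turns into a sup norm below \<open>e\<close>.\<close>

lemma sobolev_small_norm:
  assumes lim: "((\<lambda>\<tau>. sobolev_norm_sq s (g \<tau>)) \<longlongrightarrow> 0) F" and C: "C > 0" and e: "e > 0"
  obtains N where "N > 0" "C * sqrt N < e" "\<forall>\<^sub>F \<tau> in F. sobolev_norm_sq s (g \<tau>) < ennreal N"
proof
  define N where "N = (e / (2 * C))\<^sup>2"
  show N: "N > 0" using C e by (simp add: N_def)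
  show "C * sqrt N < e" using C e by (simp add: N_def real_sqrt_abs abs_of_pos)
  show "\<forall>\<^sub>F \<tau> in F. sobolev_norm_sq s (g \<tau>) < ennreal N"
    using N by (intro order_tendstoD(2)[OF lim]) simp
qed

lemma sobolev_limit_imp_uniform_limit:
  assumes s: "s > 1 / 2" and cont: "\<forall>\<^sub>F \<tau> in F. continuous_on UNIV (g \<tau>)"
    and lim: "((\<lambda>\<tau>. sobolev_norm_sq s (g \<tau>)) \<longlongrightarrow> 0) F"
  shows "uniform_limit UNIV g (\<lambda>x. 0) F"
proof (rule uniform_limitI)
  fix e :: real assume "e > 0"
  from sobolev_small_norm[OF lim sobolev_constant_pos this]
  obtain N where N: "N > 0" "sobolev_constant s * sqrt N < e"
    "\<forall>\<^sub>F \<tau> in F. sobolev_norm_sq s (g \<tau>) < ennreal N" by metis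
  from cont N(3) show "\<forall>\<^sub>F \<tau> in F. \<forall>x\<in>UNIV. dist (g \<tau> x) 0 < e"
  proof eventually_elim
    case (elim \<tau>)
    have "\<bar>g \<tau> x\<bar> < e" for x
      using sobolev_imp_bounded[OF s elim N(1), of x] N(2) by linarith
    thus ?case by simp
  qed
qed

lemma sobolev_limit_imp_uniform_limit_deriv:
  assumes s: "s > 3 / 2" and cont: "\<forall>\<^sub>F \<tau> in F. continuous_on UNIV (g \<tau>)"
    and lim: "((\<lambda>\<tau>. sobolev_norm_sq s (g \<tau>)) \<longlongrightarrow> 0) F"
  shows "uniform_limit UNIV (\<lambda>\<tau>. deriv (g \<tau>)) (\<lambda>x. 0) F"
proof (rule uniform_limitI)
  fix e :: real assume "e > 0"
  from sobolev_small_norm[OF lim sobolev_constant_pos this]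
  obtain N where N: "N > 0" "sobolev_constant (s - 1) * sqrt N < e"
    "\<forall>\<^sub>F \<tau> in F. sobolev_norm_sq s (g \<tau>) < ennreal N" by metis
  from cont N(3) show "\<forall>\<^sub>F \<tau> in F. \<forall>x\<in>UNIV. dist (deriv (g \<tau>) x) 0 < e"
  proof eventually_elim
    case (elim \<tau>)
    have "\<bar>deriv (g \<tau>) x\<bar> < e" for x
      using sobolev_imp_C1(3)[OF s elim N(1), of x] N(2) by linarith
    thus ?case by simp
  qed
qed

lemma uniform_limit_of_difference:
  fixes f :: "real \<Rightarrow> real \<Rightarrow> real"
  assumes "uniform_limit UNIV (\<lambda>\<tau> x. f \<tau> x - l x) (\<lambda>x. 0) F"
  shows "uniform_limit UNIV f l F"
  using uniform_limit_add[OF assms uniform_limit_const[where c=l]] by simp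

text \<open>The embedding is applied to the differences \<open>v \<tau> - v t\<close> with exponent \<open>s\<close>, and to the difference quotients minus the time
  derivative with exponent \<open>s - 1\<close>; all of them are continuous functions, as the embedding requires.\<close>

lemma strong_solution_imp_rod_solution:
  assumes d: "d > 0" and s: "s > 3 / 2" and sol: "strong_solution d s v0 T v"
  shows "rod_solution d {t. 0 \<le> t \<and> ereal t < T} v (\<lambda>t. deriv (v t))"
proof -
  let ?J = "{t. 0 \<le> t \<and> ereal t < T}"
  obtain w where v: "continuous_into_sobolev s T v" and w: "continuous_into_sobolev (s - 1) T w"
    and vw: "has_sobolev_time_derivative (s - 1) T v w"
    and eq: "\<And>t x. t \<in> ?J \<Longrightarrow> w t x + d * v t x * deriv (v t) x =
           - deriv (inverse_helmholtz d (\<lambda>y. d * (v t y)\<^sup>2 + d\<^sup>2 / 2 * (deriv (v t) y)\<^sup>2)) x"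
    using sol unfolding strong_solution_def by auto
  have vs: "v t \<in> sobolev s" and vc: "continuous_on UNIV (v t)"
    and vlim: "((\<lambda>\<tau>. sobolev_norm_sq s (\<lambda>x. v \<tau> x - v t x)) \<longlongrightarrow> 0) (at t within ?J)" if "t \<in> ?J" for t
    using v that unfolding continuous_into_sobolev_def by auto
  have wc: "continuous_on UNIV (w t)" if "t \<in> ?J" for t
    using w that unfolding continuous_into_sobolev_def by auto
  have wlim: "((\<lambda>\<tau>. sobolev_norm_sq (s - 1) (\<lambda>x. (v \<tau> x - v t x) / (\<tau> - t) - w t x)) \<longlongrightarrow> 0) (at t within ?J)"
    if "t \<in> ?J" for t
    using vw that unfolding has_sobolev_time_derivative_def by auto
  have s': "s > 1 / 2" "s - 1 > 1 / 2" using s by auto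
  note C1 = sobolev_imp_bounded_C1[OF s vs vc]
  have inJ: "\<forall>\<^sub>F \<tau> in at t within ?J. \<tau> \<in> ?J" for t by (simp add: eventually_at_filter)
  have contd: "\<forall>\<^sub>F \<tau> in at t within ?J. continuous_on UNIV (\<lambda>x. v \<tau> x - v t x)" if "t \<in> ?J" for t
    using inJ by eventually_elim (intro continuous_intros vc that)
  show ?thesis
  proof (unfold_locales; (rule d)?)
    fix t assume t: "t \<in> ?J"
    show "(v t has_real_derivative deriv (v t) x) (at x)" for x by (rule C1(1)[OF t t])
    show "continuous_on UNIV (deriv (v t))" by (rule C1(2)[OF t t])
    show "\<exists>B. \<forall>x. \<bar>v t x\<bar> \<le> B" by (rule C1(3)[OF t t])
    show "\<exists>B. \<forall>x. \<bar>deriv (v t) x\<bar> \<le> B" by (rule C1(4)[OF t t])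
    show "uniform_limit UNIV v (v t) (at t within ?J)"
      by (rule uniform_limit_of_difference)
         (rule sobolev_limit_imp_uniform_limit[OF s'(1) contd[OF t] vlim[OF t]])
    show "uniform_limit UNIV (\<lambda>t. deriv (v t)) (deriv (v t)) (at t within ?J)"
    proof (rule uniform_limit_of_difference)
      have lim: "uniform_limit UNIV (\<lambda>\<tau>. deriv (\<lambda>x. v \<tau> x - v t x)) (\<lambda>x. 0) (at t within ?J)"
        by (rule sobolev_limit_imp_uniform_limit_deriv[OF s contd[OF t] vlim[OF t]])
      have diff: "\<forall>\<^sub>F \<tau> in at t within ?J. \<forall>x\<in>UNIV.
          deriv (\<lambda>x. v \<tau> x - v t x) x = deriv (v \<tau>) x - deriv (v t) x"
        using inJ
      proof eventually_elim
        case (elim \<tau>)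
        show ?case
          by (intro ballI DERIV_imp_deriv DERIV_diff C1(1)[OF elim elim] C1(1)[OF t t])
      qed
      show "uniform_limit UNIV (\<lambda>\<tau> x. deriv (v \<tau>) x - deriv (v t) x) (\<lambda>x. 0) (at t within ?J)"
        by (rule iffD1[OF uniform_limit_cong[OF diff refl] lim])
    qed
    have "\<forall>\<^sub>F \<tau> in at t within ?J. continuous_on UNIV (\<lambda>x. (v \<tau> x - v t x) / (\<tau> - t) - w t x)"
      using inJ by eventually_elim (simp add: divide_inverse, intro continuous_intros vc wc t, auto)
    from uniform_limit_of_difference[OF sobolev_limit_imp_uniform_limit[OF s'(2) this wlim[OF t]]]
    have "uniform_limit UNIV (\<lambda>\<tau> x. (v \<tau> x - v t x) / (\<tau> - t)) (w t) (at t within ?J)" .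
    moreover have "w t = (\<lambda>x. - d * v t x * deriv (v t) x
        - deriv (inverse_helmholtz d (\<lambda>y. d * (v t y)\<^sup>2 + d\<^sup>2 / 2 * (deriv (v t) y)\<^sup>2)) x)"
    proof
      show "w t x = - d * v t x * deriv (v t) x
        - deriv (inverse_helmholtz d (\<lambda>y. d * (v t y)\<^sup>2 + d\<^sup>2 / 2 * (deriv (v t) y)\<^sup>2)) x" for x
        using eq[OF t, of x] by linarith
    qed
    ultimately show "uniform_limit UNIV (\<lambda>\<tau> x. (v \<tau> x - v t x) / (\<tau> - t))
        (\<lambda>x. - d * v t x * deriv (v t) x
        - deriv (inverse_helmholtz d (\<lambda>y. d * (v t y)\<^sup>2 + d\<^sup>2 / 2 * (deriv (v t) y)\<^sup>2)) x) (at t within ?J)"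
      by simp
  qed
qed

theorem corollary1p2:
  fixes s x0 :: real and v0 :: "real \<Rightarrow> real"
    and u0 :: "real^'n \<Rightarrow> real^'n"
    and T :: ereal and v :: "real \<Rightarrow> real \<Rightarrow> real"
    and u :: "real \<Rightarrow> real^'n \<Rightarrow> real^'n"
  assumes "s > 3 / 2"
    and "v0 \<in> sobolev s" and "continuous_on UNIV v0"
    and "deriv v0 x0 < - (1 / sqrt (real CARD('n))) * \<bar>v0 x0\<bar>"
    and "u0 = diagonal_field v0"
    and "maximal_strong_solution (real CARD('n)) s v0 T v"
    and "\<And>t. u t = diagonal_field (v t)"
  shows "euler_poincare_solution T u0 u \<and> T < \<infinity>"
proof
  let ?J = "{t. 0 \<le> t \<and> ereal t < T}"
  have sol: "strong_solution (real CARD('n)) s v0 T v"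
    using assms(6) by (simp add: maximal_strong_solution_def)
  have v0: "v 0 = v0" using sol by (simp add: strong_solution_def)
  interpret rod_solution "real CARD('n)" ?J v "\<lambda>t. deriv (v t)"
    by (rule strong_solution_imp_rod_solution[OF _ assms(1) sol]) simp
  show "T < \<infinity>"
  proof (rule ccontr)
    assume "\<not> T < \<infinity>"
    hence "{0..} \<subseteq> ?J" by auto
    thus False using not_global assms(4) unfolding v0 by blast
  qed
  have e: "diagonal_field f x $ i = f (coordinate_sum x)" for f and x :: "real^'n" and i
    by (simp add: diagonal_field_def coordinate_sum_def)
  have C1: "times_cont_diff 1 (\<lambda>x. u t x $ i)" if "t \<in> ?J" for t i
  proof -
    have "partial_deriv k (\<lambda>x::real^'n. v t (coordinate_sum x)) = (\<lambda>x. deriv (v t) (coordinate_sum x))" for k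
      using partial_deriv_plane_wave[OF space_deriv[OF that]] by auto
    thus ?thesis
      unfolding assms(7) e One_nat_def times_cont_diff.simps
      by (simp add: plane_wave_differentiable[OF space_deriv[OF that]]
          continuous_on_coordinate_sum[OF slope_continuous[OF that]])
  qed
  have eqn: "((\<lambda>\<tau>. momentum (u \<tau>) i \<phi>) has_real_derivative
      - (transport_term (u t) i \<phi> + stretching_term (u t) i \<phi>)) (at t within ?J)"
    if "t \<in> ?J" "test_function \<phi>" for t i \<phi>
    unfolding assms(7) by (rule momentum_equation[OF that(2,1) refl])
  show "euler_poincare_solution T u0 u"
    unfolding euler_poincare_solution_def using C1 eqn assms(5,7) v0 by auto
qed

end
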